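(* Let $v\in V(0)$. Then $T_\chi(v)=\sum_{k=1}^{14}T^k_\chi(v)$, where (with $\eta,\tau$ standing for $\pi(\eta),\pi(\tau)$) \begin{align*} T^1_\chi(v)&=q^2\!\!\int\limits_{z\in{\mathfrak o}}\int\limits_{x\in{\mathfrak o}^\times}\int\limits_{b\in{\mathfrak o}^\times}\int\limits_{a\in{\mathfrak o}^\times}\!\!\chi(ab)\,\pi\big(X(-(a+xb)\varpi^{-1})\,Y(b\varpi^{-2},z\varpi^{-4},x^{-1}\varpi^{-1})\big)v,\\ T^2_\chi(v)&=q\,\eta\!\!\int\limits_{y\in{\mathfrak o}^\times\setminus(1+\mathfrak p)}\int\limits_{b\in{\mathfrak o}^\times}\int\limits_{a\in{\mathfrak o}^\times}\int\limits_{x\in{\mathfrak o}^\times\setminus(1+\mathfrak p)}\!\!\chi(abxy)\,\pi\big(X(b\varpi^{-1})\,Y(-a\varpi^{-2},\,ab(1-(1-y)^{-1}x)\varpi^{-3},\,ab^{-1}(1-x)^{-1}\varpi^{-1})\big)v,\\ T^3_\chi(v)&=\eta\!\!\int\limits_{z\in{\mathfrak o}^\times\setminus(1+\mathfrak p)}\int\limits_{b\in{\mathfrak o}^\times}\int\limits_{a\in{\mathfrak o}^\times}\!\!\chi(b(1-z))\,\pi\big(Y(a\varpi^{-2},b\varpi^{-3},a^2b^{-1}z\varpi^{-1})\big)v,\\ T^4_\chi(v)&=q\,\eta\!\!\int\limits_{x\in{\mathfrak o}^\times}\int\limits_{b\in{\mathfrak o}^\times}\int\limits_{a\in{\mathfrak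 o}}\!\!\chi(b)\,\pi\big(X(x\varpi^{-2})\,Y(a\varpi^{-2},(b\varpi-ax)\varpi^{-4},0)\big)v,\\ T^5_\chi(v)&=\eta\!\!\int\limits_{x\in{\mathfrak o}}\int\limits_{b\in{\mathfrak o}^\times}\int\limits_{a\in{\mathfrak o}^\times}\!\!\chi(b)\,\pi\big(X(x\varpi^{-1})\,Y(a\varpi^{-2},(b-ax)\varpi^{-3},0)\big)v,\\ T^6_\chi(v)&=q^{-1}\eta^2\!\!\int\limits_{x,b,a\in{\mathfrak o}^\times}\!\!\chi(bx)\,\pi\big(Y(a\varpi^{-2},b(1-x\varpi)\varpi^{-2},a^2b^{-1}\varpi^{-2})\big)v,\\ T^7_\chi(v)&=q\,\tau\!\!\int\limits_{z\in{\mathfrak o}}\int\limits_{b\in{\mathfrak o}^\times}\int\limits_{a\in{\mathfrak o}^\times}\!\!\chi(ab)\,\pi\big(X(-a\varpi^{-2})\,Y(b\varpi^{-1},z\varpi^{-4},0)\big)v,\\ T^8_\chi(v)&=\eta\tau\!\!\int\limits_{z\in{\mathfrak o}^\times\setminus(1+\mathfrak p)}\int\limits_{b\in{\mathfrak o}^\times}\int\limits_{a\in{\mathfrak o}^\times}\!\!\chi(abz(1-z))\,\pi\big(X(b\varpi^{-2})\,Y(a\varpi^{-1},-ab(1-z)\varpi^{-3},0)\big)v,\\ T^9_\chi(v)&=q^{-2}\eta^2\tau\!\!\int\limits_{x,b,a\in{\mathfrak o}^\times}\!\!\chi(b)\,\pi\big(X(a\varpi^{-1})\,Y(0,-b\varpi^{-1},x\varpi^{-1})\big)v,\\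 T^{10}_\chi(v)&=q^{-3}\eta^2\tau^2\!\!\int\limits_{b,a\in{\mathfrak o}^\times}\!\!\chi(b)\,\pi\big(X(a\varpi^{-2})\,Y(0,-b\varpi^{-1},0)\big)v,\\ T^{11}_\chi(v)&=q^3\tau^{-1}\!\!\int\limits_{z\in{\mathfrak o}}\int\limits_{x\in{\mathfrak o}}\int\limits_{b\in{\mathfrak o}^\times}\int\limits_{a\in{\mathfrak o}^\times}\!\!\chi(ab)\,\pi\big(X(b\varpi^{-1})\,Y((xb+a\varpi)\varpi^{-3},z\varpi^{-4},-x\varpi^{-2})\big)v,\\ T^{12}_\chi(v)&=q^2\eta\tau^{-1}\!\!\int\limits_{z\in{\mathfrak o}^\times\setminus(1+\mathfrak p)}\int\limits_{y\in{\mathfrak o}}\int\limits_{b\in{\mathfrak o}^\times}\int\limits_{a\in{\mathfrak o}^\times}\!\!\chi(abz(1-z))\,\pi\big(X(a\varpi^{-1})\,Y(y\varpi^{-3},\,a(b(1-z)\varpi-y)\varpi^{-4},\,-a^{-1}(y+b\varpi)\varpi^{-2})\big)v,\\ T^{13}_\chi(v)&=\eta^2\tau^{-1}\!\!\int\limits_{x,b,a\in{\mathfrak o}^\times}\!\!\chi(bx)\,\pi\big(Y(a\varpi^{-2},b(1-x)\varpi^{-1},a^2b^{-1}\varpi^{-3})\big)v,\\ T^{14}_\chi(v)&=q\,\eta^2\tau^{-2}\!\!\int\limits_{x\in{\mathfrak o}}\int\limits_{b\in{\mathfrak o}^\times}\int\limits_{a\in{\mathfrak o}^\times}\!\!\chi(b)\,\pi\big(Y(a\varpi^{-2},-b\varpi^{-1},x\varpi^{-4})\big)v.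 \end{align*}
   Context: $F$ is a nonarchimedean local field of characteristic zero with ring of integers ${\mathfrak o}$, uniformizer $\varpi$, maximal ideal $\mathfrak p$, residue field of order $q$. Integrals use the additive Haar measure on $F$ with ${\rm vol}({\mathfrak o})=1$ (restricted to subsets such as ${\mathfrak o}^\times$); integrands are locally constant with compact support, so integrals are finite sums. $\chi$ is a quadratic character of $F^\times$ of conductor $\mathfrak p$ (so $\chi\ne1$, $\chi^2=1$, $\chi(1+\mathfrak p)=1$). Here ${\rm GSp}(4,F)$ is the group of $g\in{\rm GL}(4,F)$ with ${}^tgJ'g=\lambda(g)J'$, $J'=\begin{bmatrix}&&&1\\&&1&\\&-1&&\\-1&&&\end{bmatrix}$. $\mathrm K(\mathfrak p^n)$ is the set of $k\in{\rm GSp}(4,F)$ with $\lambda(k)\in{\mathfrak o}^\times$ and $k\in\begin{bmatrix}{\mathfrak o}&{\mathfrak o}&{\mathfrak o}&\mathfrak p^{-n}\\\mathfrak p^n&{\mathfrak o}&{\mathfrak o}&{\mathfrak o}\\\mathfrak p^n&{\mathfrak o}&{\mathfrak o}&{\mathfrak o}\\\mathfrak p^n&\mathfrak p^n&\mathfrak p^n&{\mathfrak o}\end{bmatrix}$. $(\pi,V)$ is a smooth representation of ${\rm GSp}(4,F)$ with trivial central action; $V(n)$ is the space of $\mathrm K(\mathfrak p^n)$-fixed vectors and $V(n,\chi)$ the space of $v$ with $\pi(k)v=\chi(\lambda(k))v$ for $k\in\mathrm K(\mathfrak p^n)$. Put $\eta={\rm diag}(\varpi^{-1},1,1,\varpi)$,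 $\tau={\rm diag}(1,\varpi^{-1},\varpi,1)$, $t_4=\begin{bmatrix}&&&-\varpi^{-4}\\&1&&\\&&1&\\\varpi^4&&&\end{bmatrix}$, $s_1=\begin{bmatrix}1&&&\\&&1&\\&-1&&\\&&&1\end{bmatrix}$, $L(x)=\begin{bmatrix}1&&&\\&1&&\\&x&1&\\&&&1\end{bmatrix}$, $n(a,b,c)=\begin{bmatrix}1&-a\varpi^{-1}&b\varpi^{-2}&c\\&1&&b\varpi^{-2}\\&&1&a\varpi^{-1}\\&&&1\end{bmatrix}$, $X(s)=\begin{bmatrix}1&s&&\\&1&&\\&&1&-s\\&&&1\end{bmatrix}$, $Y(r,s,t)=\begin{bmatrix}1&&r&s\\&1&t&r\\&&1&\\&&&1\end{bmatrix}$. The twisting operator $T_\chi:V(0)\to V(4,\chi)$ is $T_\chi(v)=q^3\int_{z\in{\mathfrak o}}\int_{x\in{\mathfrak o}}\int_{b\in{\mathfrak o}^\times}\int_{a\in{\mathfrak o}^\times}\chi(ab)\pi(L(x)n(a,b,z\varpi^{-4}))\pi(\tau)v\,+\,q^3\int_{z\in{\mathfrak o}}\int_{y\in\mathfrak p}\int_{b\in{\mathfrak o}^\times}\int_{a\in{\mathfrak o}^\times}\chi(ab)\pi(s_1L(y)n(a,b,z\varpi^{-4}))\pi(\tau)v\,+\,q^2\int_{z\in{\mathfrak o}}\int_{x\in{\mathfrak o}}\int_{b\in{\mathfrak o}^\times}\int_{a\in{\mathfrak o}^\times}\chi(ab)\pi(t_4L(x)n(a,b,z\varpi^{-3}))\pi(\tau)v\,+\,q^2\int_{z\in{\mathfrak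 o}}\int_{y\in\mathfrak p}\int_{b\in{\mathfrak o}^\times}\int_{a\in{\mathfrak o}^\times}\chi(ab)\pi(t_4s_1L(y)n(a,b,z\varpi^{-3}))\pi(\tau)v$. *)

theory Defs
  imports "HOL-Analysis.Analysis"
begin

text \<open>The local field F is a type 'f of characteristic zero (class field_char_0),
equipped with a normalized discrete valuation ord (ord 0 is irrelevant),
a uniformizer w (ord w = 1), finite residue field of order q, and complete.\<close>

definition pideal :: "('f::field \<Rightarrow> int) \<Rightarrow> int \<Rightarrow> 'f set" where
  "pideal ord n = {x. x = 0 \<or> n \<le> ord x}"

definition Oo :: "('f::field \<Rightarrow> int) \<Rightarrow> 'f set" where
  "Oo ord = pideal ord 0"

definition Pp :: "('f::field \<Rightarrow> int) \<Rightarrow> 'f set" where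
  "Pp ord = pideal ord 1"

definition Ounits :: "('f::field \<Rightarrow> int) \<Rightarrow> 'f set" where
  "Ounits ord = {x. x \<noteq> 0 \<and> ord x = 0}"

definition Ounits1 :: "('f::field \<Rightarrow> int) \<Rightarrow> 'f set" where
  "Ounits1 ord = Ounits ord - (\<lambda>y. 1 + y) ` Pp ord"

definition reps :: "('f::field \<Rightarrow> int) \<Rightarrow> nat \<Rightarrow> 'f set \<Rightarrow> bool" where
  "reps ord N R \<longleftrightarrow> R \<subseteq> Oo ord \<and> (\<forall>x\<in>Oo ord. \<exists>!r. r \<in> R \<and> x - r \<in> pideal ord (int N))"

definition nonarch_local_field :: "('f::field_char_0 \<Rightarrow> int) \<Rightarrow> 'f \<Rightarrow> nat \<Rightarrow> bool" where
  "nonarch_local_field ord w q \<longleftrightarrow>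
     (\<forall>x y. x \<noteq> 0 \<longrightarrow> y \<noteq> 0 \<longrightarrow> ord (x * y) = ord x + ord y) \<and>
     (\<forall>x y. x \<noteq> 0 \<longrightarrow> y \<noteq> 0 \<longrightarrow> x + y \<noteq> 0 \<longrightarrow> min (ord x) (ord y) \<le> ord (x + y)) \<and>
     w \<noteq> 0 \<and> ord w = 1 \<and>
     (\<exists>R. finite R \<and> card R = q \<and> reps ord 1 R) \<and>
     (\<forall>s::nat \<Rightarrow> 'f. (\<forall>n. \<exists>N. \<forall>m\<ge>N. \<forall>k\<ge>N. s m - s k \<in> pideal ord n) \<longrightarrow>
        (\<exists>L. \<forall>n. \<exists>N. \<forall>m\<ge>N. s m - L \<in> pideal ord n))"

definition quad_char_cond_p :: "('f::field \<Rightarrow> int) \<Rightarrow> ('f \<Rightarrow> real) \<Rightarrow> bool" where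
  "quad_char_cond_p ord chi \<longleftrightarrow>
     (\<forall>x y. x \<noteq> 0 \<longrightarrow> y \<noteq> 0 \<longrightarrow> chi (x * y) = chi x * chi y) \<and>
     (\<forall>x. x \<noteq> 0 \<longrightarrow> (chi x)\<^sup>2 = 1) \<and>
     (\<forall>y\<in>Pp ord. chi (1 + y) = 1) \<and>
     (\<exists>u\<in>Ounits ord. chi u \<noteq> 1)"

text \<open>Integral over a subset S of o (a union of cosets of p^N) of a function that is
invariant under translation by p^N on S, w.r.t. Haar measure with vol(o) = 1:
each coset of p^N has volume 1/[o : p^N].\<close>
definition integ :: "('f::field \<Rightarrow> int) \<Rightarrow> 'f set \<Rightarrow> ('f \<Rightarrow> 'v::real_vector) \<Rightarrow> 'v" where
  "integ ord S f = (THE I. \<exists>N::nat. S \<subseteq> Oo ord \<and>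
       (\<forall>x\<in>S. \<forall>y. x - y \<in> pideal ord (int N) \<longrightarrow> y \<in> S) \<and>
       (\<forall>x\<in>S. \<forall>y\<in>S. x - y \<in> pideal ord (int N) \<longrightarrow> f x = f y) \<and>
       (\<forall>R. reps ord N R \<longrightarrow> I = (1 / real (card R)) *\<^sub>R (\<Sum>r\<in>R \<inter> S. f r)))"

definition M4 :: "'a list list \<Rightarrow> 'a^4^4" where
  "M4 rs = (\<chi> i j. rs ! nat (Rep_bit0 i) ! nat (Rep_bit0 j))"

definition Jp :: "'a::comm_ring_1^4^4" where
  "Jp = M4 [[0,0,0,1],[0,0,1,0],[0,-1,0,0],[-1,0,0,0]]"

definition GSp4 :: "('f::field^4^4) set" where
  "GSp4 = {g. \<exists>l. l \<noteq> 0 \<and> transpose g ** Jp ** g = mat l ** Jp}"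

definition simil :: "'f::field^4^4 \<Rightarrow> 'f" where
  "simil g = (THE l. transpose g ** Jp ** g = mat l ** Jp)"

definition kexp :: "nat \<Rightarrow> int list list" where
  "kexp n = [[0,0,0,- int n],[int n,0,0,0],[int n,0,0,0],[int n,int n,int n,0]]"

definition Kpara :: "('f::field \<Rightarrow> int) \<Rightarrow> nat \<Rightarrow> ('f^4^4) set" where
  "Kpara ord n = {k \<in> GSp4. simil k \<in> Ounits ord \<and>
      (\<forall>i j. k $ i $ j \<in> pideal ord (kexp n ! nat (Rep_bit0 i) ! nat (Rep_bit0 j)))}"

text \<open>Smooth representation of GSp(4,F) with trivial central character on a real
vector space (complex representations are included by restriction of scalars).\<close>
definition smooth_rep_trivcent ::
  "('f::field \<Rightarrow> int) \<Rightarrow> ('f^4^4 \<Rightarrow> 'v::real_vector \<Rightarrow> 'v) \<Rightarrow> bool" where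
  "smooth_rep_trivcent ord rho \<longleftrightarrow>
     (\<forall>g\<in>GSp4. linear (rho g)) \<and>
     (\<forall>g\<in>GSp4. \<forall>h\<in>GSp4. rho (g ** h) = rho g \<circ> rho h) \<and>
     rho (mat 1) = id \<and>
     (\<forall>c. c \<noteq> 0 \<longrightarrow> rho (mat c) = id) \<and>
     (\<forall>v. \<exists>n::nat. \<forall>k\<in>GSp4. (\<forall>i j. k $ i $ j - mat 1 $ i $ j \<in> pideal ord (int n)) \<longrightarrow> rho k v = v)"

definition Vchi :: "('f::field \<Rightarrow> int) \<Rightarrow> ('f^4^4 \<Rightarrow> 'v::real_vector \<Rightarrow> 'v) \<Rightarrow> nat \<Rightarrow> ('f \<Rightarrow> real) \<Rightarrow> 'v set" where
  "Vchi ord rho n chi = {v. \<forall>k\<in>Kpara ord n. rho k v = chi (simil k) *\<^sub>R v}"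

definition Vfix :: "('f::field \<Rightarrow> int) \<Rightarrow> ('f^4^4 \<Rightarrow> 'v::real_vector \<Rightarrow> 'v) \<Rightarrow> nat \<Rightarrow> 'v set" where
  "Vfix ord rho n = {v. \<forall>k\<in>Kpara ord n. rho k v = v}"

definition etaM :: "'f::field \<Rightarrow> 'f^4^4" where
  "etaM w = M4 [[inverse w,0,0,0],[0,1,0,0],[0,0,1,0],[0,0,0,w]]"
definition tauM :: "'f::field \<Rightarrow> 'f^4^4" where
  "tauM w = M4 [[1,0,0,0],[0,inverse w,0,0],[0,0,w,0],[0,0,0,1]]"
definition t4M :: "'f::field \<Rightarrow> 'f^4^4" where
  "t4M w = M4 [[0,0,0,- (w powi (-4))],[0,1,0,0],[0,0,1,0],[w ^ 4,0,0,0]]"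
definition s1M :: "'f::field^4^4" where
  "s1M = M4 [[1,0,0,0],[0,0,1,0],[0,-1,0,0],[0,0,0,1]]"
definition LM :: "'f::field \<Rightarrow> 'f^4^4" where
  "LM x = M4 [[1,0,0,0],[0,1,0,0],[0,x,1,0],[0,0,0,1]]"
definition nM :: "'f::field \<Rightarrow> 'f \<Rightarrow> 'f \<Rightarrow> 'f \<Rightarrow> 'f^4^4" where
  "nM w a b c = M4 [[1, - a * w powi (-1), b * w powi (-2), c],
                    [0,1,0, b * w powi (-2)],[0,0,1, a * w powi (-1)],[0,0,0,1]]"
definition XM :: "'f::field \<Rightarrow> 'f^4^4" where
  "XM s = M4 [[1,s,0,0],[0,1,0,0],[0,0,1,-s],[0,0,0,1]]"
definition YM :: "'f::field \<Rightarrow> 'f \<Rightarrow> 'f \<Rightarrow> 'f^4^4" where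
  "YM r s t = M4 [[1,0,r,s],[0,1,t,r],[0,0,1,0],[0,0,0,1]]"

context
  fixes ord :: "'f::field_char_0 \<Rightarrow> int" and w :: 'f and q :: nat
    and chi :: "'f \<Rightarrow> real" and rho :: "'f^4^4 \<Rightarrow> 'v::real_vector \<Rightarrow> 'v"
begin

definition Tchi :: "'v \<Rightarrow> 'v" where
  "Tchi v =
     real q ^ 3 *\<^sub>R integ ord (Oo ord) (\<lambda>z. integ ord (Oo ord) (\<lambda>x. integ ord (Ounits ord) (\<lambda>b.
        integ ord (Ounits ord) (\<lambda>a. chi (a * b) *\<^sub>R
          rho (LM x ** nM w a b (z * w powi (-4))) (rho (tauM w) v)))))
   + real q ^ 3 *\<^sub>R integ ord (Oo ord) (\<lambda>z. integ ord (Pp ord) (\<lambda>y. integ ord (Ounits ord) (\<lambda>b.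
        integ ord (Ounits ord) (\<lambda>a. chi (a * b) *\<^sub>R
          rho (s1M ** LM y ** nM w a b (z * w powi (-4))) (rho (tauM w) v)))))
   + real q ^ 2 *\<^sub>R integ ord (Oo ord) (\<lambda>z. integ ord (Oo ord) (\<lambda>x. integ ord (Ounits ord) (\<lambda>b.
        integ ord (Ounits ord) (\<lambda>a. chi (a * b) *\<^sub>R
          rho (t4M w ** LM x ** nM w a b (z * w powi (-3))) (rho (tauM w) v)))))
   + real q ^ 2 *\<^sub>R integ ord (Oo ord) (\<lambda>z. integ ord (Pp ord) (\<lambda>y. integ ord (Ounits ord) (\<lambda>b.
        integ ord (Ounits ord) (\<lambda>a. chi (a * b) *\<^sub>R
          rho (t4M w ** s1M ** LM y ** nM w a b (z * w powi (-3))) (rho (tauM w) v)))))"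

definition T1 :: "'v \<Rightarrow> 'v" where
  "T1 v = real q ^ 2 *\<^sub>R integ ord (Oo ord) (\<lambda>z. integ ord (Ounits ord) (\<lambda>x.
     integ ord (Ounits ord) (\<lambda>b. integ ord (Ounits ord) (\<lambda>a. chi (a * b) *\<^sub>R
       rho (XM (- (a + x * b) * w powi (-1)) **
           YM (b * w powi (-2)) (z * w powi (-4)) (inverse x * w powi (-1))) v))))"

definition T2 :: "'v \<Rightarrow> 'v" where
  "T2 v = real q *\<^sub>R rho (etaM w) (integ ord (Ounits1 ord) (\<lambda>y. integ ord (Ounits ord) (\<lambda>b.
     integ ord (Ounits ord) (\<lambda>a. integ ord (Ounits1 ord) (\<lambda>x. chi (a * b * x * y) *\<^sub>R
       rho (XM (b * w powi (-1)) **
           YM (- a * w powi (-2)) (a * b * (1 - inverse (1 - y) * x) * w powi (-3))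
              (a * inverse b * inverse (1 - x) * w powi (-1))) v)))))"

definition T3 :: "'v \<Rightarrow> 'v" where
  "T3 v = rho (etaM w) (integ ord (Ounits1 ord) (\<lambda>z. integ ord (Ounits ord) (\<lambda>b.
     integ ord (Ounits ord) (\<lambda>a. chi (b * (1 - z)) *\<^sub>R
       rho (YM (a * w powi (-2)) (b * w powi (-3)) (a ^ 2 * inverse b * z * w powi (-1))) v))))"

definition T4 :: "'v \<Rightarrow> 'v" where
  "T4 v = real q *\<^sub>R rho (etaM w) (integ ord (Ounits ord) (\<lambda>x. integ ord (Ounits ord) (\<lambda>b.
     integ ord (Oo ord) (\<lambda>a. chi b *\<^sub>R
       rho (XM (x * w powi (-2)) ** YM (a * w powi (-2)) ((b * w - a * x) * w powi (-4)) 0) v))))"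

definition T5 :: "'v \<Rightarrow> 'v" where
  "T5 v = rho (etaM w) (integ ord (Oo ord) (\<lambda>x. integ ord (Ounits ord) (\<lambda>b.
     integ ord (Ounits ord) (\<lambda>a. chi b *\<^sub>R
       rho (XM (x * w powi (-1)) ** YM (a * w powi (-2)) ((b - a * x) * w powi (-3)) 0) v))))"

definition T6 :: "'v \<Rightarrow> 'v" where
  "T6 v = inverse (real q) *\<^sub>R rho (etaM w ** etaM w) (integ ord (Ounits ord) (\<lambda>x.
     integ ord (Ounits ord) (\<lambda>b. integ ord (Ounits ord) (\<lambda>a. chi (b * x) *\<^sub>R
       rho (YM (a * w powi (-2)) (b * (1 - x * w) * w powi (-2)) (a ^ 2 * inverse b * w powi (-2))) v))))"

definition T7 :: "'v \<Rightarrow> 'v" where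
  "T7 v = real q *\<^sub>R rho (tauM w) (integ ord (Oo ord) (\<lambda>z. integ ord (Ounits ord) (\<lambda>b.
     integ ord (Ounits ord) (\<lambda>a. chi (a * b) *\<^sub>R
       rho (XM (- a * w powi (-2)) ** YM (b * w powi (-1)) (z * w powi (-4)) 0) v))))"

definition T8 :: "'v \<Rightarrow> 'v" where
  "T8 v = rho (etaM w ** tauM w) (integ ord (Ounits1 ord) (\<lambda>z. integ ord (Ounits ord) (\<lambda>b.
     integ ord (Ounits ord) (\<lambda>a. chi (a * b * z * (1 - z)) *\<^sub>R
       rho (XM (b * w powi (-2)) ** YM (a * w powi (-1)) (- a * b * (1 - z) * w powi (-3)) 0) v))))"

definition T9 :: "'v \<Rightarrow> 'v" where
  "T9 v = inverse (real q ^ 2) *\<^sub>R rho (etaM w ** etaM w ** tauM w) (integ ord (Ounits ord) (\<lambda>x.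
     integ ord (Ounits ord) (\<lambda>b. integ ord (Ounits ord) (\<lambda>a. chi b *\<^sub>R
       rho (XM (a * w powi (-1)) ** YM 0 (- b * w powi (-1)) (x * w powi (-1))) v))))"

definition T10 :: "'v \<Rightarrow> 'v" where
  "T10 v = inverse (real q ^ 3) *\<^sub>R rho (etaM w ** etaM w ** tauM w ** tauM w)
     (integ ord (Ounits ord) (\<lambda>b. integ ord (Ounits ord) (\<lambda>a. chi b *\<^sub>R
       rho (XM (a * w powi (-2)) ** YM 0 (- b * w powi (-1)) 0) v)))"

definition T11 :: "'v \<Rightarrow> 'v" where
  "T11 v = real q ^ 3 *\<^sub>R rho (matrix_inv (tauM w)) (integ ord (Oo ord) (\<lambda>z. integ ord (Oo ord) (\<lambda>x.
     integ ord (Ounits ord) (\<lambda>b. integ ord (Ounits ord) (\<lambda>a. chi (a * b) *\<^sub>R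
       rho (XM (b * w powi (-1)) **
           YM ((x * b + a * w) * w powi (-3)) (z * w powi (-4)) (- x * w powi (-2))) v)))))"

definition T12 :: "'v \<Rightarrow> 'v" where
  "T12 v = real q ^ 2 *\<^sub>R rho (etaM w ** matrix_inv (tauM w)) (integ ord (Ounits1 ord) (\<lambda>z.
     integ ord (Oo ord) (\<lambda>y. integ ord (Ounits ord) (\<lambda>b. integ ord (Ounits ord) (\<lambda>a.
       chi (a * b * z * (1 - z)) *\<^sub>R
       rho (XM (a * w powi (-1)) **
           YM (y * w powi (-3)) (a * (b * (1 - z) * w - y) * w powi (-4))
              (- inverse a * (y + b * w) * w powi (-2))) v)))))"

definition T13 :: "'v \<Rightarrow> 'v" where
  "T13 v = rho (etaM w ** etaM w ** matrix_inv (tauM w)) (integ ord (Ounits ord) (\<lambda>x.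
     integ ord (Ounits ord) (\<lambda>b. integ ord (Ounits ord) (\<lambda>a. chi (b * x) *\<^sub>R
       rho (YM (a * w powi (-2)) (b * (1 - x) * w powi (-1)) (a ^ 2 * inverse b * w powi (-3))) v))))"

definition T14 :: "'v \<Rightarrow> 'v" where
  "T14 v = real q *\<^sub>R rho (etaM w ** etaM w ** matrix_inv (tauM w) ** matrix_inv (tauM w))
     (integ ord (Oo ord) (\<lambda>x. integ ord (Ounits ord) (\<lambda>b. integ ord (Ounits ord) (\<lambda>a.
       chi b *\<^sub>R rho (YM (a * w powi (-2)) (- b * w powi (-1)) (x * w powi (-4))) v))))"

end

end

theory Submission
  imports Defs
begin

text \<open>Every integral in sight is, for all large \<open>n\<close>, an average over residues modulo \<open>\<pp>\<^sup>n\<close>, so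
  identities between integrals follow from bijections that preserve congruences modulo every
  \<open>\<pp>\<^sup>n\<close>, together with the rescaling \<open>z = w z'\<close> of \<open>\<pp>\<close>, which costs a factor \<open>1/q\<close>.
  As \<open>v\<close> is fixed by the integral symplectic matrices, \<open>g \<mapsto> rho g v\<close> factors
  through cosets modulo these, and each matrix can be brought into Iwasawa form
  \<open>diag(d1, d2, 1/d2, 1/d1) X(s) Y(r, u, t)\<close>.

  The two cells with and without \<open>s1\<close> together split according to whether \<open>x\<close> is a unit, a
  unit times \<open>w\<close>, or divisible by \<open>w\<^sup>2\<close>.  For the half of the operator without \<open>t4\<close> the three
  pieces are T11, T1 and T7 after a shift of \<open>z\<close>.  In the half with \<open>t4\<close> each piece is split
  further according to which of \<open>z\<close>, \<open>z + ab\<close>, \<open>a + xb\<close> and \<open>zx + (a + xb)a\<close> are units; this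
  determines the Iwasawa form, and a rational change of variables with unit denominators
  identifies the part with one of the remaining terms or with a part of T2, T5 or T13.\<close>

text \<open>The substitutions are rational maps mixing up to four variables and do not split into
  one-variable steps, so all four variables are replaced at once; a bijection respecting congruences
  in both directions permutes residues and needs no Jacobian. The level from which an integrand is
  invariant depends on the integrand, so identities are stated for all large \<open>n\<close> and
  combined through the filter \<open>sequentially\<close>. The diagonal of the Iwasawa form is
  forced up to units: \<open>1/d1\<close> generates the fractional ideal of the entries of the last
  row, \<open>1/(d1 d2)\<close> that of the 2x2 minors of the last two rows. The quantities tested
  for being units are leading terms of such entries and minors. The unipotent part is determined
  only up to integral right factors, and it often involves fewer than four variables. A variable
  that drops out is kept as a dummy: it fills a slot that makes the map invertible or, after being
  confined to \<open>\<P>\<close> at the cost of a factor \<open>q\<close>, supplies a parameter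
  that the target sees only modulo \<open>\<P>\<close>. Characters need to agree only up to squares
  and factors in \<open>1 + \<P>\<close>.\<close>

locale local_field =
  fixes ord :: "'f::field_char_0 \<Rightarrow> int" and w :: 'f and q :: nat
  assumes nonarch: "nonarch_local_field ord w q"
begin

section \<open>Valuation arithmetic: fractional ideals, integers, units\<close>

abbreviation integers :: "'f set" ("\<O>") where "\<O> \<equiv> Oo ord"
abbreviation max_ideal :: "'f set" ("\<P>") where "\<P> \<equiv> Pp ord"
abbreviation unit_group :: "'f set" ("\<U>") where "\<U> \<equiv> Ounits ord"

lemma ord_mult: "x \<noteq> 0 \<Longrightarrow> y \<noteq> 0 \<Longrightarrow> ord (x * y) = ord x + ord y"
  and ord_add: "x \<noteq> 0 \<Longrightarrow> y \<noteq> 0 \<Longrightarrow> x + y \<noteq> 0 \<Longrightarrow> min (ord x) (ord y) \<le> ord (x + y)"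
  and w_nonzero [simp]: "w \<noteq> 0" and ord_w [simp]: "ord w = 1"
  and ex_residues: "\<exists>R. finite R \<and> card R = q \<and> reps ord 1 R"
  using nonarch unfolding nonarch_local_field_def by auto

lemma ord_1 [simp]: "ord 1 = 0"
  using ord_mult[of 1 1] by simp

lemma ord_minus [simp]: "ord (- x) = ord x"
proof (cases "x = 0")
  case False
  have "ord (-1) = 0" using ord_mult[of "-1" "-1"] by simp
  then show ?thesis using ord_mult[of "-1" x] False by simp
qed simp

lemma ord_inverse: "x \<noteq> 0 \<Longrightarrow> ord (inverse x) = - ord x"
  using ord_mult[of x "inverse x"] by simp

lemma ord_power: "x \<noteq> 0 \<Longrightarrow> ord (x ^ n) = int n * ord x"
  by (induction n) (auto simp: ord_mult algebra_simps)

lemma pideal_0 [simp]: "0 \<in> pideal ord n"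
  by (simp add: pideal_def)

lemma pideal_add: "x \<in> pideal ord n \<Longrightarrow> y \<in> pideal ord n \<Longrightarrow> x + y \<in> pideal ord n"
  using ord_add[of x y] by (cases "x = 0"; cases "y = 0"; cases "x + y = 0") (auto simp: pideal_def)

lemma pideal_minus [simp]: "- x \<in> pideal ord n \<longleftrightarrow> x \<in> pideal ord n"
  by (simp add: pideal_def)

lemma pideal_diff: "x \<in> pideal ord n \<Longrightarrow> y \<in> pideal ord n \<Longrightarrow> x - y \<in> pideal ord n"
  using pideal_add[of x n "- y"] by simp

lemma pideal_diff_commute: "x - y \<in> pideal ord n \<longleftrightarrow> y - x \<in> pideal ord n"
  using pideal_minus[of "x - y" n] by simp

lemma pideal_mult: "x \<in> pideal ord m \<Longrightarrow> y \<in> pideal ord n \<Longrightarrow> x * y \<in> pideal ord (m + n)"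
  using ord_mult[of x y] by (cases "x = 0"; cases "y = 0") (auto simp: pideal_def)

lemma pideal_mono: "x \<in> pideal ord m \<Longrightarrow> n \<le> m \<Longrightarrow> x \<in> pideal ord n"
  by (auto simp: pideal_def)

lemma ex_pideal: "\<exists>n::nat. x \<in> pideal ord (- int n)"
  by (rule exI[of _ "nat (- ord x)"]) (auto simp: pideal_def)

lemma integers_eq: "\<O> = pideal ord 0" and max_ideal_eq: "\<P> = pideal ord 1"
  by (simp_all add: Oo_def Pp_def)

lemma units_iff: "x \<in> \<U> \<longleftrightarrow> x \<in> \<O> \<and> x \<notin> \<P>"
  by (auto simp: Ounits_def integers_eq max_ideal_eq pideal_def)

lemma units_nonzero: "x \<in> \<U> \<Longrightarrow> x \<noteq> 0" and units_integers: "x \<in> \<U> \<Longrightarrow> x \<in> \<O>"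
  by (auto simp: Ounits_def integers_eq pideal_def)

lemma max_ideal_integers: "x \<in> \<P> \<Longrightarrow> x \<in> \<O>"
  by (auto simp: integers_eq max_ideal_eq pideal_def)

lemma units_mult: "x \<in> \<U> \<Longrightarrow> y \<in> \<U> \<Longrightarrow> x * y \<in> \<U>"
  and units_inverse: "x \<in> \<U> \<Longrightarrow> inverse x \<in> \<U>"
  and units_minus: "x \<in> \<U> \<Longrightarrow> - x \<in> \<U>"
  and units_1: "1 \<in> \<U>"
  by (auto simp: Ounits_def ord_mult ord_inverse)

lemma units_divide: "x \<in> \<U> \<Longrightarrow> y \<in> \<U> \<Longrightarrow> x / y \<in> \<U>"
  by (simp add: divide_inverse units_mult units_inverse)

lemma units_power: "x \<in> \<U> \<Longrightarrow> x ^ n \<in> \<U>"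
  by (auto simp: Ounits_def ord_power)

lemma integers_add: "x \<in> \<O> \<Longrightarrow> y \<in> \<O> \<Longrightarrow> x + y \<in> \<O>"
  and integers_diff: "x \<in> \<O> \<Longrightarrow> y \<in> \<O> \<Longrightarrow> x - y \<in> \<O>"
  and integers_minus: "x \<in> \<O> \<Longrightarrow> - x \<in> \<O>"
  and integers_mult: "x \<in> \<O> \<Longrightarrow> y \<in> \<O> \<Longrightarrow> x * y \<in> \<O>"
  using pideal_mult[of x 0 y 0] by (auto simp: integers_eq pideal_add pideal_diff)

lemma integers_0: "0 \<in> \<O>" and integers_1: "1 \<in> \<O>" and integers_w: "w \<in> \<O>"
  by (simp_all add: integers_eq pideal_def)

lemma integers_power: "x \<in> \<O> \<Longrightarrow> x ^ n \<in> \<O>"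
  by (induction n) (auto intro: integers_mult integers_1)

lemma integers_inverse: "y \<in> \<U> \<Longrightarrow> inverse y \<in> \<O>"
  by (blast intro: units_integers units_inverse)

lemma integers_divide: "x \<in> \<O> \<Longrightarrow> y \<in> \<U> \<Longrightarrow> x / y \<in> \<O>"
  by (simp add: divide_inverse integers_mult integers_inverse)

lemma max_ideal_divide_w: "x \<in> \<P> \<Longrightarrow> x / w \<in> \<O>"
  using ord_mult[of x "inverse w"]
  by (cases "x = 0") (auto simp: integers_eq max_ideal_eq pideal_def ord_inverse divide_inverse)

lemma max_ideal_0: "0 \<in> \<P>" and max_ideal_w: "w \<in> \<P>"
  by (simp_all add: max_ideal_eq pideal_def)

lemma max_ideal_add: "x \<in> \<P> \<Longrightarrow> y \<in> \<P> \<Longrightarrow> x + y \<in> \<P>"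
  and max_ideal_diff: "x \<in> \<P> \<Longrightarrow> y \<in> \<P> \<Longrightarrow> x - y \<in> \<P>"
  and max_ideal_minus: "x \<in> \<P> \<Longrightarrow> - x \<in> \<P>"
  and max_ideal_mult_left: "x \<in> \<P> \<Longrightarrow> y \<in> \<O> \<Longrightarrow> x * y \<in> \<P>"
  and max_ideal_mult_right: "x \<in> \<O> \<Longrightarrow> y \<in> \<P> \<Longrightarrow> x * y \<in> \<P>"
  using pideal_mult[of x 1 y 0] pideal_mult[of x 0 y 1]
  by (auto simp: integers_eq max_ideal_eq pideal_add pideal_diff)

lemma max_ideal_divide: "x \<in> \<P> \<Longrightarrow> y \<in> \<U> \<Longrightarrow> x / y \<in> \<P>"
  by (simp add: divide_inverse max_ideal_mult_left integers_inverse)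

lemma units_add_max_ideal: "x \<in> \<U> \<Longrightarrow> y \<in> \<P> \<Longrightarrow> x + y \<in> \<U>"
  using max_ideal_diff[of "x + y" y] by (auto simp: units_iff max_ideal_integers integers_add)

lemma units_max_ideal_add: "x \<in> \<P> \<Longrightarrow> y \<in> \<U> \<Longrightarrow> x + y \<in> \<U>"
  using units_add_max_ideal[of y x] by (simp add: add.commute)

lemma units_diff_max_ideal: "x \<in> \<U> \<Longrightarrow> y \<in> \<P> \<Longrightarrow> x - y \<in> \<U>"
  using units_add_max_ideal[of x "- y"] by (simp add: max_ideal_minus)

lemma units_max_ideal_diff: "x \<in> \<P> \<Longrightarrow> y \<in> \<U> \<Longrightarrow> x - y \<in> \<U>"
  using units_max_ideal_add[of x "- y"] by (simp add: units_minus)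

lemmas integral_intros = integers_0 integers_1 integers_w integers_add integers_diff integers_minus
  integers_mult integers_power integers_inverse integers_divide

lemmas units_intros = units_1 units_minus units_mult units_inverse units_divide units_power

lemmas max_ideal_intros = max_ideal_0 max_ideal_w max_ideal_add max_ideal_diff max_ideal_minus

lemmas O_rules = units_integers max_ideal_integers integers_add integers_diff integers_mult integers_power

lemma mult_unitsD: "x * y \<in> \<U> \<Longrightarrow> x \<in> \<O> \<Longrightarrow> y \<in> \<O> \<Longrightarrow> x \<in> \<U>"
  by (auto simp: units_iff max_ideal_mult_left)

text \<open>Rephrased through units because both \<open>x\<close> and \<open>1 - x\<close> occur as
  denominators and as arguments of the character.\<close>

lemma Ounits1_iff: "x \<in> Ounits1 ord \<longleftrightarrow> x \<in> \<U> \<and> 1 - x \<in> \<U>"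
proof -
  have "x \<in> (\<lambda>y. 1 + y) ` \<P> \<longleftrightarrow> x - 1 \<in> \<P>"
    by (auto simp: image_iff intro: bexI[of _ "x - 1"])
  also have "\<dots> \<longleftrightarrow> 1 - x \<in> \<P>"
    using max_ideal_minus[of "x - 1"] max_ideal_minus[of "1 - x"] by auto
  finally have "x \<in> (\<lambda>y. 1 + y) ` \<P> \<longleftrightarrow> 1 - x \<in> \<P>" .
  then show ?thesis
    by (auto simp: Ounits1_def units_iff integers_diff integers_1)
qed

subsection \<open>Representatives modulo powers of the maximal ideal\<close>

lemma reps_subset: "reps ord n R \<Longrightarrow> r \<in> R \<Longrightarrow> r \<in> \<O>"
  by (auto simp: reps_def)

lemma reps_ex: "reps ord n R \<Longrightarrow> x \<in> \<O> \<Longrightarrow> \<exists>r\<in>R. x - r \<in> pideal ord (int n)"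
  by (auto simp: reps_def)

lemma reps_unique:
  assumes "reps ord n R" "r \<in> R" "s \<in> R" "r - s \<in> pideal ord (int n)"
  shows "r = s"
proof -
  have "\<exists>!t. t \<in> R \<and> r - t \<in> pideal ord (int n)"
    using assms by (auto simp: reps_def)
  then show ?thesis using assms by (metis diff_self pideal_0)
qed

lemma repsI:
  assumes "\<And>r. r \<in> R \<Longrightarrow> r \<in> \<O>"
    and "\<And>x. x \<in> \<O> \<Longrightarrow> \<exists>r\<in>R. x - r \<in> pideal ord (int n)"
    and "\<And>r s. r \<in> R \<Longrightarrow> s \<in> R \<Longrightarrow> r - s \<in> pideal ord (int n) \<Longrightarrow> r = s"
  shows "reps ord n R"
  unfolding reps_def
proof (intro conjI ballI subsetI)
  fix x assume "x \<in> \<O>"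
  then obtain r where r: "r \<in> R" "x - r \<in> pideal ord (int n)" using assms(2) by blast
  show "\<exists>!r. r \<in> R \<and> x - r \<in> pideal ord (int n)"
  proof (rule ex1I[of _ r])
    fix s assume "s \<in> R \<and> x - s \<in> pideal ord (int n)"
    then have "(x - r) - (x - s) \<in> pideal ord (int n)" using r by (blast intro: pideal_diff)
    then have "s - r \<in> pideal ord (int n)" by simp
    then show "s = r" using assms(3) r \<open>s \<in> R \<and> _\<close> by blast
  qed (use r in auto)
qed (use assms in auto)

lemma w_power_pideal: "w ^ n * x \<in> pideal ord (int n + m) \<longleftrightarrow> x \<in> pideal ord m"
  by (cases "x = 0") (auto simp: pideal_def ord_mult ord_power)

lemma pideal_cases: "x \<in> pideal ord (int n) \<longleftrightarrow> (\<exists>y\<in>\<O>. x = w ^ n * y)"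
proof
  assume "x \<in> pideal ord (int n)"
  then have "x / w ^ n \<in> \<O>"
    using w_power_pideal[of n "x / w ^ n" 0] by (simp add: integers_eq)
  then show "\<exists>y\<in>\<O>. x = w ^ n * y" by (intro bexI[of _ "x / w ^ n"]) auto
qed (use w_power_pideal[of n _ 0] in \<open>auto simp: integers_eq\<close>)

text \<open>Digit expansion: the residue modulo \<open>w ^ m\<close> fixes \<open>r\<close>, and
  after division by \<open>w ^ m\<close> the residue modulo \<open>w ^ n\<close> fixes
  \<open>s\<close>.\<close>

lemma reps_combine:
  assumes "reps ord m R" "reps ord n S"
  shows "reps ord (m + n) ((\<lambda>(r, s). r + w ^ m * s) ` (R \<times> S))"
    and "inj_on (\<lambda>(r, s). r + w ^ m * s) (R \<times> S)"
proof -
  have *: "r = r' \<and> s = s'" if "r \<in> R" "r' \<in> R" "s \<in> S" "s' \<in> S"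
    "(r + w ^ m * s) - (r' + w ^ m * s') \<in> pideal ord (int (m + n))" for r r' s s'
  proof -
    have "s \<in> \<O>" "s' \<in> \<O>" using assms that by (auto intro: reps_subset)
    then have "w ^ m * (s - s') \<in> pideal ord (int m)"
      using w_power_pideal[of m "s - s'" 0] by (auto simp: integers_eq pideal_diff)
    moreover have "(r + w ^ m * s) - (r' + w ^ m * s') \<in> pideal ord (int m)"
      using that by (auto intro: pideal_mono)
    ultimately have "(r + w ^ m * s) - (r' + w ^ m * s') - w ^ m * (s - s') \<in> pideal ord (int m)"
      by (rule pideal_diff[rotated])
    then have "r - r' \<in> pideal ord (int m)" by (simp add: algebra_simps)
    then have "r = r'" using assms that reps_unique by blast
    with that have "w ^ m * (s - s') \<in> pideal ord (int m + int n)" by (simp add: algebra_simps)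
    then have "s = s'" using that assms reps_unique by (auto simp: w_power_pideal)
    with \<open>r = r'\<close> show ?thesis by simp
  qed
  show "inj_on (\<lambda>(r, s). r + w ^ m * s) (R \<times> S)"
    unfolding inj_on_def using * by auto
  show "reps ord (m + n) ((\<lambda>(r, s). r + w ^ m * s) ` (R \<times> S))"
  proof (rule repsI)
    fix x assume "x \<in> \<O>"
    then obtain r where r: "r \<in> R" "x - r \<in> pideal ord (int m)" using assms reps_ex by blast
    then obtain y where y: "y \<in> \<O>" "x - r = w ^ m * y" using pideal_cases by blast
    then obtain s where s: "s \<in> S" "y - s \<in> pideal ord (int n)" using assms reps_ex by blast
    have "x - (r + w ^ m * s) = w ^ m * (y - s)" using y by (simp add: algebra_simps)
    then have "x - (r + w ^ m * s) \<in> pideal ord (int (m + n))" using s w_power_pideal by simp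
    then show "\<exists>r\<in>(\<lambda>(r, s). r + w ^ m * s) ` (R \<times> S). x - r \<in> pideal ord (int (m + n))"
      using r s by force
  next
    fix r assume "r \<in> (\<lambda>(r, s). r + w ^ m * s) ` (R \<times> S)"
    then show "r \<in> \<O>" using assms by (auto intro!: integral_intros intro: reps_subset)
  qed (use * in force)
qed

lemma reps_0: "reps ord 0 {0}"
  by (rule repsI) (auto simp: integers_eq)

lemma ex_reps: "\<exists>R. finite R \<and> card R = q ^ n \<and> reps ord n R"
proof (induction n)
  case 0
  show ?case using reps_0 by (intro exI[of _ "{0}"]) auto
next
  case (Suc n)
  then obtain R S where "finite R" "card R = q ^ n" "reps ord n R"
    and "finite S" "card S = q" "reps ord 1 S" using ex_residues by blast
  then show ?case using reps_combine[of n R 1 S]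
    by (intro exI[of _ "(\<lambda>(r, s). r + w ^ n * s) ` (R \<times> S)"]) (auto simp: card_image)
qed

text \<open>The choices at different levels are unrelated; sums of invariant functions do not depend
  on them.\<close>

definition res :: "nat \<Rightarrow> 'f set" where
  "res n = (SOME R. finite R \<and> card R = q ^ n \<and> reps ord n R)"

lemma finite_res [simp]: "finite (res n)" and card_res: "card (res n) = q ^ n"
  and reps_res: "reps ord n (res n)"
  using someI_ex[OF ex_reps[of n]] unfolding res_def by auto

lemma q_pos: "q > 0"
proof -
  have "res 1 \<noteq> {}" using reps_ex[OF reps_res integers_0] by blast
  then show ?thesis using card_res[of 1] finite_res[of 1] by (metis card_gt_0_iff power_one_right)
qed

definition rep :: "nat \<Rightarrow> 'f \<Rightarrow> 'f" where
  "rep n x = (SOME r. r \<in> res n \<and> x - r \<in> pideal ord (int n))"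

lemma rep: "x \<in> \<O> \<Longrightarrow> rep n x \<in> res n" "x \<in> \<O> \<Longrightarrow> x - rep n x \<in> pideal ord (int n)"
  using someI_ex[of "\<lambda>r. r \<in> res n \<and> x - r \<in> pideal ord (int n)"] reps_ex[OF reps_res, of x n]
  unfolding rep_def by blast+

lemma res_integers: "r \<in> res n \<Longrightarrow> r \<in> \<O>"
  using reps_subset reps_res by blast

text \<open>Integrality of both arguments is built in, so that products and powers preserve
  congruence without side conditions.\<close>

definition cg :: "nat \<Rightarrow> 'f \<Rightarrow> 'f \<Rightarrow> bool" where
  "cg n x y \<longleftrightarrow> x \<in> \<O> \<and> y \<in> \<O> \<and> x - y \<in> pideal ord (int n)"

lemma cg_refl: "x \<in> \<O> \<Longrightarrow> cg n x x"
  by (simp add: cg_def)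

lemma cg_sym: "cg n x y \<Longrightarrow> cg n y x"
  by (simp add: cg_def pideal_diff_commute)

lemma cg_trans: "cg n x y \<Longrightarrow> cg n y z \<Longrightarrow> cg n x z"
  using pideal_add[of "x - y" "int n" "y - z"] by (simp add: cg_def)

lemma cg_add: "cg n x x' \<Longrightarrow> cg n y y' \<Longrightarrow> cg n (x + y) (x' + y')"
  using pideal_add[of "x - x'" "int n" "y - y'"]
  by (auto simp: cg_def integers_add algebra_simps)

lemma cg_minus: "cg n x x' \<Longrightarrow> cg n (- x) (- x')"
  using pideal_minus[of "x - x'" "int n"] by (auto simp: cg_def integers_minus)

lemma cg_diff: "cg n x x' \<Longrightarrow> cg n y y' \<Longrightarrow> cg n (x - y) (x' - y')"
  using cg_add[of n x x' "- y" "- y'"] cg_minus[of n y y'] by simp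

lemma cg_mult:
  assumes "cg n x x'" "cg n y y'"
  shows "cg n (x * y) (x' * y')"
proof -
  have "(x - x') * y + (y - y') * x' \<in> pideal ord (int n)"
    using assms pideal_mult[of "x - x'" "int n" y 0] pideal_mult[of "y - y'" "int n" x' 0]
    by (auto simp: cg_def integers_eq intro!: pideal_add)
  then show ?thesis using assms by (auto simp: cg_def integers_mult algebra_simps)
qed

lemma cg_power: "cg n x x' \<Longrightarrow> cg n (x ^ k) (x' ^ k)"
  by (induction k) (auto intro: cg_mult cg_refl integers_1)

lemma cg_max_ideal: "cg n x x' \<Longrightarrow> n \<ge> 1 \<Longrightarrow> x \<in> \<P> \<Longrightarrow> x' \<in> \<P>"
  using pideal_diff[of x 1 "x - x'"] pideal_mono[of "x - x'" "int n" 1]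
  by (auto simp: cg_def max_ideal_eq)

text \<open>Level \<open>0\<close> identifies all integers; from level \<open>1\<close> on, being a
  unit depends only on the class.\<close>

lemma cg_units: "cg n x x' \<Longrightarrow> n \<ge> 1 \<Longrightarrow> x \<in> \<U> \<Longrightarrow> x' \<in> \<U>"
  using cg_max_ideal[OF cg_sym, of n x x'] by (auto simp: units_iff cg_def)

lemma cg_integers: "cg n x x' \<Longrightarrow> x' \<in> \<O>"
  by (simp add: cg_def)

lemma cg_inverse:
  assumes "cg n x x'" "n \<ge> 1" "x \<in> \<U>"
  shows "cg n (inverse x) (inverse x')"
proof -
  have x': "x' \<in> \<U>" using cg_units assms by blast
  have "(x' - x) * (inverse x * inverse x') \<in> pideal ord (int n + 0)"
    using assms x' by (intro pideal_mult) (auto simp: cg_def pideal_diff_commute[of x' x]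
      integers_eq[symmetric] intro: integral_intros)
  moreover have "(x' - x) * (inverse x * inverse x') = inverse x - inverse x'"
    using units_nonzero[OF x'] units_nonzero[OF assms(3)] by (simp add: field_simps)
  ultimately show ?thesis using assms x' by (auto simp: cg_def integers_inverse)
qed

lemma cg_divide: "cg n x x' \<Longrightarrow> cg n y y' \<Longrightarrow> n \<ge> 1 \<Longrightarrow> y \<in> \<U> \<Longrightarrow> cg n (x / y) (x' / y')"
  by (simp add: divide_inverse cg_mult cg_inverse)

lemma cg_rep: "x \<in> \<O> \<Longrightarrow> cg n x (rep n x)"
  using rep[of x n] res_integers by (auto simp: cg_def)

lemma cg_res: "cg n x y \<Longrightarrow> x \<in> res n \<Longrightarrow> y \<in> res n \<Longrightarrow> x = y"
  using reps_unique[OF reps_res] by (auto simp: cg_def)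

lemma rep_eqI: "cg n x y \<Longrightarrow> y \<in> res n \<Longrightarrow> rep n x = y"
  by (rule cg_res[OF cg_trans[OF cg_sym[OF cg_rep]]]) (auto intro: rep(1) simp: cg_def)

subsection \<open>Finite sums representing integrals\<close>

definition cg_inv :: "nat \<Rightarrow> ('f \<Rightarrow> 'a) \<Rightarrow> bool" where
  "cg_inv n g \<longleftrightarrow> (\<forall>x y. cg n x y \<longrightarrow> g x = g y)"

lemma cg_invD: "cg_inv n g \<Longrightarrow> cg n x y \<Longrightarrow> g x = g y"
  by (simp add: cg_inv_def)

text \<open>\<open>rep n\<close> matches an arbitrary system of representatives with the chosen one.
  This serves both the quantifier over systems in the definition of \<open>integ\<close> and the
  translated or combined systems below.\<close>

lemma sum_reps:
  fixes g :: "'f \<Rightarrow> 'v::real_vector"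
  assumes R: "reps ord n R" and g: "cg_inv n g"
  shows "finite R" "card R = q ^ n" "(\<Sum>r\<in>R. g r) = (\<Sum>r\<in>res n. g r)"
proof -
  have bij: "bij_betw (rep n) R (res n)"
    unfolding bij_betw_def
  proof (intro conjI equalityI subsetI inj_onI)
    fix r s assume rs: "r \<in> R" "s \<in> R" "rep n r = rep n s"
    then have "cg n r s" using R reps_subset cg_rep cg_trans cg_sym by metis
    then show "r = s" using R rs reps_unique by (auto simp: cg_def)
  next
    fix s assume s: "s \<in> res n"
    then obtain r where r: "r \<in> R" "s - r \<in> pideal ord (int n)"
      using R reps_ex res_integers by blast
    then have "cg n r s" using R s reps_subset res_integers by (auto simp: cg_def pideal_diff_commute)
    then show "s \<in> rep n ` R" using rep_eqI s r by blast
  qed (use R reps_subset rep(1) in auto)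
  show "finite R" "card R = q ^ n"
    using bij_betw_finite[OF bij] bij_betw_same_card[OF bij] card_res by auto
  have "(\<Sum>r\<in>R. g r) = (\<Sum>r\<in>R. g (rep n r))"
    using R reps_subset cg_invD[OF g cg_rep] by (intro sum.cong) auto
  also have "\<dots> = (\<Sum>r\<in>res n. g r)" by (rule sum.reindex_bij_betw[OF bij])
  finally show "(\<Sum>r\<in>R. g r) = (\<Sum>r\<in>res n. g r)" .
qed

lemma reps_translate:
  assumes "c \<in> \<O>"
  shows "reps ord n ((\<lambda>r. r + c) ` res n)"
proof (rule repsI)
  fix x assume "x \<in> \<O>"
  then obtain r where r: "r \<in> res n" "x - c - r \<in> pideal ord (int n)"
    using reps_ex[OF reps_res integers_diff] assms by blast
  then show "\<exists>r\<in>(\<lambda>r. r + c) ` res n. x - r \<in> pideal ord (int n)"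
    by (auto simp: algebra_simps)
qed (use assms in \<open>auto simp: res_integers integers_add intro: reps_unique[OF reps_res]\<close>)

lemma sum_res_translate:
  assumes "cg_inv n g" "c \<in> \<O>"
  shows "(\<Sum>r\<in>res n. g (r + c)) = (\<Sum>r\<in>res n. g r :: 'v::real_vector)"
  using sum_reps(3)[OF reps_translate assms(1), of c] assms(2) by (simp add: sum.reindex)

lemma cg_w_power: "y \<in> \<O> \<Longrightarrow> x \<in> \<O> \<Longrightarrow> cg n (x + w ^ n * y) x"
  using pideal_cases[of "w ^ n * y" n] by (auto simp: cg_def integral_intros)

lemma cg_mono: "cg n x y \<Longrightarrow> m \<le> n \<Longrightarrow> cg m x y"
  using pideal_mono[of "x - y" "int n" "int m"] by (auto simp: cg_def)

lemma cg_inv_mono: "cg_inv m g \<Longrightarrow> m \<le> n \<Longrightarrow> cg_inv n g"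
  using cg_mono by (auto simp: cg_inv_def)

lemma sum_res_combine:
  fixes g :: "'f \<Rightarrow> 'v::real_vector"
  assumes "cg_inv (m + n) g"
  shows "(\<Sum>r\<in>res (m + n). g r) = (\<Sum>r\<in>res m. \<Sum>s\<in>res n. g (r + w ^ m * s))"
  using sum_reps(3)[OF reps_combine(1)[OF reps_res[of m] reps_res[of n]] assms]
    reps_combine(2)[OF reps_res[of m] reps_res[of n]]
  by (simp add: sum.reindex sum.cartesian_product case_prod_unfold)

lemma sum_res_level:
  fixes g :: "'f \<Rightarrow> 'v::real_vector"
  assumes g: "cg_inv n g" and "n \<le> m"
  shows "(\<Sum>r\<in>res m. g r) = real (q ^ (m - n)) *\<^sub>R (\<Sum>r\<in>res n. g r)"
proof -
  have "(\<Sum>r\<in>res m. g r) = (\<Sum>r\<in>res n. \<Sum>s\<in>res (m - n). g (r + w ^ n * s))"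
    using sum_res_combine[of n "m - n" g] cg_inv_mono[OF g, of m] assms by simp
  also have "\<dots> = (\<Sum>r\<in>res n. \<Sum>s\<in>res (m - n). g r)"
    using cg_invD[OF g cg_w_power] res_integers by (intro sum.cong) auto
  finally show ?thesis by (simp add: card_res scaleR_sum_right sum_constant_scaleR)
qed

text \<open>Modulo \<open>\<P>\<close> only one leading digit survives, and the remaining digits run
  through \<open>res n\<close>. Returning from level \<open>n\<close> to level \<open>Suc n\<close>
  produces the factor \<open>1 / q\<close>. The level rises by one because \<open>r / w\<close>
  modulo \<open>w ^ n\<close> needs \<open>r\<close> modulo \<open>w ^ Suc n\<close>.\<close>

lemma sum_res_max_ideal:
  fixes g :: "'f \<Rightarrow> 'v::real_vector"
  assumes g: "cg_inv n g"
  shows "(\<Sum>r\<in>{r\<in>res (Suc n). r \<in> \<P>}. g (r / w)) = (1 / real q) *\<^sub>R (\<Sum>r\<in>res (Suc n). g r)"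
proof -
  define h where "h r = (if r \<in> \<P> then g (r / w) else 0)" for r
  have h: "cg_inv (Suc n) h"
    unfolding cg_inv_def
  proof (intro allI impI)
    fix x y assume xy: "cg (Suc n) x y"
    show "h x = h y"
    proof (cases "x \<in> \<P>")
      case True
      then have y: "y \<in> \<P>" using cg_max_ideal xy by simp
      have "w ^ 1 * (x / w - y / w) \<in> pideal ord (int 1 + int n)"
        using xy by (simp add: cg_def right_diff_distrib)
      then have "x / w - y / w \<in> pideal ord (int n)" by (simp only: w_power_pideal)
      then have "cg n (x / w) (y / w)" using True y max_ideal_divide_w by (simp add: cg_def)
      then show ?thesis using True y cg_invD[OF g] by (simp add: h_def)
    next
      case False
      then have "y \<notin> \<P>" using cg_max_ideal cg_sym xy by (metis One_nat_def Suc_le_mono le0)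
      with False show ?thesis by (simp add: h_def)
    qed
  qed
  \<comment> \<open>The representative of the class of \<open>0\<close> need not be \<open>0\<close>
    itself; this causes the translation by \<open>r0 / w\<close> below.\<close>
  define r0 where "r0 = rep 1 0"
  have r0: "r0 \<in> res 1" "r0 \<in> \<P>"
    using rep[of 0 1] integers_0 max_ideal_minus[of "- r0"] by (auto simp: r0_def max_ideal_eq)
  have P: "r + w * s \<in> \<P> \<longleftrightarrow> r = r0" if "r \<in> res 1" "s \<in> res n" for r s
  proof -
    have ws: "w * s \<in> \<P>" using that by (simp add: max_ideal_mult_left max_ideal_w res_integers)
    have "r = r0" if "r \<in> \<P>"
      using that r0 \<open>r \<in> res 1\<close> by (intro cg_res[of 1]) (auto simp: cg_def max_ideal_integers
        max_ideal_eq[symmetric] max_ideal_diff)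
    then show ?thesis
      using ws r0 max_ideal_add[of r "w * s"] max_ideal_diff[of "r + w * s" "w * s"] by auto
  qed
  have "(\<Sum>r\<in>{r\<in>res (Suc n). r \<in> \<P>}. g (r / w)) = (\<Sum>r\<in>res (1 + n). h r)"
    by (simp add: h_def sum.inter_filter[symmetric] del: add_Suc plus_1_eq_Suc) simp
  also have "\<dots> = (\<Sum>r\<in>res 1. \<Sum>s\<in>res n. h (r + w * s))"
    using sum_res_combine[of 1 n h] h by simp
  also have "\<dots> = (\<Sum>r\<in>res 1. if r = r0 then \<Sum>s\<in>res n. g (s + r0 / w) else 0)"
    using P by (intro sum.cong) (auto simp: h_def field_simps intro!: sum.cong sum.neutral)
  also have "\<dots> = (\<Sum>s\<in>res n. g (s + r0 / w))"
    using r0 by simp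
  also have "\<dots> = (\<Sum>s\<in>res n. g s)"
    using r0 by (intro sum_res_translate g max_ideal_divide_w)
  also have "\<dots> = (1 / real q) *\<^sub>R (\<Sum>r\<in>res (Suc n). g r)"
    using sum_res_level[OF g, of "Suc n"] q_pos by simp
  finally show ?thesis .
qed

text \<open>The definite description is legitimate because averages at two admissible levels agree:
  each class at the lower level splits into equally many classes at the higher one. Any admissible
  level may therefore be used.\<close>

lemma integ_eq:
  fixes f :: "'f \<Rightarrow> 'v::real_vector"
  assumes S: "\<And>x. x \<in> S \<Longrightarrow> x \<in> \<O>" "\<And>x y. x \<in> S \<Longrightarrow> cg n x y \<Longrightarrow> y \<in> S"
    and f: "\<And>x y. x \<in> S \<Longrightarrow> y \<in> S \<Longrightarrow> cg n x y \<Longrightarrow> f x = f y"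
  shows "integ ord S f = (1 / real (q ^ n)) *\<^sub>R (\<Sum>r\<in>res n \<inter> S. f r)"
proof -
  define g where "g x = (if x \<in> S then f x else 0)" for x
  define adm where "adm m \<longleftrightarrow> S \<subseteq> \<O> \<and> (\<forall>x\<in>S. \<forall>y. x - y \<in> pideal ord (int m) \<longrightarrow> y \<in> S) \<and>
       (\<forall>x\<in>S. \<forall>y\<in>S. x - y \<in> pideal ord (int m) \<longrightarrow> f x = f y)" for m
  have g: "cg_inv m g" if "adm m" for m
    unfolding cg_inv_def
  proof (intro allI impI)
    fix x y assume "cg m x y"
    then have xy: "x - y \<in> pideal ord (int m)" "y - x \<in> pideal ord (int m)"
      by (auto simp: cg_def pideal_diff_commute)
    then have "x \<in> S \<longleftrightarrow> y \<in> S" using that unfolding adm_def by blast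
    moreover have "f x = f y" if "x \<in> S" "y \<in> S"
      using that xy(1) \<open>adm m\<close> unfolding adm_def by blast
    ultimately show "g x = g y" by (simp add: g_def)
  qed
  have avg: "(1 / real (card R)) *\<^sub>R (\<Sum>r\<in>R \<inter> S. f r) = (1 / real (q ^ m)) *\<^sub>R (\<Sum>r\<in>res m. g r)"
    if "adm m" "reps ord m R" for m R
  proof -
    have "(\<Sum>r\<in>R \<inter> S. f r) = (\<Sum>r\<in>R. g r)"
      unfolding g_def using sum_reps(1)[OF that(2) g[OF that(1)]] by (rule sum.inter_restrict)
    then show ?thesis by (simp only: sum_reps[OF that(2) g[OF that(1)]])
  qed
  have level: "(1 / real (q ^ m)) *\<^sub>R (\<Sum>r\<in>res m. g r) = (1 / real (q ^ k)) *\<^sub>R (\<Sum>r\<in>res k. g r)"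
    if "adm k" "k \<le> m" for k m
  proof -
    have "real (q ^ m) = real (q ^ k) * real (q ^ (m - k))"
      using that by (simp flip: power_add)
    then show ?thesis unfolding sum_res_level[OF g[OF that(1)] that(2)] using q_pos by simp
  qed
  have cg: "cg n x y" if "x \<in> S" "x - y \<in> pideal ord (int n)" for x y
  proof -
    have "x - y \<in> \<O>" using pideal_mono[OF that(2), of 0] by (simp add: integers_eq)
    then have "x - (x - y) \<in> \<O>" using S(1)[OF that(1)] by (rule integers_diff[rotated])
    then show ?thesis using that S(1) by (simp add: cg_def)
  qed
  have n: "adm n"
    unfolding adm_def
  proof (intro conjI ballI allI impI subsetI)
    show "x \<in> \<O>" if "x \<in> S" for x using S(1)[OF that] .
    show "y \<in> S" if "x \<in> S" "x - y \<in> pideal ord (int n)" for x y using S(2)[OF that(1) cg[OF that]] .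
    show "f x = f y" if "x \<in> S" "y \<in> S" "x - y \<in> pideal ord (int n)" for x y
      using f[OF that(1,2) cg[OF that(1,3)]] .
  qed
  have "integ ord S f = (THE I. \<exists>m::nat. adm m \<and> (\<forall>R. reps ord m R \<longrightarrow>
          I = (1 / real (card R)) *\<^sub>R (\<Sum>r\<in>R \<inter> S. f r)))"
    unfolding integ_def adm_def by (simp only: conj_assoc)
  also have "\<dots> = (1 / real (q ^ n)) *\<^sub>R (\<Sum>r\<in>res n. g r)"
  proof (rule the_equality)
    fix I assume "\<exists>m::nat. adm m \<and> (\<forall>R. reps ord m R \<longrightarrow>
          I = (1 / real (card R)) *\<^sub>R (\<Sum>r\<in>R \<inter> S. f r))"
    then obtain m where m: "adm m" "\<And>R. reps ord m R \<Longrightarrow>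
          I = (1 / real (card R)) *\<^sub>R (\<Sum>r\<in>R \<inter> S. f r)" by blast
    \<comment> \<open>\<open>res m\<close> is a system of representatives, so the condition on all
      \<open>R\<close> is not vacuous and determines \<open>I\<close>.\<close>
    then have "I = (1 / real (q ^ m)) *\<^sub>R (\<Sum>r\<in>res m. g r)"
      using avg reps_res by blast
    then show "I = (1 / real (q ^ n)) *\<^sub>R (\<Sum>r\<in>res n. g r)"
      using level[OF m(1), of n] level[OF n, of m] nat_le_linear[of m n] by auto
  next
    show "\<exists>m. adm m \<and> (\<forall>R. reps ord m R \<longrightarrow>
        (1 / real (q ^ n)) *\<^sub>R (\<Sum>r\<in>res n. g r) = (1 / real (card R)) *\<^sub>R (\<Sum>r\<in>R \<inter> S. f r))"
      using n avg[OF n] by (intro exI[of _ n] conjI allI impI) simp_all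
  qed
  also have "(\<Sum>r\<in>res n. g r) = (\<Sum>r\<in>res n \<inter> S. f r)"
    unfolding g_def by (rule sum.inter_restrict[symmetric]) simp
  finally show ?thesis .
qed

text \<open>All integrals become averages over four variables; shorter integrals carry dummy variables
  running over \<^term>\<open>\<O>\<close>.\<close>

definition pts :: "nat \<Rightarrow> ('f \<Rightarrow> 'f \<Rightarrow> 'f \<Rightarrow> 'f \<Rightarrow> bool) \<Rightarrow> ('f \<times> 'f \<times> 'f \<times> 'f) set" where
  "pts n S = {(z, x, b, a). z \<in> res n \<and> x \<in> res n \<and> b \<in> res n \<and> a \<in> res n \<and> S z x b a}"

definition J :: "nat \<Rightarrow> ('f \<Rightarrow> 'f \<Rightarrow> 'f \<Rightarrow> 'f \<Rightarrow> bool) \<Rightarrow> ('f \<Rightarrow> 'f \<Rightarrow> 'f \<Rightarrow> 'f \<Rightarrow> 'v) \<Rightarrow> 'v::real_vector" where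
  "J n S f = (1 / real q ^ (4 * n)) *\<^sub>R (\<Sum>(z, x, b, a)\<in>pts n S. f z x b a)"

definition cg_region :: "nat \<Rightarrow> ('f \<Rightarrow> 'f \<Rightarrow> 'f \<Rightarrow> 'f \<Rightarrow> bool) \<Rightarrow> bool" where
  "cg_region n S \<longleftrightarrow> (\<forall>z x b a z' x' b' a'. S z x b a \<longrightarrow> z \<in> \<O> \<and> x \<in> \<O> \<and> b \<in> \<O> \<and> a \<in> \<O> \<and>
     (cg n z z' \<longrightarrow> cg n x x' \<longrightarrow> cg n b b' \<longrightarrow> cg n a a' \<longrightarrow> S z' x' b' a'))"

definition cg_fun :: "nat \<Rightarrow> ('f \<Rightarrow> 'f \<Rightarrow> 'f \<Rightarrow> 'f \<Rightarrow> bool) \<Rightarrow> ('f \<Rightarrow> 'f \<Rightarrow> 'f \<Rightarrow> 'f \<Rightarrow> 'a) \<Rightarrow> bool" where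
  "cg_fun n S f \<longleftrightarrow> (\<forall>z x b a z' x' b' a'. S z x b a \<longrightarrow>
     cg n z z' \<longrightarrow> cg n x x' \<longrightarrow> cg n b b' \<longrightarrow> cg n a a' \<longrightarrow> f z x b a = f z' x' b' a')"

lemma cg_regionI:
  assumes "\<And>z x b a. S z x b a \<Longrightarrow> z \<in> \<O> \<and> x \<in> \<O> \<and> b \<in> \<O> \<and> a \<in> \<O>"
    and "\<And>z x b a z' x' b' a'. S z x b a \<Longrightarrow> cg n z z' \<Longrightarrow> cg n x x' \<Longrightarrow> cg n b b' \<Longrightarrow> cg n a a' \<Longrightarrow>
      S z' x' b' a'"
  shows "cg_region n S"
  using assms unfolding cg_region_def by blast

lemma cg_region_integers: "cg_region n S \<Longrightarrow> S z x b a \<Longrightarrow> z \<in> \<O> \<and> x \<in> \<O> \<and> b \<in> \<O> \<and> a \<in> \<O>"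
  unfolding cg_region_def by blast

lemma cg_regionD: "cg_region n S \<Longrightarrow> S z x b a \<Longrightarrow> cg n z z' \<Longrightarrow> cg n x x' \<Longrightarrow> cg n b b' \<Longrightarrow>
    cg n a a' \<Longrightarrow> S z' x' b' a'"
  unfolding cg_region_def by blast

lemma cg_funD: "cg_fun n S f \<Longrightarrow> S z x b a \<Longrightarrow> cg n z z' \<Longrightarrow> cg n x x' \<Longrightarrow> cg n b b' \<Longrightarrow>
    cg n a a' \<Longrightarrow> f z x b a = f z' x' b' a'"
  unfolding cg_fun_def by blast

lemma cg_fun_mono: "cg_fun m S f \<Longrightarrow> m \<le> n \<Longrightarrow> cg_fun n S f"
  using cg_mono unfolding cg_fun_def by blast

lemma cg_fun_subset: "cg_fun m S f \<Longrightarrow> (\<And>z x b a. T z x b a \<Longrightarrow> S z x b a) \<Longrightarrow> cg_fun m T f"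
  unfolding cg_fun_def by blast

lemma finite_pts [simp]: "finite (pts n S)"
  by (rule finite_subset[of _ "res n \<times> res n \<times> res n \<times> res n"]) (auto simp: pts_def)

lemma J_cong:
  assumes "\<And>z x b a. S z x b a \<longleftrightarrow> T z x b a" "\<And>z x b a. S z x b a \<Longrightarrow> f z x b a = g z x b a"
  shows "J n S f = J n T g"
proof -
  have "S = T" using assms(1) by blast
  then show ?thesis unfolding J_def using assms(2)
    by (auto simp: pts_def intro!: arg_cong2[of _ _ _ _ scaleR] sum.cong)
qed

lemma J_split:
  "J n S f = J n (\<lambda>z x b a. S z x b a \<and> Q z x b a) f + J n (\<lambda>z x b a. S z x b a \<and> \<not> Q z x b a) f"
proof -
  define A where "A = pts n (\<lambda>z x b a. S z x b a \<and> Q z x b a)"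
  define B where "B = pts n (\<lambda>z x b a. S z x b a \<and> \<not> Q z x b a)"
  have "pts n S = A \<union> B" "A \<inter> B = {}" "finite A" "finite B"
    unfolding A_def B_def by (auto simp: pts_def[of n S]) (auto simp: pts_def)
  then show ?thesis
    unfolding J_def A_def[symmetric] B_def[symmetric]
    by (simp add: sum.union_disjoint scaleR_add_right)
qed

lemma J_linear: "linear h \<Longrightarrow> h (J n S f) = J n S (\<lambda>z x b a. h (f z x b a))"
  unfolding J_def by (simp add: linear_cmul linear_sum case_prod_unfold)

text \<open>Two maps inverse to each other that respect congruence modulo \<open>w ^ n\<close>
  induce inverse bijections of the residue points, so the two sums are reindexings of each
  other.\<close>

lemma J_subst:
  assumes S: "cg_region n S" and T: "cg_region n T" and f: "cg_fun n T f"
    and fwd: "\<And>z x b a. S z x b a \<Longrightarrow> T (kz z x b a) (kx z x b a) (kb z x b a) (ka z x b a)"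
    and bwd: "\<And>z x b a. T z x b a \<Longrightarrow> S (lz z x b a) (lx z x b a) (lb z x b a) (la z x b a)"
    and cgk: "\<And>z x b a z' x' b' a'. S z x b a \<Longrightarrow> cg n z z' \<Longrightarrow> cg n x x' \<Longrightarrow> cg n b b' \<Longrightarrow> cg n a a' \<Longrightarrow>
      cg n (kz z x b a) (kz z' x' b' a') \<and> cg n (kx z x b a) (kx z' x' b' a') \<and>
      cg n (kb z x b a) (kb z' x' b' a') \<and> cg n (ka z x b a) (ka z' x' b' a')"
    and cgl: "\<And>z x b a z' x' b' a'. T z x b a \<Longrightarrow> cg n z z' \<Longrightarrow> cg n x x' \<Longrightarrow> cg n b b' \<Longrightarrow> cg n a a' \<Longrightarrow>
      cg n (lz z x b a) (lz z' x' b' a') \<and> cg n (lx z x b a) (lx z' x' b' a') \<and>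
      cg n (lb z x b a) (lb z' x' b' a') \<and> cg n (la z x b a) (la z' x' b' a')"
    and lk: "\<And>z x b a. S z x b a \<Longrightarrow>
      lz (kz z x b a) (kx z x b a) (kb z x b a) (ka z x b a) = z \<and>
      lx (kz z x b a) (kx z x b a) (kb z x b a) (ka z x b a) = x \<and>
      lb (kz z x b a) (kx z x b a) (kb z x b a) (ka z x b a) = b \<and>
      la (kz z x b a) (kx z x b a) (kb z x b a) (ka z x b a) = a"
    and kl: "\<And>z x b a. T z x b a \<Longrightarrow>
      kz (lz z x b a) (lx z x b a) (lb z x b a) (la z x b a) = z \<and>
      kx (lz z x b a) (lx z x b a) (lb z x b a) (la z x b a) = x \<and>
      kb (lz z x b a) (lx z x b a) (lb z x b a) (la z x b a) = b \<and>
      ka (lz z x b a) (lx z x b a) (lb z x b a) (la z x b a) = a"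
    and g: "\<And>z x b a. S z x b a \<Longrightarrow> g z x b a = f (kz z x b a) (kx z x b a) (kb z x b a) (ka z x b a)"
  shows "J n S g = J n T f"
proof -
  \<comment> \<open>The images of chosen residues need not be chosen residues; \<open>rep n\<close>
    moves them back, and the congruence hypotheses absorb the change.\<close>
  define k where "k = (\<lambda>(z, x, b, a). (rep n (kz z x b a), rep n (kx z x b a), rep n (kb z x b a), rep n (ka z x b a)))"
  define l where "l = (\<lambda>(z, x, b, a). (rep n (lz z x b a), rep n (lx z x b a), rep n (lb z x b a), rep n (la z x b a)))"
  have "(\<Sum>(z, x, b, a)\<in>pts n S. g z x b a) = (\<Sum>(z, x, b, a)\<in>pts n T. f z x b a)"
  proof (rule sum.reindex_bij_witness[of _ l k])
    fix p assume p: "p \<in> pts n S"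
    obtain z x b a where pe: "p = (z, x, b, a)" by (cases p)
    have s: "S z x b a" and r: "z \<in> res n" "x \<in> res n" "b \<in> res n" "a \<in> res n"
      using p pe by (auto simp: pts_def)
    define z' x' b' a' where k': "z' = kz z x b a" "x' = kx z x b a" "b' = kb z x b a" "a' = ka z x b a"
    have t: "T z' x' b' a'" using fwd[OF s] by (simp add: k')
    have int: "z' \<in> \<O>" "x' \<in> \<O>" "b' \<in> \<O>" "a' \<in> \<O>" using cg_region_integers[OF T t] by auto
    note c = cg_rep[OF int(1), of n] cg_rep[OF int(2), of n] cg_rep[OF int(3), of n] cg_rep[OF int(4), of n]
    show "k p \<in> pts n T"
      using cg_regionD[OF T t c] rep(1) int by (simp add: k_def pe pts_def k')
    show "l (k p) = p"
      using cgl[OF t c] lk[OF s] r by (auto simp: k_def l_def pe k' intro!: rep_eqI[OF cg_sym])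
    show "(case k p of (z, x, b, a) \<Rightarrow> f z x b a) = (case p of (z, x, b, a) \<Rightarrow> g z x b a)"
      using cg_funD[OF f t c] g[OF s] by (simp add: k_def pe k')
  next
    fix p assume p: "p \<in> pts n T"
    obtain z x b a where pe: "p = (z, x, b, a)" by (cases p)
    have s: "T z x b a" and r: "z \<in> res n" "x \<in> res n" "b \<in> res n" "a \<in> res n"
      using p pe by (auto simp: pts_def)
    define z' x' b' a' where k': "z' = lz z x b a" "x' = lx z x b a" "b' = lb z x b a" "a' = la z x b a"
    have t: "S z' x' b' a'" using bwd[OF s] by (simp add: k')
    have int: "z' \<in> \<O>" "x' \<in> \<O>" "b' \<in> \<O>" "a' \<in> \<O>" using cg_region_integers[OF S t] by auto
    note c = cg_rep[OF int(1), of n] cg_rep[OF int(2), of n] cg_rep[OF int(3), of n] cg_rep[OF int(4), of n]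
    show "l p \<in> pts n S"
      using cg_regionD[OF S t c] rep(1) int by (simp add: l_def pe pts_def k')
    show "k (l p) = p"
      using cgk[OF t c] kl[OF s] r by (auto simp: k_def l_def pe k' intro!: rep_eqI[OF cg_sym])
  qed
  then show ?thesis by (simp add: J_def)
qed

lemma sum_pts: "(\<Sum>(z, x, b, a)\<in>pts n S. f z x b a) =
    (\<Sum>z\<in>res n. \<Sum>x\<in>res n. \<Sum>b\<in>res n. \<Sum>a\<in>res n. if S z x b a then f z x b a else 0)"
proof -
  have "pts n S = {p \<in> res n \<times> res n \<times> res n \<times> res n. case p of (z, x, b, a) \<Rightarrow> S z x b a}"
    by (auto simp: pts_def)
  then show ?thesis
    by (simp add: sum.inter_filter sum.cartesian_product case_prod_unfold)
qed

text \<open>Invariance at level \<open>n\<close> is asked for while the average is taken at level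
  \<open>Suc n\<close>, since dividing by \<open>w\<close> loses one digit.\<close>

lemma J_scale:
  assumes S: "cg_region n S" and f: "cg_fun n S f"
  shows "J (Suc n) (\<lambda>z x b a. z \<in> \<P> \<and> S (z / w) x b a) (\<lambda>z x b a. f (z / w) x b a) =
    (1 / real q) *\<^sub>R J (Suc n) S f"
proof -
  define g where "g z = (\<Sum>x\<in>res (Suc n). \<Sum>b\<in>res (Suc n). \<Sum>a\<in>res (Suc n). if S z x b a then f z x b a else 0)" for z
  have eq: "(if S z x b a then f z x b a else 0) = (if S z' x b a then f z' x b a else 0)"
    if "cg n z z'" "x \<in> \<O>" "b \<in> \<O>" "a \<in> \<O>" for z z' x b a
    using that cg_regionD[OF S, of z x b a z' x b a] cg_regionD[OF S, of z' x b a z x b a]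
      cg_funD[OF f, of z x b a z' x b a] cg_refl cg_sym by auto
  have g: "cg_inv n g"
    unfolding cg_inv_def g_def using eq res_integers by (intro allI impI sum.cong refl) blast
  have "(\<Sum>(z, x, b, a)\<in>pts (Suc n) (\<lambda>z x b a. z \<in> \<P> \<and> S (z / w) x b a). f (z / w) x b a) =
      (\<Sum>z\<in>res (Suc n). if z \<in> \<P> then g (z / w) else 0)"
    unfolding sum_pts g_def by (intro sum.cong) auto
  also have "\<dots> = (\<Sum>r\<in>{r\<in>res (Suc n). r \<in> \<P>}. g (r / w))"
    by (simp add: sum.inter_filter)
  also have "\<dots> = (1 / real q) *\<^sub>R (\<Sum>r\<in>res (Suc n). g r)"
    by (rule sum_res_max_ideal[OF g])
  also have "(\<Sum>r\<in>res (Suc n). g r) = (\<Sum>(z, x, b, a)\<in>pts (Suc n) S. f z x b a)"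
    unfolding sum_pts g_def ..
  finally show ?thesis by (simp add: J_def)
qed

lemma J_swap: "J n (\<lambda>z x b a. S x z b a) (\<lambda>z x b a. f x z b a) = J n S f"
  unfolding J_def
  by (intro arg_cong2[of _ _ _ _ scaleR] refl
      sum.reindex_bij_witness[of _ "\<lambda>(z, x, b, a). (x, z, b, a)" "\<lambda>(z, x, b, a). (x, z, b, a)"])
    (auto simp: pts_def)

lemma J_swap_last: "J n (\<lambda>z x b a. S a x b z) (\<lambda>z x b a. f a x b z) = J n S f"
  unfolding J_def
  by (intro arg_cong2[of _ _ _ _ scaleR] refl
      sum.reindex_bij_witness[of _ "\<lambda>(z, x, b, a). (a, x, b, z)" "\<lambda>(z, x, b, a). (a, x, b, z)"])
    (auto simp: pts_def)

definition cg_set :: "'f set \<Rightarrow> bool" where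
  "cg_set A \<longleftrightarrow> (\<forall>x\<in>A. x \<in> \<O> \<and> (\<forall>n\<ge>1. \<forall>y. cg n x y \<longrightarrow> y \<in> A))"

lemma cg_setI:
  "(\<And>x. x \<in> A \<Longrightarrow> x \<in> \<O>) \<Longrightarrow> (\<And>n x y. x \<in> A \<Longrightarrow> n \<ge> 1 \<Longrightarrow> cg n x y \<Longrightarrow> y \<in> A) \<Longrightarrow> cg_set A"
  unfolding cg_set_def by blast

lemma cg_set_integers: "cg_set \<O>"
  by (rule cg_setI) (auto intro: cg_integers)

lemma cg_set_units: "cg_set \<U>"
  by (rule cg_setI) (auto intro: cg_units units_integers)

lemma cg_set_units1: "cg_set (Ounits1 ord)"
proof (rule cg_setI)
  fix n x y assume "x \<in> Ounits1 ord" "n \<ge> 1" "cg n x y"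
  moreover from this have "cg n (1 - x) (1 - y)" by (intro cg_diff cg_refl integers_1)
  ultimately show "y \<in> Ounits1 ord" using cg_units[of n x y] cg_units[of n "1 - x" "1 - y"]
    by (auto simp: Ounits1_iff)
qed (auto simp: Ounits1_iff units_integers)

lemma cg_set_max_ideal: "cg_set \<P>"
  by (rule cg_setI) (auto intro: cg_max_ideal max_ideal_integers)

lemma cg_setD: "cg_set A \<Longrightarrow> x \<in> A \<Longrightarrow> n \<ge> 1 \<Longrightarrow> cg n x y \<Longrightarrow> y \<in> A"
  and cg_set_in: "cg_set A \<Longrightarrow> x \<in> A \<Longrightarrow> x \<in> \<O>"
  unfolding cg_set_def by blast+

abbreviation box :: "'f set \<Rightarrow> 'f set \<Rightarrow> 'f set \<Rightarrow> 'f set \<Rightarrow> 'f \<Rightarrow> 'f \<Rightarrow> 'f \<Rightarrow> 'f \<Rightarrow> bool" where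
  "box A B C D z x b a \<equiv> z \<in> A \<and> x \<in> B \<and> b \<in> C \<and> a \<in> D"

text \<open>One level serves all four variables, so each inner integral is again invariant at that
  level and \<open>integ_eq\<close> applies from the inside outwards.\<close>

lemma integ_box:
  fixes f :: "'f \<Rightarrow> 'f \<Rightarrow> 'f \<Rightarrow> 'f \<Rightarrow> 'v::real_vector"
  assumes A: "cg_set A" and B: "cg_set B" and C: "cg_set C" and D: "cg_set D" and n: "n \<ge> 1"
    and f: "cg_fun n (box A B C D) f"
  shows "integ ord A (\<lambda>z. integ ord B (\<lambda>x. integ ord C (\<lambda>b. integ ord D (\<lambda>a. f z x b a)))) =
    J n (box A B C D) f"
proof -
  let ?c = "1 / real (q ^ n)"
  have ff: "f z x b a = f z' x' b' a'" if "z \<in> A" "x \<in> B" "b \<in> C" "a \<in> D"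
    "cg n z z'" "cg n x x'" "cg n b b'" "cg n a a'" for z x b a z' x' b' a'
    using cg_funD[OF f, of z x b a] that by blast
  have r: "cg n x x" if "x \<in> A \<or> x \<in> B \<or> x \<in> C \<or> x \<in> D" for x
    using that A B C D cg_refl cg_set_in by blast
  have 1: "integ ord D (\<lambda>a. f z x b a) = ?c *\<^sub>R (\<Sum>a\<in>res n \<inter> D. f z x b a)"
    if "z \<in> A" "x \<in> B" "b \<in> C" for z x b
    using that r by (intro integ_eq) (auto intro: cg_setD[OF D _ n] cg_set_in[OF D] ff)
  have 2: "integ ord C (\<lambda>b. integ ord D (\<lambda>a. f z x b a)) =
      ?c *\<^sub>R (\<Sum>b\<in>res n \<inter> C. ?c *\<^sub>R (\<Sum>a\<in>res n \<inter> D. f z x b a))"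
    if "z \<in> A" "x \<in> B" for z x
    using that r
    by (subst integ_eq[of _ n]) (auto intro: cg_setD[OF C _ n] cg_set_in[OF C] simp: 1
        intro!: ff sum.cong arg_cong2[of _ _ _ _ scaleR])
  have 3: "integ ord B (\<lambda>x. integ ord C (\<lambda>b. integ ord D (\<lambda>a. f z x b a))) =
      ?c *\<^sub>R (\<Sum>x\<in>res n \<inter> B. ?c *\<^sub>R (\<Sum>b\<in>res n \<inter> C. ?c *\<^sub>R (\<Sum>a\<in>res n \<inter> D. f z x b a)))"
    if "z \<in> A" for z
    using that r
    by (subst integ_eq[of _ n]) (auto intro: cg_setD[OF B _ n] cg_set_in[OF B] simp: 2
        intro!: ff sum.cong arg_cong2[of _ _ _ _ scaleR])
  have 4: "integ ord A (\<lambda>z. integ ord B (\<lambda>x. integ ord C (\<lambda>b. integ ord D (\<lambda>a. f z x b a)))) =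
      ?c *\<^sub>R (\<Sum>z\<in>res n \<inter> A. ?c *\<^sub>R (\<Sum>x\<in>res n \<inter> B. ?c *\<^sub>R (\<Sum>b\<in>res n \<inter> C. ?c *\<^sub>R (\<Sum>a\<in>res n \<inter> D. f z x b a))))"
    using r
    by (subst integ_eq[of _ n]) (auto intro: cg_setD[OF A _ n] cg_set_in[OF A] simp: 3
        intro!: ff sum.cong arg_cong2[of _ _ _ _ scaleR])
  have c: "?c * (?c * (?c * ?c)) = 1 / real q ^ (4 * n)"
  proof -
    have "real q ^ (n + (n + (n + n))) = real q ^ (4 * n)" by (rule arg_cong[of _ _ "(^) (real q)"]) simp
    then show ?thesis by (simp add: power_add)
  qed
  have p: "pts n (box A B C D) = (res n \<inter> A) \<times> (res n \<inter> B) \<times> (res n \<inter> C) \<times> (res n \<inter> D)"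
    by (auto simp: pts_def)
  show ?thesis
    unfolding 4 J_def p c[symmetric]
    by (simp add: scaleR_sum_right[symmetric] sum.cartesian_product case_prod_unfold)
qed

text \<open>Since \<open>\<O>\<close> has volume 1, dummy integrations are free. Level
  \<open>0\<close> suffices for a constant.\<close>

lemma integ_const: "integ ord \<O> (\<lambda>_. c) = (c :: 'v::real_vector)"
proof -
  have "res 0 \<inter> \<O> = res 0" using res_integers by auto
  then show ?thesis
    using integ_eq[of \<O> 0 "\<lambda>_. c"] by (simp add: cg_def card_res sum_constant_scaleR)
qed

end

subsection \<open>Symplectic matrices\<close>

lemma Rep_bit0_4: "Rep_bit0 (1::4) = 1" "Rep_bit0 (2::4) = 2" "Rep_bit0 (3::4) = 3" "Rep_bit0 (4::4) = 0"
  by (simp_all add: bit0.Rep_1 bit0.Rep_numeral)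

text \<open>In the index type the numeral \<open>4\<close> equals \<open>0\<close>, so index
  \<open>4\<close> is the first row or column and \<open>1\<close>, \<open>2\<close>,
  \<open>3\<close> are the second to fourth.\<close>

lemma M4_nth:
  "M4 [[a11,a12,a13,a14],[a21,a22,a23,a24],[a31,a32,a33,a34],[a41,a42,a43,a44]] $ i $ j =
    (if i = 4 then if j = 4 then a11 else if j = 1 then a12 else if j = 2 then a13 else a14
     else if i = 1 then if j = 4 then a21 else if j = 1 then a22 else if j = 2 then a23 else a24
     else if i = 2 then if j = 4 then a31 else if j = 1 then a32 else if j = 2 then a33 else a34
     else if j = 4 then a41 else if j = 1 then a42 else if j = 2 then a43 else a44)"
  using exhaust_4[of i] exhaust_4[of j] by (auto simp: M4_def Rep_bit0_4)

lemma M4_eqI: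
  assumes "a11 = b11" "a12 = b12" "a13 = b13" "a14 = b14" "a21 = b21" "a22 = b22" "a23 = b23" "a24 = b24"
    "a31 = b31" "a32 = b32" "a33 = b33" "a34 = b34" "a41 = b41" "a42 = b42" "a43 = b43" "a44 = b44"
  shows "M4 [[a11,a12,a13,a14],[a21,a22,a23,a24],[a31,a32,a33,a34],[a41,a42,a43,a44]] =
    M4 [[b11,b12,b13,b14],[b21,b22,b23,b24],[b31,b32,b33,b34],[b41,b42,b43,b44]]"
  using assms by simp

lemma M4_mult:
  fixes a11 :: "'a::comm_ring_1"
  shows "M4 [[a11,a12,a13,a14],[a21,a22,a23,a24],[a31,a32,a33,a34],[a41,a42,a43,a44]] **
    M4 [[b11,b12,b13,b14],[b21,b22,b23,b24],[b31,b32,b33,b34],[b41,b42,b43,b44]] =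
    M4 [[a11*b11+a12*b21+a13*b31+a14*b41, a11*b12+a12*b22+a13*b32+a14*b42,
         a11*b13+a12*b23+a13*b33+a14*b43, a11*b14+a12*b24+a13*b34+a14*b44],
        [a21*b11+a22*b21+a23*b31+a24*b41, a21*b12+a22*b22+a23*b32+a24*b42,
         a21*b13+a22*b23+a23*b33+a24*b43, a21*b14+a22*b24+a23*b34+a24*b44],
        [a31*b11+a32*b21+a33*b31+a34*b41, a31*b12+a32*b22+a33*b32+a34*b42,
         a31*b13+a32*b23+a33*b33+a34*b43, a31*b14+a32*b24+a33*b34+a34*b44],
        [a41*b11+a42*b21+a43*b31+a44*b41, a41*b12+a42*b22+a43*b32+a44*b42,
         a41*b13+a42*b23+a43*b33+a44*b43, a41*b14+a42*b24+a43*b34+a44*b44]]"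
  by (simp add: vec_eq_iff forall_4 matrix_matrix_mult_def sum_4 M4_nth)

lemma M4_transpose:
  "transpose (M4 [[a11,a12,a13,a14],[a21,a22,a23,a24],[a31,a32,a33,a34],[a41,a42,a43,a44]]) =
    M4 [[a11,a21,a31,a41],[a12,a22,a32,a42],[a13,a23,a33,a43],[a14,a24,a34,a44]]"
  by (simp add: vec_eq_iff forall_4 transpose_def M4_nth)

lemma mat_M4: "mat c = M4 [[c,0,0,0],[0,c,0,0],[0,0,c,0],[0,0,0,c]]"
  by (simp add: vec_eq_iff forall_4 mat_def M4_nth)

text \<open>Every matrix that acts below has multiplier 1, which avoids carrying multipliers through
  the products.\<close>

definition Sp4 :: "('f::field^4^4) set" where
  "Sp4 = {g. transpose g ** Jp ** g = Jp}"

lemma Sp4_mult: "g \<in> Sp4 \<Longrightarrow> h \<in> Sp4 \<Longrightarrow> g ** h \<in> Sp4"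
  unfolding Sp4_def by (simp add: matrix_transpose_mul) (metis matrix_mul_assoc)

lemma Sp4_factor:
  assumes "g \<in> Sp4" "g ** k \<in> Sp4" shows "k \<in> Sp4"
proof -
  have "transpose k ** (transpose g ** Jp ** g) ** k = Jp"
    using assms(2) by (simp add: Sp4_def matrix_transpose_mul matrix_mul_assoc)
  then show ?thesis using assms(1) by (simp add: Sp4_def)
qed

lemma Sp4_GSp4: "g \<in> Sp4 \<Longrightarrow> g \<in> GSp4"
  unfolding Sp4_def GSp4_def by (auto intro!: exI[of _ 1])

lemma simil_Sp4: "g \<in> Sp4 \<Longrightarrow> simil g = 1"
  unfolding simil_def Sp4_def
  by (rule the_equality) (auto simp: Jp_def mat_M4 M4_mult vec_eq_iff forall_4 M4_nth)

lemma Jp_Jp: "(- Jp) ** Jp = (mat 1 :: 'f::field^4^4)"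
  by (simp add: vec_eq_iff forall_4 Jp_def mat_M4 matrix_matrix_mult_def sum_4 M4_nth)

text \<open>Because the inverse of \<open>Jp\<close> is \<open>- Jp\<close>, the entries of the
  inverse of \<open>g\<close> are entries of \<open>g\<close> up to sign; a bound on the
  denominators of \<open>g\<close> therefore bounds those of its inverse.\<close>

lemma Sp4_inverse:
  assumes "g \<in> Sp4" shows "(- Jp) ** transpose g ** Jp ** g = mat 1" "g ** ((- Jp) ** transpose g ** Jp) = mat 1"
proof -
  have "(- Jp) ** (transpose g ** Jp ** g) = mat 1" using assms Jp_Jp by (simp add: Sp4_def)
  then show *: "(- Jp) ** transpose g ** Jp ** g = mat 1" by (simp add: matrix_mul_assoc)
  then show "g ** ((- Jp) ** transpose g ** Jp) = mat 1" using matrix_left_right_inverse by blast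
qed

text \<open>The matrix \<open>iwa d1 d2 s r c t\<close> is
  \<open>diag(d1, d2, 1/d2, 1/d1) X(s) Y(r, c - s r, t)\<close>.\<close>

definition iwa :: "'f::field \<Rightarrow> 'f \<Rightarrow> 'f \<Rightarrow> 'f \<Rightarrow> 'f \<Rightarrow> 'f \<Rightarrow> 'f^4^4" where
  "iwa d1 d2 s r c t = M4 [[d1, d1 * s, d1 * (r + s * t), d1 * c], [0, d2, d2 * t, d2 * r],
     [0, 0, 1 / d2, - s / d2], [0, 0, 0, 1 / d1]]"

lemma XM_YM: "XM s ** YM r u t = iwa 1 1 s r (u + s * r) t"
  by (simp add: XM_def YM_def iwa_def M4_mult)

lemma YM_iwa: "YM r u t = iwa 1 1 0 r u t"
  by (simp add: YM_def iwa_def)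

lemma etaM_iwa: "w \<noteq> 0 \<Longrightarrow> etaM w ** iwa d1 d2 s r c t = iwa (d1 / w) d2 s r c t"
  by (simp add: etaM_def iwa_def M4_mult field_simps)

lemma tauM_iwa: "w \<noteq> 0 \<Longrightarrow> tauM w ** iwa d1 d2 s r c t = iwa d1 (d2 / w) s r c t"
  by (simp add: tauM_def iwa_def M4_mult field_simps)

text \<open>\<open>matrix_inv\<close> is a choice, so it is pinned down by exhibiting the two-sided
  inverse \<open>T\<close>.\<close>

lemma matrix_inv_tauM_iwa:
  assumes "w \<noteq> 0"
  shows "matrix_inv (tauM w) ** iwa d1 d2 s r c t = iwa d1 (w * d2) s r c t"
proof -
  define T where "T = M4 [[1,0,0,0],[0,w,0,0],[0,0,1/w,0],[0,0,0,1]]"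
  have T: "tauM w ** T = mat 1" "T ** tauM w = mat 1"
    using assms by (simp_all add: tauM_def T_def M4_mult mat_M4)
  then have "tauM w ** matrix_inv (tauM w) = mat 1 \<and> matrix_inv (tauM w) ** tauM w = mat 1"
    unfolding matrix_inv_def
    by (intro someI[of "\<lambda>A. tauM w ** A = mat 1 \<and> A ** tauM w = mat 1" T]) simp
  then have "matrix_inv (tauM w) ** (tauM w ** T) = T"
    by (simp only: matrix_mul_assoc) simp
  then have "matrix_inv (tauM w) = T"
    by (simp only: T(1) matrix_mul_rid)
  then show ?thesis using assms by (simp add: T_def iwa_def M4_mult field_simps)
qed

lemma iwa_Sp4: "d1 \<noteq> 0 \<Longrightarrow> d2 \<noteq> 0 \<Longrightarrow> iwa d1 d2 s r c t \<in> Sp4"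
  unfolding Sp4_def iwa_def Jp_def by (simp add: M4_transpose M4_mult field_simps)

lemma t4M_eq: "t4M w = M4 [[0,0,0,- 1 / w ^ 4],[0,1,0,0],[0,0,1,0],[w ^ 4,0,0,0]]"
  by (simp add: t4M_def power_int_minus divide_inverse)

lemma nM_eq: "nM w a b c = iwa 1 1 (- a / w) (b / w ^ 2) c 0"
  by (simp add: nM_def iwa_def power_int_minus divide_inverse)

lemma Sp4_generators:
  assumes "w \<noteq> 0"
  shows "t4M w \<in> Sp4" "LM x \<in> Sp4" "s1M \<in> Sp4" "etaM w \<in> Sp4" "tauM w \<in> Sp4"
    "matrix_inv (tauM w) \<in> Sp4" "nM w a b c \<in> Sp4" "mat 1 \<in> Sp4"
proof -
  have "mat 1 = iwa 1 1 0 0 0 (0 :: 'a)" by (simp add: mat_M4 iwa_def)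
  then have "matrix_inv (tauM w) = iwa 1 w 0 0 0 0" "tauM w = iwa 1 (1 / w) 0 0 0 0" "etaM w = iwa (1 / w) 1 0 0 0 0"
    using matrix_inv_tauM_iwa[OF assms, of 1 1 0 0 0 0] tauM_iwa[OF assms, of 1 1 0 0 0 0]
      etaM_iwa[OF assms, of 1 1 0 0 0 0] by (simp_all flip: \<open>mat 1 = _\<close>)
  then show "matrix_inv (tauM w) \<in> Sp4" "tauM w \<in> Sp4" "etaM w \<in> Sp4"
    using assms by (simp_all add: iwa_Sp4)
qed (use assms in \<open>simp_all add: Sp4_def t4M_eq LM_def s1M_def nM_def mat_M4 Jp_def M4_transpose M4_mult\<close>)

context local_field
begin

subsection \<open>Uniformly locally constant functions\<close>

text \<open>Congruence for numbers with denominators: they may have denominator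
  \<open>w ^ e\<close>, and \<open>e\<close> digits of precision are lost.\<close>

definition near :: "nat \<Rightarrow> nat \<Rightarrow> 'f \<Rightarrow> 'f \<Rightarrow> bool" where
  "near e n x y \<longleftrightarrow> x \<in> pideal ord (- int e) \<and> y \<in> pideal ord (- int e) \<and> x - y \<in> pideal ord (int n - int e)"

lemma near_mono: "near e n x y \<Longrightarrow> e \<le> e' \<Longrightarrow> near e' n x y"
  unfolding near_def by (auto elim!: pideal_mono)

lemma near_add:
  assumes "near d n x x'" "near e n y y'"
  shows "near (max d e) n (x + y) (x' + y')"
proof -
  have "near (max d e) n x x'" "near (max d e) n y y'"
    using assms near_mono max.cobounded1 max.cobounded2 by blast+
  then show ?thesis
    using pideal_add[of "x - x'" "int n - int (max d e)" "y - y'"]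
    by (auto simp: near_def algebra_simps simp del: of_nat_max intro: pideal_add)
qed

lemma near_mult:
  assumes "near d n x x'" "near e n y y'"
  shows "near (d + e) n (x * y) (x' * y')"
proof -
  have "(x - x') * y \<in> pideal ord ((int n - int d) + (- int e))"
    "x' * (y - y') \<in> pideal ord ((- int d) + (int n - int e))"
    "x * y \<in> pideal ord ((- int d) + (- int e))" "x' * y' \<in> pideal ord ((- int d) + (- int e))"
    by (intro pideal_mult; use assms in \<open>simp add: near_def\<close>)+
  moreover from this(1,2) have "(x - x') * y + x' * (y - y') \<in> pideal ord (int n - int (d + e))"
    by (intro pideal_add) (simp_all add: algebra_simps)
  ultimately show ?thesis by (simp add: near_def algebra_simps)
qed

text \<open>Inverting units loses nothing further, since the difference of the inverses is the
  difference of the units times a unit.\<close>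

lemma near_inverse:
  assumes "near e n x x'" "x \<in> \<U>" "x' \<in> \<U>"
  shows "near e n (inverse x) (inverse x')"
proof -
  have i: "inverse x \<in> pideal ord 0" "inverse x' \<in> pideal ord 0"
    using assms(2,3) integers_inverse by (auto simp: integers_eq)
  have "- ((x - x') * (inverse x * inverse x')) \<in> pideal ord ((int n - int e) + (0 + 0))"
    unfolding pideal_minus using assms(1) i by (intro pideal_mult) (auto simp: near_def)
  moreover have "- ((x - x') * (inverse x * inverse x')) = inverse x - inverse x'"
    using assms(2,3) units_nonzero by (simp add: field_simps)
  ultimately show ?thesis using i by (auto simp: near_def elim!: pideal_mono)
qed

text \<open>Bounded and Lipschitz: the loss \<open>e\<close> is the same for every level
  \<open>n\<close>. This uniformity is what survives sums, products and division by units.\<close>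

definition bl_at :: "nat \<Rightarrow> ('f \<Rightarrow> 'f \<Rightarrow> 'f \<Rightarrow> 'f \<Rightarrow> bool) \<Rightarrow> ('f \<Rightarrow> 'f \<Rightarrow> 'f \<Rightarrow> 'f \<Rightarrow> 'f) \<Rightarrow> bool" where
  "bl_at e S h \<longleftrightarrow> (\<forall>n z x b a z' x' b' a'. S z x b a \<longrightarrow> S z' x' b' a' \<longrightarrow>
     cg n z z' \<longrightarrow> cg n x x' \<longrightarrow> cg n b b' \<longrightarrow> cg n a a' \<longrightarrow> near e n (h z x b a) (h z' x' b' a'))"

definition bl :: "('f \<Rightarrow> 'f \<Rightarrow> 'f \<Rightarrow> 'f \<Rightarrow> bool) \<Rightarrow> ('f \<Rightarrow> 'f \<Rightarrow> 'f \<Rightarrow> 'f \<Rightarrow> 'f) \<Rightarrow> bool" where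
  "bl S h \<longleftrightarrow> (\<exists>e. bl_at e S h)"

lemma bl_atD: "bl_at e S h \<Longrightarrow> S z x b a \<Longrightarrow> S z' x' b' a' \<Longrightarrow>
     cg n z z' \<Longrightarrow> cg n x x' \<Longrightarrow> cg n b b' \<Longrightarrow> cg n a a' \<Longrightarrow> near e n (h z x b a) (h z' x' b' a')"
  unfolding bl_at_def by blast

lemma bl_const: "bl S (\<lambda>z x b a. c)"
proof -
  obtain e :: nat where "c \<in> pideal ord (- int e)" using ex_pideal by blast
  then show ?thesis unfolding bl_def bl_at_def near_def by auto
qed

lemma bl_vars: "bl S (\<lambda>z x b a. z)" "bl S (\<lambda>z x b a. x)" "bl S (\<lambda>z x b a. b)" "bl S (\<lambda>z x b a. a)"
  unfolding bl_def bl_at_def by (rule exI[of _ 0]; simp add: near_def cg_def integers_eq)+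

lemma bl_add: "bl S f \<Longrightarrow> bl S g \<Longrightarrow> bl S (\<lambda>z x b a. f z x b a + g z x b a)"
  unfolding bl_def
proof (elim exE)
  fix d e assume "bl_at d S f" "bl_at e S g"
  then show "\<exists>e. bl_at e S (\<lambda>z x b a. f z x b a + g z x b a)"
    unfolding bl_at_def by (intro exI[of _ "max d e"] allI impI near_add) blast+
qed

lemma bl_mult: "bl S f \<Longrightarrow> bl S g \<Longrightarrow> bl S (\<lambda>z x b a. f z x b a * g z x b a)"
  unfolding bl_def
proof (elim exE)
  fix d e assume "bl_at d S f" "bl_at e S g"
  then show "\<exists>e. bl_at e S (\<lambda>z x b a. f z x b a * g z x b a)"
    unfolding bl_at_def by (intro exI[of _ "d + e"] allI impI near_mult) blast+
qed

lemma bl_minus: "bl S f \<Longrightarrow> bl S (\<lambda>z x b a. - f z x b a)"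
  using bl_mult[OF bl_const[of S "-1"], of f] by simp

lemma bl_diff: "bl S f \<Longrightarrow> bl S g \<Longrightarrow> bl S (\<lambda>z x b a. f z x b a - g z x b a)"
  using bl_add[OF _ bl_minus, of S f g] by simp

lemma bl_power: "bl S f \<Longrightarrow> bl S (\<lambda>z x b a. f z x b a ^ n)"
  by (induction n) (auto intro: bl_const bl_mult)

lemma bl_inverse: "bl S f \<Longrightarrow> (\<And>z x b a. S z x b a \<Longrightarrow> f z x b a \<in> \<U>) \<Longrightarrow>
    bl S (\<lambda>z x b a. inverse (f z x b a))"
  unfolding bl_def
proof (elim exE)
  fix e assume "bl_at e S f" and "\<And>z x b a. S z x b a \<Longrightarrow> f z x b a \<in> \<U>"
  then show "\<exists>e. bl_at e S (\<lambda>z x b a. inverse (f z x b a))"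
    unfolding bl_at_def by (intro exI[of _ e] allI impI near_inverse) blast+
qed

lemma bl_divide: "bl S f \<Longrightarrow> bl S g \<Longrightarrow> (\<And>z x b a. S z x b a \<Longrightarrow> g z x b a \<in> \<U>) \<Longrightarrow>
    bl S (\<lambda>z x b a. f z x b a / g z x b a)"
  using bl_mult[OF _ bl_inverse, of S f g] by (simp add: divide_inverse)

lemma bl_divide_const: "bl S f \<Longrightarrow> bl S (\<lambda>z x b a. f z x b a / c)"
  using bl_mult[OF _ bl_const, of S f "inverse c"] by (simp add: divide_inverse)

lemmas bl_intros = bl_const bl_vars bl_minus bl_add bl_diff bl_mult bl_power bl_divide_const

definition mbl :: "('f \<Rightarrow> 'f \<Rightarrow> 'f \<Rightarrow> 'f \<Rightarrow> bool) \<Rightarrow> ('f \<Rightarrow> 'f \<Rightarrow> 'f \<Rightarrow> 'f \<Rightarrow> 'f^4^4) \<Rightarrow> bool" where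
  "mbl S M \<longleftrightarrow> (\<forall>i j. bl S (\<lambda>z x b a. M z x b a $ i $ j))"

lemma mbl_const: "mbl S (\<lambda>z x b a. g)"
  by (simp add: mbl_def bl_const)

lemma mbl_mult: "mbl S M \<Longrightarrow> mbl S N \<Longrightarrow> mbl S (\<lambda>z x b a. M z x b a ** N z x b a)"
  unfolding mbl_def matrix_matrix_mult_def by (simp add: sum_4 bl_add bl_mult)

lemma mbl_iwa:
  assumes "bl S s" "bl S r" "bl S c" "bl S t"
  shows "mbl S (\<lambda>z x b a. iwa d1 d2 (s z x b a) (r z x b a) (c z x b a) (t z x b a))"
  unfolding mbl_def iwa_def by (simp add: forall_4 M4_nth) (intro conjI bl_intros assms)

lemma mbl_LM: "bl S h \<Longrightarrow> mbl S (\<lambda>z x b a. LM (h z x b a))"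
  unfolding mbl_def LM_def by (simp add: forall_4 M4_nth bl_const)

lemmas mbl_intros = mbl_const mbl_mult mbl_iwa mbl_LM

text \<open>As \<open>n = 1\<close> is included, a region is a union of cosets of
  \<open>\<P>\<close> in each variable.\<close>

definition region :: "('f \<Rightarrow> 'f \<Rightarrow> 'f \<Rightarrow> 'f \<Rightarrow> bool) \<Rightarrow> bool" where
  "region S \<longleftrightarrow> (\<forall>n\<ge>1. cg_region n S)"

lemma region_box: "cg_set A \<Longrightarrow> cg_set B \<Longrightarrow> cg_set C \<Longrightarrow> cg_set D \<Longrightarrow> region (box A B C D)"
  unfolding region_def by (auto intro!: cg_regionI intro: cg_setD cg_set_in)

lemma regionI:
  assumes "\<And>z x b a. S z x b a \<Longrightarrow> z \<in> \<O> \<and> x \<in> \<O> \<and> b \<in> \<O> \<and> a \<in> \<O>"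
    and "\<And>n z x b a z' x' b' a'. n \<ge> 1 \<Longrightarrow> S z x b a \<Longrightarrow> cg n z z' \<Longrightarrow> cg n x x' \<Longrightarrow> cg n b b' \<Longrightarrow> cg n a a' \<Longrightarrow>
      S z' x' b' a'"
  shows "region S"
  using assms unfolding region_def by (blast intro: cg_regionI)

definition loc :: "('f \<Rightarrow> 'f \<Rightarrow> 'f \<Rightarrow> 'f \<Rightarrow> bool) \<Rightarrow> ('f \<Rightarrow> 'f \<Rightarrow> 'f \<Rightarrow> 'f \<Rightarrow> 'v) \<Rightarrow> bool" where
  "loc S f \<longleftrightarrow> (\<exists>n. cg_fun n S f)"

lemma loc_eventually: "loc S f \<Longrightarrow> eventually (\<lambda>n. cg_fun n S f) sequentially"
  unfolding loc_def eventually_sequentially using cg_fun_mono by blast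

lemma loc_subset: "loc S f \<Longrightarrow> (\<And>z x b a. T z x b a \<Longrightarrow> S z x b a) \<Longrightarrow> loc T f"
  unfolding loc_def using cg_fun_subset by blast

end

section \<open>The quadratic character and the orbit map of the fixed vector\<close>

locale unramified_vector = local_field ord w q
  for ord :: "'f::field_char_0 \<Rightarrow> int" and w :: 'f and q :: nat +
  fixes chi :: "'f \<Rightarrow> real" and rho :: "'f^4^4 \<Rightarrow> 'v::real_vector \<Rightarrow> 'v" and v :: 'v
  assumes chi: "quad_char_cond_p ord chi"
    and rho: "smooth_rep_trivcent ord rho"
    and v: "v \<in> Vfix ord rho 0"
begin

lemma chi_mult: "x \<noteq> 0 \<Longrightarrow> y \<noteq> 0 \<Longrightarrow> chi (x * y) = chi x * chi y"
  and chi_square: "x \<noteq> 0 \<Longrightarrow> chi x * chi x = 1"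
  and chi_1_add: "y \<in> \<P> \<Longrightarrow> chi (1 + y) = 1"
  using chi unfolding quad_char_cond_p_def power2_eq_square by auto

text \<open>A quadratic character is trivial on squares and this one on \<open>1 + \<P>\<close>.
  Every later comparison of characters consists in supplying the square root \<open>s\<close> and
  the error \<open>e\<close>.\<close>

lemma chi_eqI:
  assumes "x \<noteq> 0" "y \<noteq> 0" "s \<noteq> 0" "e \<in> \<P>" "x * y = s ^ 2 * (1 + e)"
  shows "chi x = chi y"
proof -
  have "1 + e \<noteq> 0" using units_add_max_ideal[OF units_1 assms(4)] units_nonzero by blast
  then have "chi (x * y) = 1"
    using assms by (simp add: chi_mult chi_1_add chi_square power2_eq_square)
  then have "chi x * chi y = 1" using chi_mult[OF assms(1,2)] by simp
  then have "chi x * (chi y * chi y) = chi y" by (simp add: mult.assoc[symmetric])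
  then show ?thesis using chi_square[OF assms(2)] by simp
qed

lemma chi_cg: "cg n x y \<Longrightarrow> n \<ge> 1 \<Longrightarrow> x \<in> \<U> \<Longrightarrow> chi x = chi y"
proof -
  assume xy: "cg n x y" "n \<ge> 1" "x \<in> \<U>"
  then have y: "y \<in> \<U>" using cg_units by blast
  have "cg 1 x y" using xy cg_mono by blast
  then have "x - y \<in> \<P>" by (simp add: cg_def max_ideal_eq)
  then have "(x - y) / y \<in> \<P>" using y max_ideal_divide by blast
  moreover have "x * y = y ^ 2 * (1 + (x - y) / y)"
    using units_nonzero[OF y] by (simp add: field_simps power2_eq_square)
  ultimately show ?thesis using xy y units_nonzero chi_eqI by blast
qed

abbreviation Phi :: "'f^4^4 \<Rightarrow> 'v" where "Phi g \<equiv> rho g v"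

lemma rho_linear: "g \<in> Sp4 \<Longrightarrow> linear (rho g)"
  and rho_mult: "g \<in> Sp4 \<Longrightarrow> h \<in> Sp4 \<Longrightarrow> rho (g ** h) u = rho g (rho h u)"
  and rho_1: "rho (mat 1) u = u"
  using rho Sp4_GSp4[of g] Sp4_GSp4[of h] unfolding smooth_rep_trivcent_def by auto

text \<open>By \<open>Sp4_factor\<close> the quotient \<open>k\<close> is symplectic, hence lies in
  the integral group at level \<open>0\<close>, which fixes \<open>v\<close>.\<close>

lemma Phi_right_invariant:
  assumes "g \<in> Sp4" "g' \<in> Sp4" "g = g' ** k" "\<And>i j. k $ i $ j \<in> \<O>"
  shows "Phi g = Phi g'"
proof -
  have k: "k \<in> Sp4" using assms Sp4_factor by blast
  have "kexp 0 ! nat (Rep_bit0 i) ! nat (Rep_bit0 j) = 0" for i j :: 4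
    using exhaust_4[of i] exhaust_4[of j] by (auto simp: kexp_def Rep_bit0_4)
  then have "k \<in> Kpara ord 0"
    using k assms(4) by (simp add: Kpara_def Sp4_GSp4 simil_Sp4 units_1 integers_eq)
  then have "rho k v = v" using v by (simp add: Vfix_def)
  then show ?thesis using assms k by (simp add: rho_mult)
qed

lemma Phi_eqI:
  assumes "g = g' ** M4 [[a11,a12,a13,a14],[a21,a22,a23,a24],[a31,a32,a33,a34],[a41,a42,a43,a44]]"
    and "h \<in> Sp4" "g \<in> Sp4" "g' \<in> Sp4"
    and "a11 \<in> \<O>" "a12 \<in> \<O>" "a13 \<in> \<O>" "a14 \<in> \<O>" "a21 \<in> \<O>" "a22 \<in> \<O>" "a23 \<in> \<O>" "a24 \<in> \<O>"
      "a31 \<in> \<O>" "a32 \<in> \<O>" "a33 \<in> \<O>" "a34 \<in> \<O>" "a41 \<in> \<O>" "a42 \<in> \<O>" "a43 \<in> \<O>" "a44 \<in> \<O>"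
  shows "Phi (h ** g) = Phi (h ** g')"
proof -
  have "Phi g = Phi g'"
    using assms(3,4,1) by (rule Phi_right_invariant) (use assms in \<open>simp add: M4_nth\<close>)
  then show ?thesis using assms by (simp add: rho_mult)
qed

text \<open>The quotient of nearby matrices is \<open>1 + gi (g' - g)\<close>. Both factors of the
  correction cost at most \<open>e\<close> digits, so it is integral as soon as
  \<open>2 * e \<le> n\<close>, and right invariance applies.\<close>

lemma Phi_cg:
  assumes "g \<in> Sp4" "g' \<in> Sp4" "\<And>i j. g $ i $ j \<in> pideal ord (- int e)"
    and "\<And>i j. g $ i $ j - g' $ i $ j \<in> pideal ord (int n - int e)" "2 * e \<le> n"
  shows "Phi g' = Phi g"
proof -
  define gi where "gi = (- Jp) ** transpose g ** Jp"
  have gi: "gi ** g = mat 1" "g ** gi = mat 1"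
    using Sp4_inverse[OF assms(1)] by (simp_all add: gi_def)
  have gi_bound: "gi $ i $ j \<in> pideal ord (- int e)" for i j
    using exhaust_4[of i] exhaust_4[of j] assms(3)
    by (auto simp: gi_def Jp_def matrix_matrix_mult_def sum_4 M4_nth transpose_def)
  have "gi ** g' = mat 1 + gi ** (g' - g)"
    using gi matrix_add_ldistrib[of gi g "g' - g"] by simp
  moreover have "(mat 1 + gi ** (g' - g)) $ i $ j \<in> \<O>" for i j
  proof -
    have "gi $ i $ k * (g' $ k $ j - g $ k $ j) \<in> \<O>" for k
    proof -
      have "gi $ i $ k * (g' $ k $ j - g $ k $ j) \<in> pideal ord (- int e + (int n - int e))"
        using gi_bound assms(4) by (intro pideal_mult) (simp_all add: pideal_diff_commute)
      then show ?thesis using assms(5) by (auto simp: integers_eq elim!: pideal_mono)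
    qed
    then show ?thesis
      by (simp add: matrix_matrix_mult_def sum_4 mat_def integers_add integers_0 integers_1)
  qed
  moreover have "g' = g ** (gi ** g')" using gi by (simp add: matrix_mul_assoc)
  ultimately show ?thesis using Phi_right_invariant[OF assms(2,1), of "gi ** g'"] by simp
qed

text \<open>The character needs its argument modulo \<open>\<P>\<close> only, and the vector needs
  the matrix up to an integral right factor; Lipschitz entries give both from a fixed level
  on.\<close>

lemma loc_integrand:
  assumes S: "region S" and h: "bl S h" "\<And>z x b a. S z x b a \<Longrightarrow> h z x b a \<in> \<U>"
    and M: "mbl S M" "\<And>z x b a. S z x b a \<Longrightarrow> M z x b a \<in> Sp4"
  shows "loc S (\<lambda>z x b a. chi (h z x b a) *\<^sub>R Phi (M z x b a))"
proof -
  obtain e1 where e1: "bl_at e1 S h" using h(1) by (auto simp: bl_def)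
  obtain E where E: "bl_at (E i j) S (\<lambda>z x b a. M z x b a $ i $ j)" for i j
    using M(1) unfolding mbl_def bl_def by metis
  \<comment> \<open>The sum over all entries is a convenient common bound for the sixteen
    losses.\<close>
  define e where "e = (\<Sum>i\<in>UNIV. \<Sum>j\<in>UNIV. E i j)"
  have e: "E i j \<le> e" for i j
    using member_le_sum[of j UNIV "E i"] member_le_sum[of i UNIV "\<lambda>i. \<Sum>j\<in>UNIV. E i j"]
    unfolding e_def by simp
  show ?thesis
    unfolding loc_def cg_fun_def
  proof (intro exI allI impI)
    fix z x b a z' x' b' a'
    \<comment> \<open>\<open>Suc e1\<close> digits leave the argument of the character correct
      modulo \<open>\<P>\<close>; the \<open>2 * e\<close> digits are those required by
      \<open>Phi_cg\<close>.\<close>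
    define n where "n = Suc e1 + 2 * e"
    assume s: "S z x b a" and c: "cg (Suc e1 + 2 * e) z z'" "cg (Suc e1 + 2 * e) x x'"
      "cg (Suc e1 + 2 * e) b b'" "cg (Suc e1 + 2 * e) a a'"
    note c = c[folded n_def]
    have s': "S z' x' b' a'"
      using S s c cg_regionD[of n S] unfolding region_def by (simp add: n_def)
    have "h z x b a - h z' x' b' a' \<in> pideal ord (int 1)"
      using bl_atD[OF e1 s s' c] by (auto simp: near_def n_def elim!: pideal_mono)
    then have "cg 1 (h z x b a) (h z' x' b' a')"
      using h(2) s s' units_integers by (simp add: cg_def)
    then have "chi (h z x b a) = chi (h z' x' b' a')"
      using chi_cg h(2) s by blast
    moreover have "Phi (M z' x' b' a') = Phi (M z x b a)"
    proof (rule Phi_cg[of _ _ e n])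
      show "M z x b a $ i $ j \<in> pideal ord (- int e)" for i j
        using bl_atD[OF E s s' c, of i j] e[of i j] by (auto simp: near_def elim!: pideal_mono)
      show "M z x b a $ i $ j - M z' x' b' a' $ i $ j \<in> pideal ord (int n - int e)" for i j
        using bl_atD[OF E s s' c, of i j] e[of i j] by (auto simp: near_def elim!: pideal_mono)
    qed (use M(2) s s' in \<open>auto simp: n_def\<close>)
    ultimately show "chi (h z x b a) *\<^sub>R Phi (M z x b a) = chi (h z' x' b' a') *\<^sub>R Phi (M z' x' b' a')"
      by simp
  qed
qed

end

lemma M4_nth_in:
  assumes "a11 \<in> A" "a12 \<in> A" "a13 \<in> A" "a14 \<in> A" "a21 \<in> A" "a22 \<in> A" "a23 \<in> A" "a24 \<in> A"
    "a31 \<in> A" "a32 \<in> A" "a33 \<in> A" "a34 \<in> A" "a41 \<in> A" "a42 \<in> A" "a43 \<in> A" "a44 \<in> A"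
  shows "M4 [[a11,a12,a13,a14],[a21,a22,a23,a24],[a31,a32,a33,a34],[a41,a42,a43,a44]] $ i $ j \<in> A"
proof -
  have *: "(if c then x else y) \<in> A" if "x \<in> A" "y \<in> A" for c x y using that by simp
  show ?thesis unfolding M4_nth by (intro * assms)
qed

section \<open>Substitutions that preserve congruences\<close>

context local_field
begin

text \<open>The lossless and integral counterpart of \<open>bl\<close>: a change of variables must
  respect congruence at each level exactly, whereas matrix entries may lose digits.\<close>

definition lip :: "('f \<Rightarrow> 'f \<Rightarrow> 'f \<Rightarrow> 'f \<Rightarrow> bool) \<Rightarrow> ('f \<Rightarrow> 'f \<Rightarrow> 'f \<Rightarrow> 'f \<Rightarrow> 'f) \<Rightarrow> bool" where
  "lip S h \<longleftrightarrow> (\<forall>n\<ge>1. \<forall>z x b a z' x' b' a'. S z x b a \<longrightarrow> cg n z z' \<longrightarrow> cg n x x' \<longrightarrow>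
     cg n b b' \<longrightarrow> cg n a a' \<longrightarrow> cg n (h z x b a) (h z' x' b' a'))"

lemma lipI:
  assumes "\<And>n z x b a z' x' b' a'. n \<ge> 1 \<Longrightarrow> S z x b a \<Longrightarrow> cg n z z' \<Longrightarrow> cg n x x' \<Longrightarrow>
     cg n b b' \<Longrightarrow> cg n a a' \<Longrightarrow> cg n (h z x b a) (h z' x' b' a')"
  shows "lip S h"
  unfolding lip_def by (intro allI impI) (rule assms)

lemma lipD:
  assumes "lip S h" "n \<ge> 1" "S z x b a" "cg n z z'" "cg n x x'" "cg n b b'" "cg n a a'"
  shows "cg n (h z x b a) (h z' x' b' a')"
  by (rule assms(1)[unfolded lip_def, rule_format, OF assms(2-7)])

lemma lip_const: "c \<in> \<O> \<Longrightarrow> lip S (\<lambda>z x b a. c)"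
  by (rule lipI) (rule cg_refl)

lemma lip_vars: "lip S (\<lambda>z x b a. z)" "lip S (\<lambda>z x b a. x)" "lip S (\<lambda>z x b a. b)" "lip S (\<lambda>z x b a. a)"
  by (rule lipI; assumption)+

lemma lip_add:
  assumes "lip S f" "lip S g" shows "lip S (\<lambda>z x b a. f z x b a + g z x b a)"
  by (rule lipI, rule cg_add[OF lipD[OF assms(1)] lipD[OF assms(2)]])

lemma lip_diff:
  assumes "lip S f" "lip S g" shows "lip S (\<lambda>z x b a. f z x b a - g z x b a)"
  by (rule lipI, rule cg_diff[OF lipD[OF assms(1)] lipD[OF assms(2)]])

lemma lip_mult:
  assumes "lip S f" "lip S g" shows "lip S (\<lambda>z x b a. f z x b a * g z x b a)"
  by (rule lipI, rule cg_mult[OF lipD[OF assms(1)] lipD[OF assms(2)]])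

lemma lip_minus:
  assumes "lip S f" shows "lip S (\<lambda>z x b a. - f z x b a)"
  by (rule lipI, rule cg_minus, rule lipD[OF assms(1)]; assumption)

lemma lip_power:
  assumes "lip S f" shows "lip S (\<lambda>z x b a. f z x b a ^ m)"
  by (rule lipI, rule cg_power, rule lipD[OF assms(1)]; assumption)

lemma lip_divide:
  assumes "lip S f" "lip S g" "\<And>z x b a. S z x b a \<Longrightarrow> g z x b a \<in> \<U>"
  shows "lip S (\<lambda>z x b a. f z x b a / g z x b a)"
proof (rule lipI)
  fix n z x b a z' x' b' a'
  assume *: "n \<ge> 1" "S z x b a" "cg n z z'" "cg n x x'" "cg n b b'" "cg n a a'"
  show "cg n (f z x b a / g z x b a) (f z' x' b' a' / g z' x' b' a')"
    using lipD[OF assms(1) *] lipD[OF assms(2) *] *(1) assms(3)[OF *(2)] by (rule cg_divide)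
qed

lemmas lip_intros = lip_vars lip_minus lip_add lip_diff lip_mult lip_power lip_divide

lemma region_conj:
  assumes "region S" "lip S h" "cg_set A"
  shows "region (\<lambda>z x b a. S z x b a \<and> h z x b a \<in> A)"
proof (rule regionI)
  fix n z x b a z' x' b' a'
  assume *: "n \<ge> 1" "S z x b a \<and> h z x b a \<in> A" "cg n z z'" "cg n x x'" "cg n b b'" "cg n a a'"
  have "S z' x' b' a'"
    using * assms(1) cg_regionD[of n S z x b a] unfolding region_def by blast
  moreover have "h z' x' b' a' \<in> A"
    using * lipD[OF assms(2)] cg_setD[OF assms(3)] by blast
  ultimately show "S z' x' b' a' \<and> h z' x' b' a' \<in> A" ..
qed (use assms(1) cg_region_integers[of 1 S] in \<open>unfold region_def, blast\<close>)

lemmas cg_set_intros = cg_set_integers cg_set_units cg_set_units1 cg_set_max_ideal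

lemma J_subst_eventually:
  assumes fwd: "\<And>z x b a. S z x b a \<Longrightarrow>
      T (kz z x b a) (kx z x b a) (kb z x b a) (ka z x b a) \<and>
      lz (kz z x b a) (kx z x b a) (kb z x b a) (ka z x b a) = z \<and>
      lx (kz z x b a) (kx z x b a) (kb z x b a) (ka z x b a) = x \<and>
      lb (kz z x b a) (kx z x b a) (kb z x b a) (ka z x b a) = b \<and>
      la (kz z x b a) (kx z x b a) (kb z x b a) (ka z x b a) = a \<and>
      g z x b a = f (kz z x b a) (kx z x b a) (kb z x b a) (ka z x b a)"
    and bwd: "\<And>z x b a. T z x b a \<Longrightarrow>
      S (lz z x b a) (lx z x b a) (lb z x b a) (la z x b a) \<and>
      kz (lz z x b a) (lx z x b a) (lb z x b a) (la z x b a) = z \<and>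
      kx (lz z x b a) (lx z x b a) (lb z x b a) (la z x b a) = x \<and>
      kb (lz z x b a) (lx z x b a) (lb z x b a) (la z x b a) = b \<and>
      ka (lz z x b a) (lx z x b a) (lb z x b a) (la z x b a) = a"
    and S: "region S" and T: "region T" and f: "loc T f"
    and k: "lip S kz" "lip S kx" "lip S kb" "lip S ka"
    and l: "lip T lz" "lip T lx" "lip T lb" "lip T la"
  shows "\<forall>\<^sub>F n in sequentially. J n S g = J n T f"
  using loc_eventually[OF f] eventually_ge_at_top[of 1]
proof eventually_elim
  case (elim n)
  show ?case
  proof (rule J_subst[OF _ _ elim(1), where kz = kz and kx = kx and kb = kb and ka = ka
        and lz = lz and lx = lx and lb = lb and la = la])
    show "cg_region n S" "cg_region n T"
      using S T elim unfolding region_def by auto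
  next
    fix z x b a z' x' b' a'
    assume c: "cg n z z'" "cg n x x'" "cg n b b'" "cg n a a'"
    show "cg n (kz z x b a) (kz z' x' b' a') \<and> cg n (kx z x b a) (kx z' x' b' a') \<and>
      cg n (kb z x b a) (kb z' x' b' a') \<and> cg n (ka z x b a) (ka z' x' b' a')" if "S z x b a"
      using that k[THEN lipD, OF elim(2) that c] by blast
    show "cg n (lz z x b a) (lz z' x' b' a') \<and> cg n (lx z x b a) (lx z' x' b' a') \<and>
      cg n (lb z x b a) (lb z' x' b' a') \<and> cg n (la z x b a) (la z' x' b' a')" if "T z x b a"
      using that l[THEN lipD, OF elim(2) that c] by blast
  qed (use fwd bwd in simp_all)
qed

lemma J_scale_eventually:
  assumes S: "region S" and f: "loc S f"
  shows "eventually (\<lambda>n. J n (\<lambda>z x b a. z \<in> \<P> \<and> S (z / w) x b a) (\<lambda>z x b a. f (z / w) x b a) =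
    (1 / real q) *\<^sub>R J n S f) sequentially"
proof -
  obtain m where m: "cg_fun m S f" using f unfolding loc_def by blast
  show ?thesis
    using eventually_ge_at_top[of "Suc (max 1 m)"]
  proof eventually_elim
    case (elim n)
    then obtain k where k: "n = Suc k" "k \<ge> max 1 m" by (cases n) auto
    then show ?case
      using J_scale[of k S f] cg_fun_mono[OF m, of k] S unfolding region_def by simp
  qed
qed

end

section \<open>Iwasawa decompositions of the matrices and cells\<close>

context unramified_vector
begin

text \<open>The integral matrix \<open>k\<close> with \<open>t4 iwa = iwa' k\<close> is supplied
  explicitly. Since \<open>iwa'\<close> is upper triangular, the system is solved from the bottom:
  the last row of \<open>k\<close> is the last row of the left side times \<open>e1\<close>, and
  each higher row uses those below it. The sixteen equations are kept separate because they stay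
  small, whereas a full matrix product of rational functions does not.\<close>

lemma Phi_t4M_eqI:
  assumes "d \<noteq> 0" "e1 \<noteq> 0" "e2 \<noteq> 0"
    and "kda / e1 = w ^ 4" "kdb / e1 = w ^ 4 * s" "kdc / e1 = w ^ 4 * (r + s * t)" "kdd / e1 = w ^ 4 * c"
    and "kca = s' * kda" "kcb = s' * kdb" "kcc = e2 / d + s' * kdc" "kcd = s' * kdd - e2 * s / d"
    and "kba + t' * kca + r' * kda = 0" "e2 * (kbb + t' * kcb + r' * kdb) = d"
      "e2 * (kbc + t' * kcc + r' * kdc) = d * t" "e2 * (kbd + t' * kcd + r' * kdd) = d * r"
    and "kaa + s' * kba + (r' + s' * t') * kca + c' * kda = 0"
      "kab + s' * kbb + (r' + s' * t') * kcb + c' * kdb = 0"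
      "kac + s' * kbc + (r' + s' * t') * kcc + c' * kdc = 0"
      "e1 * (kad + s' * kbd + (r' + s' * t') * kcd + c' * kdd) = - 1 / w ^ 4"
    and "kaa \<in> \<O>" "kab \<in> \<O>" "kac \<in> \<O>" "kad \<in> \<O>" "kba \<in> \<O>" "kbb \<in> \<O>" "kbc \<in> \<O>" "kbd \<in> \<O>"
      "kca \<in> \<O>" "kcb \<in> \<O>" "kcc \<in> \<O>" "kcd \<in> \<O>" "kda \<in> \<O>" "kdb \<in> \<O>" "kdc \<in> \<O>" "kdd \<in> \<O>"
  shows "Phi (t4M w ** iwa 1 d s r c t) = Phi (iwa e1 e2 s' r' c' t')"
proof -
  have row4: "1 / e1 * kda = w ^ 4" "1 / e1 * kdb = w ^ 4 * s" "1 / e1 * kdc = w ^ 4 * (r + s * t)"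
    "1 / e1 * kdd = w ^ 4 * c"
    using assms(4-7) by (simp_all only: times_divide_eq_left mult_1_left)
  have row3: "1 / e2 * x3 + - s' / e2 * x4 = (x3 - s' * x4) / e2" for x3 x4
    by (simp add: diff_divide_distrib)
  have row2: "e2 * x2 + e2 * t' * x3 + e2 * r' * x4 = e2 * (x2 + t' * x3 + r' * x4)" for x2 x3 x4
    by (simp add: distrib_left mult.assoc)
  have row1: "e1 * x1 + e1 * s' * x2 + e1 * (r' + s' * t') * x3 + e1 * c' * x4 =
      e1 * (x1 + s' * x2 + (r' + s' * t') * x3 + c' * x4)" for x1 x2 x3 x4
    by (simp add: distrib_left mult.assoc)
  have "t4M w ** iwa 1 d s r c t = M4 [[0, 0, 0, - 1 / w ^ 4], [0, d, d * t, d * r],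
      [0, 0, 1 / d, - s / d], [w ^ 4, w ^ 4 * s, w ^ 4 * (r + s * t), w ^ 4 * c]]"
    by (simp add: t4M_eq iwa_def M4_mult)
  also have "\<dots> = iwa e1 e2 s' r' c' t' **
    M4 [[kaa,kab,kac,kad],[kba,kbb,kbc,kbd],[kca,kcb,kcc,kcd],[kda,kdb,kdc,kdd]]"
    unfolding iwa_def M4_mult mult_zero_left add_0 row1 row2 row3
    using assms(1-3)
    by (intro M4_eqI; (simp only: assms(12-19) mult_zero_right; fail)?)
      (simp_all only: row4 assms(8-11), simp_all)
  finally have "t4M w ** iwa 1 d s r c t = iwa e1 e2 s' r' c' t' **
    M4 [[kaa,kab,kac,kad],[kba,kbb,kbc,kbd],[kca,kcb,kcc,kcd],[kda,kdb,kdc,kdd]]" .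
  then show ?thesis
  proof (rule Phi_right_invariant[rotated 2])
    show "M4 [[kaa,kab,kac,kad],[kba,kbb,kbc,kbd],[kca,kcb,kcc,kcd],[kda,kdb,kdc,kdd]] $ i $ j \<in> \<O>" for i j
      by (intro M4_nth_in assms)
  qed (use assms(1-3) in \<open>simp_all add: Sp4_mult Sp4_generators iwa_Sp4\<close>)
qed

end

lemmas field_rules = field_simps power2_eq_square power3_eq_cube power4_eq_xxxx

context unramified_vector
begin

text \<open>Up to sign, \<open>u\<close> is the minor of the last two rows of \<open>k\<close> in
  the last two columns; that it is a unit forces the diagonal \<open>1 / w ^ 2\<close>,
  \<open>w ^ 2\<close>.\<close>

lemma Phi_T14:
  assumes "z \<in> \<O>" "x \<in> \<O>" "b \<in> \<U>" "a \<in> \<U>"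
  shows "Phi (t4M w ** iwa 1 w (b / w) ((x * b + a * w) / w ^ 3) (z / w ^ 2) (- x / w ^ 2)) =
    Phi (iwa (1 / w ^ 2) (w ^ 2) 0 (a / (a * b + z * w) / w ^ 2) (- 1 / (a * b + z * w) / w) (- (x + a ^ 2 * w / (a * b + z * w)) / w ^ 4))"
proof -
  define u where "u = a * b + z * w"
  have "u \<in> \<U>"
    unfolding u_def using assms
    by (intro units_add_max_ideal units_mult max_ideal_mult_right max_ideal_w)
  note units = this assms(3,4)
  note nz = units[THEN units_nonzero]
  note int = units[THEN units_integers] assms(1,2)
  have z: "z = (u - a * b) / w" by (simp add: u_def)
  show ?thesis
    by (rule Phi_t4M_eqI[where kda = "w ^ 2" and kdb = "b * w" and kdc = "a" and kdd = "z"
        and kca = "0" and kcb = "0" and kcc = "w" and kcd = "- b"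
        and kba = "- a / u" and kbb = "z / u" and kbc = "0" and kbd = "0"
        and kaa = "w / u" and kab = "b / u" and kac = "0" and kad = "0"];
      ((intro integral_intros units_mult units_power | rule units int)+; fail)?;
      (use nz in \<open>simp add: u_def[symmetric] z field_rules; fail\<close>)?)
qed

text \<open>Compared with the case where \<open>z + a * b\<close> is a unit, the third row is
  divisible by one more \<open>w\<close>; its primitive entry becomes \<open>b ^ 2 / z\<close>, and
  the second diagonal entry is \<open>1\<close> instead of \<open>w\<close>.\<close>

lemma Phi_T4:
  assumes "z \<in> \<U>" "x \<in> \<O>" "b \<in> \<U>" "a \<in> \<U>" "z + a * b \<in> \<P>"
  shows "Phi (t4M w ** iwa 1 w (b / w) ((x * b + a * w) / w ^ 3) (z / w ^ 3) (- x / w ^ 2)) =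
    Phi (iwa (1 / w) 1 (b / z / w ^ 2) ((a * w + x * b) / z / w ^ 2) (- 1 / z / w ^ 3) 0)"
proof -
  define u where "u = (z + a * b) / w"
  note units = assms(1,3,4)
  note nz = units[THEN units_nonzero]
  have "u \<in> \<O>" unfolding u_def by (rule max_ideal_divide_w[OF assms(5)])
  note int = this units[THEN units_integers] assms(2)
  have a: "a = (u * w - z) / b" using nz by (simp add: u_def)
  show ?thesis
    by (rule Phi_t4M_eqI[where kda = "w ^ 3" and kdb = "b * w ^ 2" and kdc = "a * w" and kdd = "z"
        and kca = "b * w / z" and kcb = "b ^ 2 / z" and kcc = "u / z" and kcd = "0"
        and kba = "- (a * w + x * b) * w / z" and kbb = "w - (a * w + x * b) * b / z" and kbc = "- (a ^ 2) / z - x * u / z" and kbd = "0"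
        and kaa = "1 / z" and kab = "0" and kac = "0" and kad = "0"];
      ((intro integral_intros units_mult units_power | rule units int)+; fail)?;
      (use nz in \<open>simp add: a field_rules; fail\<close>)?)
qed

text \<open>The pivots are \<open>z\<close> in the last row and \<open>(z + a * b) / z\<close> in
  the third.\<close>

lemma Phi_T12:
  assumes "z \<in> \<U>" "x \<in> \<O>" "b \<in> \<U>" "a \<in> \<U>" "z + a * b \<in> \<U>"
  shows "Phi (t4M w ** iwa 1 w (b / w) ((x * b + a * w) / w ^ 3) (z / w ^ 3) (- x / w ^ 2)) =
    Phi (iwa (1 / w) w (b / z / w) ((a * w + x * b) / z / w ^ 3) (- 1 / z / w ^ 3) ((- x - a ^ 2 * w / (z + a * b)) / w ^ 2))"
proof -
  define u where "u = z + a * b"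
  note units = assms(1,3,4) assms(5)[folded u_def]
  note nz = units(1,2,4)[THEN units_nonzero]
  note int = units[THEN units_integers] assms(2)
  have a: "a = (u - z) / b" using nz by (simp add: u_def)
  show ?thesis
    by (rule Phi_t4M_eqI[where kda = "w ^ 3" and kdb = "b * w ^ 2" and kdc = "a * w" and kdd = "z"
        and kca = "b / z * w ^ 2" and kcb = "b ^ 2 / z * w" and kcc = "u / z" and kcd = "0"
        and kba = "- a / u * w" and kbb = "z / u" and kbc = "0" and kbd = "0"
        and kaa = "1 / z" and kab = "0" and kac = "0" and kad = "0"];
      ((intro integral_intros units_mult units_power | rule units int)+; fail)?;
      (use nz in \<open>simp add: a field_rules; fail\<close>)?)
qed

text \<open>The left side does not involve \<open>x\<close>: the corner entry may be changed by any
  integer through an integral right factor, and \<open>x / w\<close> is an integer. This freedom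
  later lets a dummy variable become a variable of T13.\<close>

lemma Phi_T13_max_ideal:
  assumes "z \<in> \<O>" "x \<in> \<P>" "b \<in> \<U>" "a \<in> \<U>"
  shows "Phi (t4M w ** iwa 1 (1 / w) (- a / w ^ 2) (b / w) (z / w ^ 2) 0) =
    Phi (iwa (1 / w ^ 2) w 0 (- 1 / a / w ^ 2) (- x / (a * b + z * w) / w) ((a * b + z * w) / a ^ 2 / w ^ 3))"
proof -
  define u where "u = a * b + z * w"
  define y where "y = x / w"
  have "u \<in> \<U>"
    unfolding u_def using assms
    by (intro units_add_max_ideal units_mult max_ideal_mult_right max_ideal_w)
  note units = this assms(3,4)
  note nz = units[THEN units_nonzero]
  have "y \<in> \<O>" unfolding y_def by (rule max_ideal_divide_w[OF assms(2)])
  note int = this units[THEN units_integers] assms(1)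
  have z: "z = (u - a * b) / w" and x: "x = y * w" by (simp_all add: u_def y_def)
  show ?thesis
    by (rule Phi_t4M_eqI[where kda = "w ^ 2" and kdb = "- a" and kdc = "b * w" and kdd = "z"
        and kca = "0" and kcb = "0" and kcc = "w ^ 2" and kcd = "a"
        and kba = "1 / a" and kbb = "0" and kbc = "- z / a ^ 2" and kbd = "0"
        and kaa = "y * w ^ 2 / u" and kab = "- a * y / u" and kac = "1 / a + y * w * b / u" and kad = "y * z / u"];
      ((intro integral_intros units_mult units_power | rule units int)+; fail)?;
      (use nz in \<open>simp add: u_def[symmetric] z x field_rules; fail\<close>)?)
qed

text \<open>The entry \<open>t = T / w\<close> matters only modulo \<open>\<O>\<close>, so
  \<open>T\<close> is a free lift of the residue of \<open>(z + a * b) / a ^ 2\<close>. One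
  decomposition thus serves several targets, each with its own lift.\<close>

lemma Phi_C7_units:
  assumes "z \<in> \<U>" "b \<in> \<U>" "a \<in> \<U>" "T \<in> \<O>" "z + a * b - T * a ^ 2 \<in> \<P>"
  shows "Phi (t4M w ** iwa 1 (1 / w) (- a / w ^ 2) (b / w) (z / w ^ 3) 0) =
    Phi (iwa (1 / w) 1 (- a / z / w) (b / z / w ^ 2) (- 1 / z / w ^ 3) (T / w))"
proof -
  define e where "e = (z + a * b - T * a ^ 2) / w"
  note units = assms(1-3)
  note nz = units[THEN units_nonzero]
  have "e \<in> \<O>" unfolding e_def by (rule max_ideal_divide_w[OF assms(5)])
  note int = this units[THEN units_integers] assms(4)
  show ?thesis
    by (rule Phi_t4M_eqI[where kda = "w ^ 3" and kdb = "- a * w" and kdc = "b * w ^ 2" and kdd = "z"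
        and kca = "- a * w ^ 2 / z" and kcb = "a ^ 2 / z" and kcc = "w - a * b / z * w" and kcd = "0"
        and kba = "- b * w / z + T * a * w / z" and kbb = "e / z" and kbc = "- (b ^ 2) / z - T * (1 - a * b / z)" and kbd = "0"
        and kaa = "1 / z" and kab = "0" and kac = "0" and kad = "0"];
      ((intro integral_intros units_mult units_power | rule units int)+; fail)?;
      (use nz in \<open>simp add: e_def field_rules; fail\<close>)?)
qed

text \<open>Again \<open>T\<close> is a lift modulo \<open>\<P>\<close>, now of a solution of
  \<open>T (z x - A a) = z + a b\<close>. It is \<open>0\<close> when the right side lies in
  \<open>\<P>\<close> and the quotient when \<open>z x - A a\<close> is a unit; the remaining case
  has another diagonal.\<close>

lemma Phi_C1_units:
  assumes "z \<in> \<U>" "x \<in> \<U>" "b \<in> \<U>" "a \<in> \<U>" "A = - (a + x * b)" "T \<in> \<O>" "z + a * b - T * (z * x - A * a) \<in> \<P>"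
  shows "Phi (t4M w ** iwa 1 1 (A / w) (b / w ^ 2) (z / w ^ 3) (1 / x / w)) =
    Phi (iwa (1 / w) 1 (A / z / w) (b / z / w ^ 2) (- 1 / z / w ^ 3) (T / w))"
proof -
  define e where "e = (z + a * b - T * (z * x - A * a)) / w"
  note units = assms(1-4)
  note nz = units[THEN units_nonzero]
  have e: "e \<in> \<O>" unfolding e_def by (rule max_ideal_divide_w[OF assms(7)])
  have A: "A \<in> \<O>"
    unfolding assms(5) using units units_integers by (intro integral_intros) auto
  note int = e A units[THEN units_integers] assms(6)
  have b: "b = - (A + a) / x" using nz by (simp add: assms(5))
  show ?thesis
    by (rule Phi_t4M_eqI[where kda = "w ^ 3" and kdb = "A * w ^ 2" and kdc = "- a * w / x" and kdd = "z"
        and kca = "A * w ^ 2 / z" and kcb = "A ^ 2 * w / z" and kcc = "1 - A * a / (z * x)" and kcd = "0"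
        and kba = "- b * w / z - T * A * w / z" and kbb = "1 - b * A / z - T * A ^ 2 / z" and kbc = "e / (z * x)" and kbd = "0"
        and kaa = "1 / z" and kab = "0" and kac = "0" and kad = "0"];
      ((intro integral_intros units_mult units_power | rule units int)+; fail)?;
      (use nz in \<open>simp add: e_def b field_rules; fail\<close>)?)
qed

text \<open>Here \<open>z * x - A * a\<close> stops being a unit, so the third row of
  \<open>k\<close> from the unit case is divisible by \<open>w\<close> and the second diagonal entry
  drops from \<open>1\<close> to \<open>1 / w\<close>.\<close>

lemma Phi_T8:
  assumes "z \<in> \<U>" "x \<in> \<U>" "b \<in> \<U>" "a \<in> \<U>" "A = - (a + x * b)" "z * x - A * a \<in> \<P>"
  shows "Phi (t4M w ** iwa 1 1 (A / w) (b / w ^ 2) (z / w ^ 3) (1 / x / w)) =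
    Phi (iwa (1 / w) (1 / w) (A / z / w ^ 2) (b / z / w) (- 1 / z / w ^ 3) 0)"
proof -
  define e where "e = (z * x - A * a) / w"
  note units = assms(1-4)
  note nz = units[THEN units_nonzero]
  have e: "e \<in> \<O>" unfolding e_def by (rule max_ideal_divide_w[OF assms(6)])
  have A: "A \<in> \<O>"
    unfolding assms(5) using units units_integers by (intro integral_intros) auto
  note int = e A units[THEN units_integers]
  have b: "b = - (A + a) / x" using nz by (simp add: assms(5))
  show ?thesis
    by (rule Phi_t4M_eqI[where kda = "w ^ 3" and kdb = "A * w ^ 2" and kdc = "- a * w / x" and kdd = "z"
        and kca = "A * w / z" and kcb = "A ^ 2 / z" and kcc = "e / (z * x)" and kcd = "0"
        and kba = "- b * w ^ 2 / z" and kbb = "w - b * A * w / z" and kbc = "1 / x + a * b / (z * x)" and kbd = "0"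
        and kaa = "1 / z" and kab = "0" and kac = "0" and kad = "0"];
      ((intro integral_intros units_mult units_power | rule units int)+; fail)?;
      (use nz in \<open>simp add: e_def b field_rules; fail\<close>)?)
qed

text \<open>Divided by \<open>x\<close>, the unit \<open>Q\<close> is up to sign the minor of the
  last two rows in the last two columns; it reduces to \<open>a * A\<close> modulo
  \<open>\<P>\<close>.\<close>

lemma Phi_T13_units:
  assumes "z \<in> \<O>" "x \<in> \<U>" "b \<in> \<U>" "a \<in> \<U>" "A = - (a + x * b)" "A \<in> \<U>" "Q = a * A - x * z * w"
  shows "Phi (t4M w ** iwa 1 1 (A / w) (b / w ^ 2) (z / w ^ 2) (1 / x / w)) =
    Phi (iwa (1 / w ^ 2) w 0 (a / Q / w ^ 2) (x / Q / w) (- (a * b + z * w) / Q / w ^ 3))"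
proof -
  have "Q \<in> \<U>"
    unfolding assms(7) using assms units_integers
    by (intro units_diff_max_ideal units_mult max_ideal_mult_right max_ideal_w integers_mult) auto
  note units = this assms(2-4,6)
  note nz = units[THEN units_nonzero]
  note int = units[THEN units_integers] assms(1)
  have b: "b = - (A + a) / x" using nz by (simp add: assms(5))
  have z: "z = (a * A - Q) / (x * w)" using nz by (simp add: assms(7))
  show ?thesis
    by (rule Phi_t4M_eqI[where kda = "w ^ 2" and kdb = "A * w" and kdc = "- a / x" and kdd = "z"
        and kca = "0" and kcb = "0" and kcc = "w" and kcd = "- A"
        and kba = "- a / Q" and kbb = "- x * z / Q" and kbc = "0" and kbd = "0"
        and kaa = "- x * w / Q" and kab = "- x * A / Q" and kac = "0" and kad = "0"];
      ((intro integral_intros units_mult units_power | rule units int)+; fail)?;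
      (use nz in \<open>simp add: b z field_rules; fail\<close>)?)
qed

lemma Phi_T3:
  assumes "z \<in> \<U>" "x \<in> \<O>" "a \<in> \<U>"
  shows "Phi (t4M w ** iwa 1 1 0 (a / w ^ 2) (z / w ^ 3) (x / w)) =
    Phi (iwa (1 / w) 1 0 (a / z / w ^ 2) (- 1 / z / w ^ 3) ((x - a ^ 2 / z) / w))"
proof -
  note units = assms(1,3)
  note nz = units[THEN units_nonzero]
  note int = units[THEN units_integers] assms(2)
  show ?thesis
    by (rule Phi_t4M_eqI[where kda = "w ^ 3" and kdb = "0" and kdc = "a * w" and kdd = "z"
        and kca = "0" and kcb = "0" and kcc = "1" and kcd = "0"
        and kba = "- a * w / z" and kbb = "1" and kbc = "0" and kbd = "0"
        and kaa = "1 / z" and kab = "0" and kac = "0" and kad = "0"];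
      ((intro integral_intros units_mult units_power | rule units int)+; fail)?;
      (use nz in \<open>simp add: field_rules; fail\<close>)?)
qed

lemma Phi_T6:
  assumes "z \<in> \<U>" "x \<in> \<O>" "a \<in> \<U>"
  shows "Phi (t4M w ** iwa 1 1 0 (a / w ^ 2) (z / w ^ 2) (x / w)) =
    Phi (iwa (1 / w ^ 2) 1 0 (a / z / w ^ 2) (- 1 / z / w ^ 2) (x / w - a ^ 2 / z / w ^ 2))"
proof -
  note units = assms(1,3)
  note nz = units[THEN units_nonzero]
  note int = units[THEN units_integers] assms(2)
  show ?thesis
    by (rule Phi_t4M_eqI[where kda = "w ^ 2" and kdb = "0" and kdc = "a" and kdd = "z"
        and kca = "0" and kcb = "0" and kcc = "1" and kcd = "0"
        and kba = "- a / z" and kbb = "1" and kbc = "0" and kbd = "0"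
        and kaa = "1 / z" and kab = "0" and kac = "0" and kad = "0"];
      ((intro integral_intros units_mult units_power | rule units int)+; fail)?;
      (use nz in \<open>simp add: field_rules; fail\<close>)?)
qed

text \<open>The last entry of the last row is now divisible by \<open>w\<close>, so the pivot moves
  from \<open>z\<close> to \<open>a\<close>. This is why \<open>r\<close> vanishes and
  \<open>s\<close> appears.\<close>

lemma Phi_T9:
  assumes "z \<in> \<U>" "x \<in> \<O>" "a \<in> \<U>"
  shows "Phi (t4M w ** iwa 1 1 0 (a / w ^ 2) (z / w) (x / w)) =
    Phi (iwa (1 / w ^ 2) (1 / w) (- 1 / a / w) 0 (x / a ^ 2 / w) (- (a ^ 2) / z / w))"
proof -
  note units = assms(1,3)
  note nz = units[THEN units_nonzero]
  note int = units[THEN units_integers] assms(2)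
  show ?thesis
    by (rule Phi_t4M_eqI[where kda = "w ^ 2" and kdb = "0" and kdc = "a" and kdd = "w * z"
        and kca = "- w / a" and kcb = "0" and kcc = "0" and kcd = "- z / a"
        and kba = "- a / z" and kbb = "w" and kbc = "x" and kbd = "0"
        and kaa = "- x * w / a ^ 2" and kab = "1 / a" and kac = "0" and kad = "- x * z / a ^ 2"];
      ((intro integral_intros units_mult units_power | rule units int)+; fail)?;
      (use nz in \<open>simp add: field_rules; fail\<close>)?)
qed

lemma Phi_T10:
  assumes "z \<in> \<O>" "x \<in> \<O>" "a \<in> \<U>"
  shows "Phi (t4M w ** iwa 1 1 0 (a / w ^ 2) (z / 1) (x / w)) =
    Phi (iwa (1 / w ^ 2) (1 / w ^ 2) (- 1 / a / w ^ 2) 0 (x / a ^ 2 / w) 0)"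
proof -
  note units = assms(3)
  note nz = units[THEN units_nonzero]
  note int = units[THEN units_integers] assms(1,2)
  show ?thesis
    by (rule Phi_t4M_eqI[where kda = "w ^ 2" and kdb = "0" and kdc = "a" and kdd = "w ^ 2 * z"
        and kca = "- 1 / a" and kcb = "0" and kcc = "0" and kcd = "- z / a"
        and kba = "0" and kbb = "w ^ 2" and kbc = "x * w" and kbd = "a"
        and kaa = "- x * w / a ^ 2" and kab = "1 / a" and kac = "0" and kad = "- x * w * z / a ^ 2"];
      ((intro integral_intros units_mult units_power | rule units int)+; fail)?;
      (use nz in \<open>simp add: field_rules; fail\<close>)?)
qed

text \<open>Moving \<open>tau\<close> to the left replaces \<open>LM x\<close> by
  \<open>LM (x / w ^ 2)\<close>, so only the valuation of \<open>x\<close>, capped at 2, matters.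
  Valuations 0, 1 and at least 2 give the second diagonal entries \<open>w\<close>, \<open>1\<close>
  and \<open>1 / w\<close>; the right factor is the integral part of the corresponding decomposition
  in SL(2).\<close>

lemma Phi_cell_units:
  assumes "h \<in> Sp4" "x \<in> \<U>" "b \<in> \<U>" "a \<in> \<U>"
  shows "Phi (h ** (LM x ** nM w a b c ** tauM w)) = Phi (h ** iwa 1 w (- (a * w + x * b) / w) (b / w ^ 3) c (1 / (x * w ^ 2)))"
proof -
  have "LM x ** nM w a b c ** tauM w = iwa 1 w (- (a * w + x * b) / w) (b / w ^ 3) c (1 / (x * w ^ 2)) **
      M4 [[1,0,0,0],[0,0,- 1 / x,0],[0,x,w ^ 2,0],[0,0,0,1]]"
    unfolding LM_def nM_eq tauM_def s1M_def iwa_def M4_mult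
    by (rule M4_eqI) (use assms(2-4)[THEN units_nonzero] in \<open>simp_all add: field_rules\<close>)
  then show ?thesis
    by (rule Phi_eqI)
      (((rule integers_minus)?, rule max_ideal_divide_w, rule assms) |
       intro Sp4_mult Sp4_generators[OF w_nonzero] iwa_Sp4 integral_intros | rule assms units_integers | simp)+
qed

text \<open>Conjugation by \<open>s1\<close> makes \<open>LM x\<close> upper triangular, and
  \<open>s1\<close> itself ends up as the integral right factor; no condition on \<open>x\<close>
  arises.\<close>

lemma Phi_cell_s1:
  assumes "h \<in> Sp4"
  shows "Phi (h ** (s1M ** LM x ** nM w a b c ** tauM w)) = Phi (h ** iwa 1 w (b / w) ((x * b + a * w) / w ^ 3) c (- x / w ^ 2))"
proof -
  have "s1M ** LM x ** nM w a b c ** tauM w = iwa 1 w (b / w) ((x * b + a * w) / w ^ 3) c (- x / w ^ 2) **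
      M4 [[1,0,0,0],[0,0,1,0],[0,-1,0,0],[0,0,0,1]]"
    unfolding LM_def nM_eq tauM_def s1M_def iwa_def M4_mult
    by (rule M4_eqI) (simp_all add: field_rules)
  then show ?thesis
    by (rule Phi_eqI)
      (((rule integers_minus)?, rule max_ideal_divide_w, rule assms) |
       intro Sp4_mult Sp4_generators[OF w_nonzero] iwa_Sp4 integral_intros | rule assms units_integers | simp)+
qed

lemma Phi_cell_w:
  assumes "h \<in> Sp4" "x \<in> \<U>"
  shows "Phi (h ** (LM (w * x) ** nM w a b c ** tauM w)) = Phi (h ** iwa 1 1 (- (a + x * b) / w) (b / w ^ 2) c (1 / x / w))"
proof -
  have "LM (w * x) ** nM w a b c ** tauM w = iwa 1 1 (- (a + x * b) / w) (b / w ^ 2) c (1 / x / w) **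
      M4 [[1,0,0,0],[0,0,- 1 / x,0],[0,x,w,0],[0,0,0,1]]"
    unfolding LM_def nM_eq tauM_def s1M_def iwa_def M4_mult
    by (rule M4_eqI) (use assms(2)[THEN units_nonzero] in \<open>simp_all add: field_rules\<close>)
  then show ?thesis
    by (rule Phi_eqI)
      (((rule integers_minus)?, rule max_ideal_divide_w, rule assms) |
       intro Sp4_mult Sp4_generators[OF w_nonzero] iwa_Sp4 integral_intros | rule assms units_integers | simp)+
qed

lemma Phi_cell_w2:
  assumes "h \<in> Sp4" "x \<in> \<O>"
  shows "Phi (h ** (LM (w ^ 2 * x) ** nM w a b c ** tauM w)) = Phi (h ** iwa 1 (1 / w) (- (a + x * b * w) / w ^ 2) (b / w) c 0)"
proof -
  have "LM (w ^ 2 * x) ** nM w a b c ** tauM w = iwa 1 (1 / w) (- (a + x * b * w) / w ^ 2) (b / w) c 0 **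
      M4 [[1,0,0,0],[0,1,0,0],[0,x,1,0],[0,0,0,1]]"
    unfolding LM_def nM_eq tauM_def s1M_def iwa_def M4_mult
    by (rule M4_eqI) (simp_all add: field_rules)
  then show ?thesis
    by (rule Phi_eqI)
      (((rule integers_minus)?, rule max_ideal_divide_w, rule assms) |
       intro Sp4_mult Sp4_generators[OF w_nonzero] iwa_Sp4 integral_intros | rule assms units_integers | simp)+
qed

text \<open>For \<open>A\<close> in \<open>\<P>\<close> the factor \<open>X(A / w)\<close> is
  integral; moving it to the right past the \<open>Y\<close> part removes \<open>s\<close> and
  shifts \<open>r\<close> and the corner.\<close>

lemma Phi_C1_max_ideal:
  assumes "h \<in> Sp4" "x \<in> \<U>" "A \<in> \<P>"
  shows "Phi (h ** (iwa 1 1 (A / w) (b / w ^ 2) (z / w ^ 3) (1 / x / w))) = Phi (h ** iwa 1 1 0 ((b + A / x) / w ^ 2) ((z + (b + A / x) * A) / w ^ 3) (1 / x / w))"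
proof -
  have "iwa 1 1 (A / w) (b / w ^ 2) (z / w ^ 3) (1 / x / w) = iwa 1 1 0 ((b + A / x) / w ^ 2) ((z + (b + A / x) * A) / w ^ 3) (1 / x / w) **
      M4 [[1,A / w,0,0],[0,1,0,0],[0,0,1,- (A / w)],[0,0,0,1]]"
    unfolding LM_def nM_eq tauM_def s1M_def iwa_def M4_mult
    by (rule M4_eqI) (use assms(2)[THEN units_nonzero] in \<open>simp_all add: field_rules\<close>)
  then show ?thesis
    by (rule Phi_eqI)
      (((rule integers_minus)?, rule max_ideal_divide_w, rule assms) |
       intro Sp4_mult Sp4_generators[OF w_nonzero] iwa_Sp4 integral_intros | rule assms units_integers | simp)+
qed

subsection \<open>The integrands\<close>

text \<open>\<open>F1\<close> to \<open>F14\<close> are the integrands of the fourteen terms with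
  the outer power of \<open>eta\<close> and \<open>tau\<close> pulled inside and merged into the
  diagonal. The corner is stored as \<open>c = u + s r\<close>, which makes several of them simpler;
  \<open>d\<close>, \<open>d'\<close> are dummies.\<close>

definition F1 :: "'f \<Rightarrow> 'f \<Rightarrow> 'f \<Rightarrow> 'f \<Rightarrow> 'v" where
  "F1 z x b a = chi (a * b) *\<^sub>R Phi (iwa 1 1 (- (a + x * b) / w) (b / w ^ 2) (z / w ^ 4 - (a + x * b) * b / w ^ 3) (1 / x / w))"

definition F2 :: "'f \<Rightarrow> 'f \<Rightarrow> 'f \<Rightarrow> 'f \<Rightarrow> 'v" where
  "F2 y b a x = chi (a * b * x * y) *\<^sub>R Phi (iwa (1 / w) 1 (b / w) (- a / w ^ 2) (- (a * b * x / (1 - y)) / w ^ 3) (a / (b * (1 - x)) / w))"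

definition F3 :: "'f \<Rightarrow> 'f \<Rightarrow> 'f \<Rightarrow> 'f \<Rightarrow> 'v" where
  "F3 z b a d = chi (b * (1 - z)) *\<^sub>R Phi (iwa (1 / w) 1 0 (a / w ^ 2) (b / w ^ 3) (a ^ 2 * z / b / w))"

definition F4 :: "'f \<Rightarrow> 'f \<Rightarrow> 'f \<Rightarrow> 'f \<Rightarrow> 'v" where
  "F4 x b a d = chi b *\<^sub>R Phi (iwa (1 / w) 1 (x / w ^ 2) (a / w ^ 2) (b / w ^ 3) 0)"

definition F5 :: "'f \<Rightarrow> 'f \<Rightarrow> 'f \<Rightarrow> 'f \<Rightarrow> 'v" where
  "F5 x b a d = chi b *\<^sub>R Phi (iwa (1 / w) 1 (x / w) (a / w ^ 2) (b / w ^ 3) 0)"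

definition F6 :: "'f \<Rightarrow> 'f \<Rightarrow> 'f \<Rightarrow> 'f \<Rightarrow> 'v" where
  "F6 x b a d = chi (b * x) *\<^sub>R Phi (iwa (1 / w ^ 2) 1 0 (a / w ^ 2) (b * (1 - x * w) / w ^ 2) (a ^ 2 / b / w ^ 2))"

definition F7 :: "'f \<Rightarrow> 'f \<Rightarrow> 'f \<Rightarrow> 'f \<Rightarrow> 'v" where
  "F7 z b a d = chi (a * b) *\<^sub>R Phi (iwa 1 (1 / w) (- a / w ^ 2) (b / w) (z / w ^ 4 - a * b / w ^ 3) 0)"

definition F8 :: "'f \<Rightarrow> 'f \<Rightarrow> 'f \<Rightarrow> 'f \<Rightarrow> 'v" where
  "F8 z b a d = chi (a * b * z * (1 - z)) *\<^sub>R Phi (iwa (1 / w) (1 / w) (b / w ^ 2) (a / w) (a * b * z / w ^ 3) 0)"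

definition F9 :: "'f \<Rightarrow> 'f \<Rightarrow> 'f \<Rightarrow> 'f \<Rightarrow> 'v" where
  "F9 x b a d = chi b *\<^sub>R Phi (iwa (1 / w ^ 2) (1 / w) (a / w) 0 (- b / w) (x / w))"

definition F10 :: "'f \<Rightarrow> 'f \<Rightarrow> 'f \<Rightarrow> 'f \<Rightarrow> 'v" where
  "F10 b a d d' = chi b *\<^sub>R Phi (iwa (1 / w ^ 2) (1 / w ^ 2) (a / w ^ 2) 0 (- b / w) 0)"

definition F11 :: "'f \<Rightarrow> 'f \<Rightarrow> 'f \<Rightarrow> 'f \<Rightarrow> 'v" where
  "F11 z x b a = chi (a * b) *\<^sub>R Phi (iwa 1 w (b / w) ((x * b + a * w) / w ^ 3) (z / w ^ 4 + b * (x * b + a * w) / w ^ 4) (- x / w ^ 2))"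

definition F12 :: "'f \<Rightarrow> 'f \<Rightarrow> 'f \<Rightarrow> 'f \<Rightarrow> 'v" where
  "F12 z y b a = chi (a * b * z * (1 - z)) *\<^sub>R Phi (iwa (1 / w) w (a / w) (y / w ^ 3) (a * b * (1 - z) / w ^ 3) (- (y + b * w) / a / w ^ 2))"

definition F13 :: "'f \<Rightarrow> 'f \<Rightarrow> 'f \<Rightarrow> 'f \<Rightarrow> 'v" where
  "F13 x b a d = chi (b * x) *\<^sub>R Phi (iwa (1 / w ^ 2) w 0 (a / w ^ 2) (b * (1 - x) / w) (a ^ 2 / b / w ^ 3))"

definition F14 :: "'f \<Rightarrow> 'f \<Rightarrow> 'f \<Rightarrow> 'f \<Rightarrow> 'v" where
  "F14 x b a d = chi b *\<^sub>R Phi (iwa (1 / w ^ 2) (w ^ 2) 0 (a / w ^ 2) (- b / w) (x / w ^ 4))"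

text \<open>The pair \<open>h\<close>, \<open>c\<close> is \<open>mat 1\<close>,
  \<open>w ^ 4\<close> or \<open>t4M w\<close>, \<open>w ^ 3\<close>, so the two halves of the
  operator are treated alike.\<close>

definition cell_A :: "'f^4^4 \<Rightarrow> 'f \<Rightarrow> 'f \<Rightarrow> 'f \<Rightarrow> 'f \<Rightarrow> 'f \<Rightarrow> 'v" where
  "cell_A h c z x b a = chi (a * b) *\<^sub>R Phi (h ** (LM x ** nM w a b (z / c) ** tauM w))"

definition cell_B :: "'f^4^4 \<Rightarrow> 'f \<Rightarrow> 'f \<Rightarrow> 'f \<Rightarrow> 'f \<Rightarrow> 'f \<Rightarrow> 'v" where
  "cell_B h c z x b a = chi (a * b) *\<^sub>R Phi (h ** (s1M ** LM x ** nM w a b (z / c) ** tauM w))"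

text \<open>\<open>S1\<close>, \<open>S7\<close> and \<open>S11\<close> are named after the terms to
  which they lead for \<open>h = mat 1\<close>.\<close>

definition S1 :: "'f^4^4 \<Rightarrow> 'f \<Rightarrow> 'f \<Rightarrow> 'f \<Rightarrow> 'f \<Rightarrow> 'f \<Rightarrow> 'v" where
  "S1 h c z x b a = chi (a * b) *\<^sub>R Phi (h ** iwa 1 1 (- (a + x * b) / w) (b / w ^ 2) (z / c) (1 / x / w))"

definition S7 :: "'f^4^4 \<Rightarrow> 'f \<Rightarrow> 'f \<Rightarrow> 'f \<Rightarrow> 'f \<Rightarrow> 'f \<Rightarrow> 'v" where
  "S7 h c z x b a = chi (a * b) *\<^sub>R Phi (h ** iwa 1 (1 / w) (- a / w ^ 2) (b / w) (z / c) 0)"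

definition S11 :: "'f^4^4 \<Rightarrow> 'f \<Rightarrow> 'f \<Rightarrow> 'f \<Rightarrow> 'f \<Rightarrow> 'f \<Rightarrow> 'v" where
  "S11 h c z x b a = chi (a * b) *\<^sub>R Phi (h ** iwa 1 w (b / w) ((x * b + a * w) / w ^ 3) (z / c) (- x / w ^ 2))"

text \<open>What is left of \<open>S1\<close> once \<open>a + x * b\<close> lies in
  \<open>\<P>\<close> and \<open>X\<close> has been absorbed. The character then depends on one
  variable, because \<open>a * b\<close> is \<open>- x * b ^ 2\<close> modulo
  \<open>\<P>\<close>.\<close>

definition S1' :: "'f \<Rightarrow> 'f \<Rightarrow> 'f \<Rightarrow> 'f \<Rightarrow> 'f \<Rightarrow> 'v" where
  "S1' c z x b a = chi (- x) *\<^sub>R Phi (t4M w ** iwa 1 1 0 (b / w ^ 2) (z / c) (x / w))"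

lemma loc_F1: "loc (box \<O> \<U> \<U> \<U>) F1"
  and loc_F2: "loc (box (Ounits1 ord) \<U> \<U> (Ounits1 ord)) F2"
  and loc_F3: "loc (box (Ounits1 ord) \<U> \<U> \<O>) F3"
  and loc_F4: "loc (box \<U> \<U> \<O> \<O>) F4"
  and loc_F5: "loc (box \<O> \<U> \<U> \<O>) F5"
  and loc_F6: "loc (box \<U> \<U> \<U> \<O>) F6"
  and loc_F7: "loc (box \<O> \<U> \<U> \<O>) F7"
  and loc_F8: "loc (box (Ounits1 ord) \<U> \<U> \<O>) F8"
  and loc_F9: "loc (box \<U> \<U> \<U> \<O>) F9"
  and loc_F10: "loc (box \<U> \<U> \<O> \<O>) F10"
  and loc_F11: "loc (box \<O> \<O> \<U> \<U>) F11"
  and loc_F12: "loc (box (Ounits1 ord) \<O> \<U> \<U>) F12"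
  and loc_F13: "loc (box \<U> \<U> \<U> \<O>) F13"
  and loc_F14: "loc (box \<O> \<U> \<U> \<O>) F14"
  and loc_S1': "loc (box \<O> \<U> \<U> \<O>) (S1' c)"
  unfolding F1_def F2_def F3_def F4_def F5_def F6_def F7_def F8_def F9_def
    F10_def F11_def F12_def F13_def F14_def S1'_def
  by (rule loc_integrand; (intro region_box cg_set_intros; fail)?;
      (intro mbl_intros bl_intros bl_divide)?;
      (auto simp: Ounits1_iff intro!: units_intros Sp4_mult Sp4_generators iwa_Sp4)?)+

lemma loc_S1: "h \<in> Sp4 \<Longrightarrow> loc (box \<O> \<U> \<U> \<U>) (S1 h c)"
  and loc_S7: "h \<in> Sp4 \<Longrightarrow> loc (box \<O> \<O> \<U> \<U>) (S7 h c)"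
  and loc_S11: "h \<in> Sp4 \<Longrightarrow> loc (box \<O> \<O> \<U> \<U>) (S11 h c)"
  unfolding S1_def S7_def S11_def
  by (rule loc_integrand; (intro region_box cg_set_intros; fail)?;
      (intro mbl_intros bl_intros bl_divide)?;
      (auto simp: Ounits1_iff intro!: units_intros Sp4_mult Sp4_generators iwa_Sp4)?)+

lemma loc_cell_A: "h \<in> Sp4 \<Longrightarrow> loc (box \<O> \<O> \<U> \<U>) (cell_A h c)"
  and loc_cell_B: "h \<in> Sp4 \<Longrightarrow> loc (box \<O> \<P> \<U> \<U>) (cell_B h c)"
  and loc_cell_A_scaled: "h \<in> Sp4 \<Longrightarrow> loc (box \<O> \<O> \<U> \<U>) (\<lambda>z x b a. cell_A h c z (u * x) b a)"
  unfolding cell_A_def cell_B_def nM_eq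
  by (rule loc_integrand; (intro region_box cg_set_intros; fail)?;
      (intro mbl_intros bl_intros bl_divide)?;
      (auto simp: Ounits1_iff intro!: units_intros Sp4_mult Sp4_generators[unfolded nM_eq] iwa_Sp4)?)+

subsection \<open>Changes of variables\<close>

lemma integrand_eqI:
  "chi c = chi c' \<Longrightarrow> Phi g = Phi (iwa d e s r u t) \<Longrightarrow> s = s' \<Longrightarrow> r = r' \<Longrightarrow> u = u' \<Longrightarrow> t = t' \<Longrightarrow>
    chi c *\<^sub>R Phi g = chi c' *\<^sub>R Phi (iwa d e s' r' u' t')"
  "chi c = chi c' \<Longrightarrow> Phi g = Phi (h ** iwa d e s r u t) \<Longrightarrow> s = s' \<Longrightarrow> r = r' \<Longrightarrow> u = u' \<Longrightarrow> t = t' \<Longrightarrow>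
    chi c *\<^sub>R Phi g = chi c' *\<^sub>R Phi (h ** iwa d e s' r' u' t')"
  by simp_all

lemma Phi_mat_1: "Phi (mat 1 ** g) = Phi g"
  by simp

lemma units_den: "x \<in> \<U> \<Longrightarrow> y \<in> \<U> \<Longrightarrow> z \<in> \<O> \<Longrightarrow> x * y + z * w \<in> \<U>"
  "x \<in> \<U> \<Longrightarrow> z \<in> \<O> \<Longrightarrow> x - z * w \<in> \<U>"
  by (intro units_add_max_ideal units_diff_max_ideal units_mult max_ideal_mult_right max_ideal_w; assumption)+

lemma units_1_diff_add: "z - a \<in> \<P> \<Longrightarrow> 1 - z + a \<in> \<U>"
  using units_diff_max_ideal[OF units_1, of "z - a"] by (simp add: algebra_simps)

lemmas closure_rules = units_intros units_add_max_ideal units_diff_max_ideal max_ideal_intros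
  max_ideal_mult_right max_ideal_divide integral_intros max_ideal_integers

lemmas region_rules = region_conj region_box cg_set_intros lip_intros lip_const integers_1 integers_w

text \<open>Forward maps are read off by comparing source and target Iwasawa forms entry by entry; a
  variable that the target does not see goes into a dummy slot, and the backward maps solve these
  equations. Here \<open>t\<close> forces the inversion \<open>- 1 / x\<close>, then
  \<open>s\<close> gives the new \<open>b\<close> and \<open>r\<close> the new
  \<open>a\<close>.\<close>

lemma J_cell_units:
  assumes h: "h \<in> Sp4"
  shows "\<forall>\<^sub>F n in sequentially. J n (box \<O> \<U> \<U> \<U>) (cell_A h c) =
    J n (box \<O> \<U> \<U> \<U>) (S11 h c)"
proof (rule J_subst_eventually[where
      kz = "\<lambda>z x b a. z" and kx = "\<lambda>z x b a. - 1 / x" and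
      kb = "\<lambda>z x b a. - (x * b + a * w)" and ka = "\<lambda>z x b a. - a / x" and
      lz = "\<lambda>z x b a. z" and lx = "\<lambda>z x b a. - 1 / x" and
      lb = "\<lambda>z x b a. b * x + a * w" and la = "\<lambda>z x b a. a / x"],
    goal_cases)
  case (1 z x b a)
  then have m: "z \<in> \<O>" "x \<in> \<U>" "b \<in> \<U>" "a \<in> \<U>"
    by auto
  note m' = m m(2,3,4)[THEN units_integers] and [simp] = m(2,3,4)[THEN units_nonzero]
  show ?case
    unfolding cell_A_def S11_def
    by (intro conjI; (rule integrand_eqI(2)[OF chi_eqI[of _ _ "a * b" "a * w / (x * b)"]
        Phi_cell_units[OF h m(2,3,4)]])?;
      (((rule m' closure_rules)+; fail) |
      (rule units_nonzero, (rule m' closure_rules)+; fail) |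
      (simp add: field_rules; fail)))
next
  case (2 z x b a)
  then have m: "z \<in> \<O>" "x \<in> \<U>" "b \<in> \<U>" "a \<in> \<U>"
    by auto
  note m' = m m(2,3,4)[THEN units_integers] and [simp] = m(2,3,4)[THEN units_nonzero]
  show ?case
    by (intro conjI;
      (((rule m' closure_rules)+; fail) |
      (simp add: field_rules; fail)))
qed ((intro region_rules)?;
    (rule loc_subset[OF loc_S11[OF h]])?; auto intro!: units_intros intro: O_rules)+

text \<open>The shift of \<open>a\<close> by a multiple of \<open>w\<close> removes \<open>x\<close>
  from the matrix and is invisible to the character, so \<open>x\<close> becomes a dummy.\<close>

lemma J_cell_w2:
  assumes h: "h \<in> Sp4"
  shows "\<forall>\<^sub>F n in sequentially. J n (box \<O> \<O> \<U> \<U>) (\<lambda>z x b a. cell_A h c z (w ^ 2 * x) b a) =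
    J n (box \<O> \<O> \<U> \<U>) (S7 h c)"
proof (rule J_subst_eventually[where
      kz = "\<lambda>z x b a. z" and kx = "\<lambda>z x b a. x" and kb = "\<lambda>z x b a. b" and
      ka = "\<lambda>z x b a. a + x * b * w" and lz = "\<lambda>z x b a. z" and lx = "\<lambda>z x b a. x" and
      lb = "\<lambda>z x b a. b" and la = "\<lambda>z x b a. a - x * b * w"],
    goal_cases)
  case (1 z x b a)
  then have m: "z \<in> \<O>" "x \<in> \<O>" "b \<in> \<U>" "a \<in> \<U>"
    by auto
  note m' = m m(3,4)[THEN units_integers] and [simp] = m(3,4)[THEN units_nonzero]
  show ?case
    unfolding cell_A_def S7_def
    by (intro conjI; (rule integrand_eqI(2)[OF chi_eqI[of _ _ "a * b" "x * b * w / a"]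
        Phi_cell_w2[OF h m(2)]])?;
      (((rule m' closure_rules)+; fail) |
      (rule units_nonzero, (rule m' closure_rules)+; fail) |
      (simp add: field_rules; fail)))
next
  case (2 z x b a)
  then have m: "z \<in> \<O>" "x \<in> \<O>" "b \<in> \<U>" "a \<in> \<U>"
    by auto
  note m' = m m(3,4)[THEN units_integers] and [simp] = m(3,4)[THEN units_nonzero]
  show ?case
    by (intro conjI;
      (((rule m' closure_rules)+; fail) |
      (simp add: field_rules; fail)))
qed ((intro region_rules)?;
    (rule loc_subset[OF loc_S7[OF h]])?; auto intro!: units_intros intro: O_rules)+

lemma J_T1:
  "\<forall>\<^sub>F n in sequentially. J n (box \<O> \<U> \<U> \<U>) (S1 (mat 1) (w ^ 4)) =
    J n (box \<O> \<U> \<U> \<U>) F1"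
proof (rule J_subst_eventually[where
      kz = "\<lambda>z x b a. z + (a + x * b) * b * w" and kx = "\<lambda>z x b a. x" and
      kb = "\<lambda>z x b a. b" and ka = "\<lambda>z x b a. a" and
      lz = "\<lambda>z x b a. z - (a + x * b) * b * w" and lx = "\<lambda>z x b a. x" and
      lb = "\<lambda>z x b a. b" and la = "\<lambda>z x b a. a"],
    goal_cases)
  case (1 z x b a)
  then have m: "z \<in> \<O>" "x \<in> \<U>" "b \<in> \<U>" "a \<in> \<U>"
    by auto
  note m' = m m(2,3,4)[THEN units_integers] and [simp] = m(2,3,4)[THEN units_nonzero]
  show ?case
    unfolding S1_def F1_def
    by (intro conjI; (rule integrand_eqI(1)[OF chi_eqI[of _ _ "a * b" "0"]
        Phi_mat_1])?;
      (((rule m' closure_rules)+; fail) |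
      (simp add: field_rules; fail)))
next
  case (2 z x b a)
  then have m: "z \<in> \<O>" "x \<in> \<U>" "b \<in> \<U>" "a \<in> \<U>"
    by auto
  note m' = m m(2,3,4)[THEN units_integers] and [simp] = m(2,3,4)[THEN units_nonzero]
  show ?case
    by (intro conjI;
      (((rule m' closure_rules)+; fail) |
      (simp add: field_rules; fail)))
qed ((intro region_rules)?;
    (rule loc_subset[OF loc_F1])?; auto intro!: units_intros intro: O_rules)+

lemma J_T7:
  "\<forall>\<^sub>F n in sequentially. J n (box \<O> \<O> \<U> \<U>) (S7 (mat 1) (w ^ 4)) =
    J n (box \<O> \<U> \<U> \<O>) F7"
proof (rule J_subst_eventually[where
      kz = "\<lambda>z x b a. z + a * b * w" and kx = "\<lambda>z x b a. b" and kb = "\<lambda>z x b a. a" and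
      ka = "\<lambda>z x b a. x" and lz = "\<lambda>z x b a. z - b * x * w" and lx = "\<lambda>z x b a. a" and
      lb = "\<lambda>z x b a. x" and la = "\<lambda>z x b a. b"],
    goal_cases)
  case (1 z x b a)
  then have m: "z \<in> \<O>" "x \<in> \<O>" "b \<in> \<U>" "a \<in> \<U>"
    by auto
  note m' = m m(3,4)[THEN units_integers] and [simp] = m(3,4)[THEN units_nonzero]
  show ?case
    unfolding S7_def F7_def
    by (intro conjI; (rule integrand_eqI(1)[OF chi_eqI[of _ _ "a * b" "0"]
        Phi_mat_1])?;
      (((rule m' closure_rules)+; fail) |
      (simp add: field_rules; fail)))
next
  case (2 z x b a)
  then have m: "z \<in> \<O>" "x \<in> \<U>" "b \<in> \<U>" "a \<in> \<O>"
    by auto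
  note m' = m m(2,3)[THEN units_integers] and [simp] = m(2,3)[THEN units_nonzero]
  show ?case
    by (intro conjI;
      (((rule m' closure_rules)+; fail) |
      (simp add: field_rules; fail)))
qed ((intro region_rules)?;
    (rule loc_subset[OF loc_F7])?; auto intro!: units_intros intro: O_rules)+

lemma J_T11:
  "\<forall>\<^sub>F n in sequentially. J n (box \<O> \<O> \<U> \<U>) (S11 (mat 1) (w ^ 4)) =
    J n (box \<O> \<O> \<U> \<U>) F11"
proof (rule J_subst_eventually[where
      kz = "\<lambda>z x b a. z - b * (x * b + a * w)" and kx = "\<lambda>z x b a. x" and
      kb = "\<lambda>z x b a. b" and ka = "\<lambda>z x b a. a" and
      lz = "\<lambda>z x b a. z + b * (x * b + a * w)" and lx = "\<lambda>z x b a. x" and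
      lb = "\<lambda>z x b a. b" and la = "\<lambda>z x b a. a"],
    goal_cases)
  case (1 z x b a)
  then have m: "z \<in> \<O>" "x \<in> \<O>" "b \<in> \<U>" "a \<in> \<U>"
    by auto
  note m' = m m(3,4)[THEN units_integers] and [simp] = m(3,4)[THEN units_nonzero]
  show ?case
    unfolding S11_def F11_def
    by (intro conjI; (rule integrand_eqI(1)[OF chi_eqI[of _ _ "a * b" "0"]
        Phi_mat_1])?;
      (((rule m' closure_rules)+; fail) |
      (simp add: field_rules; fail)))
next
  case (2 z x b a)
  then have m: "z \<in> \<O>" "x \<in> \<O>" "b \<in> \<U>" "a \<in> \<U>"
    by auto
  note m' = m m(3,4)[THEN units_integers] and [simp] = m(3,4)[THEN units_nonzero]
  show ?case
    by (intro conjI;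
      (((rule m' closure_rules)+; fail) |
      (simp add: field_rules; fail)))
qed ((intro region_rules)?;
    (rule loc_subset[OF loc_F11])?; auto intro!: units_intros intro: O_rules)+

text \<open>The entries \<open>r\<close>, \<open>c\<close>, \<open>t\<close> fix three variables.
  Since \<open>z\<close> enters only through \<open>a * b + z * w\<close>, it is kept in the dummy
  slot, from which \<open>a * b\<close> can be recovered.\<close>

lemma J_T14:
  "\<forall>\<^sub>F n in sequentially. J n (box \<O> \<O> \<U> \<U>) (S11 (t4M w) (w ^ 2)) =
    J n (box \<O> \<U> \<U> \<O>) F14"
proof (rule J_subst_eventually[where
      kz = "\<lambda>z x b a. - (x + a ^ 2 * w / (a * b + z * w))" and
      kx = "\<lambda>z x b a. 1 / (a * b + z * w)" and kb = "\<lambda>z x b a. a / (a * b + z * w)" and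
      ka = "\<lambda>z x b a. z" and lz = "\<lambda>z x b a. a" and
      lx = "\<lambda>z x b a. - z - b ^ 2 * w / x" and lb = "\<lambda>z x b a. (1 - a * x * w) / b" and
      la = "\<lambda>z x b a. b / x"],
    goal_cases)
  case (1 z x b a)
  then have m: "z \<in> \<O>" "x \<in> \<O>" "b \<in> \<U>" "a \<in> \<U>"
    by auto
  note m' = m m(3,4)[THEN units_integers] and [simp] = m(3,4)[THEN units_nonzero]
  define u where "u = a * b + z * w"
  have u: "u \<in> \<U>"
    unfolding u_def by (rule m' closure_rules)+
  note m' = m' u u[THEN units_integers] and [simp] = u[THEN units_nonzero]
  have u_eq: "z = (u - a * b) / w"
    by (simp add: u_def field_simps)
  show ?case
    unfolding S11_def F14_def
    by (intro conjI; (rule integrand_eqI(1)[OF chi_eqI[of _ _ "1" "- z * w / u"]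
        Phi_T14[OF m(1,2,3,4)]])?; (simp only: u_def[symmetric])?;
      (((rule m' closure_rules)+; fail) |
      (simp add: u_eq field_rules; fail)))
next
  case (2 z x b a)
  then have m: "z \<in> \<O>" "x \<in> \<U>" "b \<in> \<U>" "a \<in> \<O>"
    by auto
  note m' = m m(2,3)[THEN units_integers] and [simp] = m(2,3)[THEN units_nonzero]
  have E0: "(b / x) * ((1 - a * x * w) / b) + (a) * w = 1 / x"
    by (simp add: field_rules)
  show ?case
    by (intro conjI; (simp only: E0)?;
      (((rule m' closure_rules)+; fail) |
      (simp add: field_rules; fail)))
qed ((intro region_rules)?;
    (rule loc_subset[OF loc_F14])?; auto intro!: units_den units_intros intro: O_rules)+

text \<open>The target does not see \<open>z + a * b\<close>; it is stored in the dummy slot, which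
  therefore ranges over \<open>\<P>\<close> only and later accounts for a factor
  \<open>1 / q\<close>.\<close>

lemma J_T4:
  "\<forall>\<^sub>F n in sequentially. J n (\<lambda>z x b a. box \<U> \<O> \<U> \<U> z x b a \<and> z + a * b \<in> \<P>) (S11 (t4M w) (w ^ 3)) =
    J n (box \<U> \<U> \<O> \<P>) F4"
proof (rule J_subst_eventually[where
      kz = "\<lambda>z x b a. b / z" and kx = "\<lambda>z x b a. - 1 / z" and
      kb = "\<lambda>z x b a. (a * w + x * b) / z" and ka = "\<lambda>z x b a. z + a * b" and
      lz = "\<lambda>z x b a. - 1 / x" and lx = "\<lambda>z x b a. (b - (1 + x * a) * w * x / z) / z" and
      lb = "\<lambda>z x b a. - z / x" and la = "\<lambda>z x b a. - (1 + x * a) / z"],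
    goal_cases)
  case (1 z x b a)
  then have m: "z \<in> \<U>" "x \<in> \<O>" "b \<in> \<U>" "a \<in> \<U>" "z + a * b \<in> \<P>"
    by auto
  note m' = m m(1,3,4)[THEN units_integers] m(5)[THEN max_ideal_integers] and [simp] = m(1,3,4)[THEN units_nonzero]
  define u where "u = z + a * b"
  have u: "u \<in> \<P>"
    using m by (simp add: u_def)
  note m' = m' u u[THEN max_ideal_integers]
  have u_eq: "a = (u - z) / b"
    by (simp add: u_def field_simps)
  show ?case
    unfolding S11_def F4_def
    by (intro conjI; (rule integrand_eqI(1)[OF chi_eqI[of _ _ "1" "- (z + a * b) / z"]
        Phi_T4[OF m]])?; (simp only: u_def[symmetric])?;
      (((rule m' closure_rules)+; fail) |
      (rule units_nonzero, (rule m' closure_rules)+; fail) |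
      (simp add: u_eq field_rules; fail)))
next
  case (2 z x b a)
  then have m: "z \<in> \<U>" "x \<in> \<U>" "b \<in> \<O>" "a \<in> \<P>"
    by auto
  note m' = m m(1,2)[THEN units_integers] m(4)[THEN max_ideal_integers] and [simp] = m(1,2)[THEN units_nonzero]
  have E0: "(- 1 / x) + (- (1 + x * a) / z) * (- z / x) = a"
    by (simp add: field_rules)
  show ?case
    by (intro conjI; (simp only: E0)?;
      (((rule m' closure_rules)+; fail) |
      (simp add: field_rules; fail)))
qed ((intro region_rules)?;
    (rule loc_subset[OF loc_F4])?; auto intro!: units_intros intro: O_rules)+

text \<open>No dummy is left: \<open>s\<close> and \<open>r\<close> give two variables,
  \<open>t\<close> gives \<open>- a / (z + a * b)\<close>, and the corner gives
  \<open>- z / (a * b)\<close>. The coset excluded in \<open>Ounits1 ord\<close> corresponds to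
  \<open>z + a * b\<close> in \<open>\<P>\<close>.\<close>

lemma J_T12:
  "\<forall>\<^sub>F n in sequentially. J n (\<lambda>z x b a. box \<U> \<O> \<U> \<U> z x b a \<and> z + a * b \<in> \<U>) (S11 (t4M w) (w ^ 3)) =
    J n (box (Ounits1 ord) \<O> \<U> \<U>) F12"
proof (rule J_subst_eventually[where
      kz = "\<lambda>z x b a. - z / (a * b)" and kx = "\<lambda>z x b a. (a * w + x * b) / z" and
      kb = "\<lambda>z x b a. - a / (z + a * b)" and ka = "\<lambda>z x b a. b / z" and
      lz = "\<lambda>z x b a. - 1 / (a * b * (1 - z))" and
      lx = "\<lambda>z x b a. x / a - b * w * (1 - z) / (a * z)" and
      lb = "\<lambda>z x b a. - 1 / (b * (1 - z))" and la = "\<lambda>z x b a. - 1 / (a * z)"],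
    goal_cases)
  case (1 z x b a)
  then have m: "z \<in> \<U>" "x \<in> \<O>" "b \<in> \<U>" "a \<in> \<U>" "z + a * b \<in> \<U>"
    by auto
  note m' = m m(1,3,4,5)[THEN units_integers] and [simp] = m(1,3,4)[THEN units_nonzero]
  define u where "u = z + a * b"
  have u: "u \<in> \<U>"
    using m by (simp add: u_def)
  note m' = m' u u[THEN units_integers] and [simp] = u[THEN units_nonzero]
  have u_eq: "a = (u - z) / b"
    by (simp add: u_def field_simps)
  have E1: "1 - (- z / (a * b)) = u / (a * b)"
    by (simp add: u_def field_rules)
  show ?case
    unfolding S11_def F12_def Ounits1_iff
    by (intro conjI; (rule integrand_eqI(1)[OF chi_eqI[of _ _ "1" "0"]
        Phi_T12[OF m]])?; (simp only: u_def[symmetric] E1)?;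
      (((rule m' closure_rules)+; fail) |
      (simp add: field_rules; fail) |
      (simp add: u_eq field_rules; fail)))
next
  case (2 z x b a)
  then have m: "z \<in> \<U>" "1 - z \<in> \<U>" "x \<in> \<O>" "b \<in> \<U>" "a \<in> \<U>"
    by (auto simp: Ounits1_iff)
  note m' = m m(1,2,4,5)[THEN units_integers] and [simp] = m(1,4,5)[THEN units_nonzero]
  define u where "u = 1 - z"
  have u: "u \<in> \<U>"
    using m by (simp add: u_def)
  note m' = m' u u[THEN units_integers] and [simp] = u[THEN units_nonzero]
  have E1: "(- 1 / (a * b * u)) + (- 1 / (a * z)) * (- 1 / (b * u)) = 1 / (a * b * z)"
    by (simp add: field_rules, use u_def in algebra)
  show ?case
    by (intro conjI; (simp only: u_def[symmetric] E1)?;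
      (((rule m' closure_rules)+; fail) |
      (simp add: field_rules; fail)))
qed ((intro region_rules)?;
    (rule loc_subset[OF loc_F12])?; auto simp: Ounits1_iff intro!: units_intros intro: O_rules)+

text \<open>The dummy \<open>x\<close> of \<open>S7\<close>, confined to \<open>\<P>\<close>,
  becomes the distance of the first variable of T13 from 1. This covers the part of T13 with that
  variable in \<open>1 + \<P>\<close>.\<close>

lemma J_T13_max_ideal:
  "\<forall>\<^sub>F n in sequentially. J n (box \<O> \<P> \<U> \<U>) (S7 (t4M w) (w ^ 2)) =
    J n (\<lambda>z x b a. box \<U> \<U> \<U> \<O> z x b a \<and> 1 - z \<in> \<P>) F13"
proof (rule J_subst_eventually[where
      kz = "\<lambda>z x b a. 1 + x" and kx = "\<lambda>z x b a. 1 / (a * b + z * w)" and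
      kb = "\<lambda>z x b a. - 1 / a" and ka = "\<lambda>z x b a. z" and lz = "\<lambda>z x b a. a" and
      lx = "\<lambda>z x b a. z - 1" and lb = "\<lambda>z x b a. - (1 / x - a * w) * b" and
      la = "\<lambda>z x b a. - 1 / b"],
    goal_cases)
  case (1 z x b a)
  then have m: "z \<in> \<O>" "x \<in> \<P>" "b \<in> \<U>" "a \<in> \<U>"
    by auto
  note m' = m m(3,4)[THEN units_integers] m(2)[THEN max_ideal_integers] and [simp] = m(3,4)[THEN units_nonzero]
  define u where "u = a * b + z * w"
  have u: "u \<in> \<U>"
    unfolding u_def by (rule m' closure_rules)+
  note m' = m' u u[THEN units_integers] and [simp] = u[THEN units_nonzero]
  have u_eq: "z = (u - a * b) / w"
    by (simp add: u_def field_simps)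
  have E1: "1 - (1 + x) = - x"
    by (simp add: field_rules)
  show ?case
    unfolding S7_def F13_def
    by (intro conjI; (rule integrand_eqI(1)[OF chi_eqI[of _ _ "1" "x - z * w / u - z * w * x / u"]
        Phi_T13_max_ideal[OF m]])?; (simp only: u_def[symmetric] E1)?;
      (((rule m' closure_rules)+; fail) |
      (rule units_nonzero, (rule m' closure_rules)+; fail) |
      (simp add: u_eq field_rules; fail)))
next
  case (2 z x b a)
  then have m: "z \<in> \<U>" "x \<in> \<U>" "b \<in> \<U>" "a \<in> \<O>" "1 - z \<in> \<P>"
    by auto
  note m' = m m(1,2,3)[THEN units_integers] m(5)[THEN max_ideal_integers] and [simp] = m(1,2,3)[THEN units_nonzero]
  have E0: "z - 1 = - (1 - z)"
    by (simp add: field_rules)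
  show ?case
    by (intro conjI; (simp only: E0)?;
      (((rule m' closure_rules)+; fail) |
      (simp add: field_rules; fail)))
qed ((intro region_rules)?;
    (rule loc_subset[OF loc_F13])?; auto intro!: units_den units_intros intro: O_rules)+

text \<open>The new \<open>z * b + x\<close> is \<open>- (z + a * b) / z ^ 2\<close> in the old
  variables, so the condition of the source becomes one half of the dichotomy for T5; the lift
  \<open>T\<close> is \<open>0\<close>.\<close>

lemma J_T5_max_ideal:
  "\<forall>\<^sub>F n in sequentially. J n (\<lambda>z x b a. box \<U> \<O> \<U> \<U> z x b a \<and> z + a * b \<in> \<P>) (S7 (t4M w) (w ^ 3)) =
    J n (\<lambda>z x b a. box \<U> \<U> \<U> \<O> z x b a \<and> z * b + x \<in> \<P>) F5"
proof (rule J_subst_eventually[where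
      kz = "\<lambda>z x b a. - a / z" and kx = "\<lambda>z x b a. - 1 / z" and
      kb = "\<lambda>z x b a. b / z" and ka = "\<lambda>z x b a. x" and lz = "\<lambda>z x b a. - 1 / x" and
      lx = "\<lambda>z x b a. a" and lb = "\<lambda>z x b a. - b / x" and la = "\<lambda>z x b a. z / x"],
    goal_cases)
  case (1 z x b a)
  then have m: "z \<in> \<U>" "x \<in> \<O>" "b \<in> \<U>" "a \<in> \<U>" "z + a * b \<in> \<P>"
    by auto
  note m' = m m(1,3,4)[THEN units_integers] m(5)[THEN max_ideal_integers] and [simp] = m(1,3,4)[THEN units_nonzero]
  define u where "u = z + a * b"
  have u: "u \<in> \<P>"
    using m by (simp add: u_def)
  note m' = m' u u[THEN max_ideal_integers]
  have u_eq: "a = (u - z) / b"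
    by (simp add: u_def field_simps)
  have P0: "z + a * b - 0 * a ^ 2 \<in> \<P>"
    using m by simp
  have E1: "(- a / z) * (b / z) + (- 1 / z) = - u / z ^ 2"
    by (simp add: u_eq field_rules)
  show ?case
    unfolding S7_def F5_def
    by (intro conjI; (rule integrand_eqI(1)[OF chi_eqI[of _ _ "1" "- (z + a * b) / z"]
        Phi_C7_units[OF m(1,3,4) integers_0 P0]])?; (simp only: u_def[symmetric] E1)?;
      (((rule m' closure_rules)+; fail) |
      (rule units_nonzero, (rule m' closure_rules)+; fail) |
      (simp add: u_eq field_rules; fail)))
next
  case (2 z x b a)
  then have m: "z \<in> \<U>" "x \<in> \<U>" "b \<in> \<U>" "a \<in> \<O>" "z * b + x \<in> \<P>"
    by auto
  note m' = m m(1,2,3)[THEN units_integers] m(5)[THEN max_ideal_integers] and [simp] = m(1,2,3)[THEN units_nonzero]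
  define v where "v = z * b + x"
  have v: "v \<in> \<P>"
    using m by (simp add: v_def)
  note m' = m' v v[THEN max_ideal_integers]
  have E1: "(- 1 / x) + (z / x) * (- b / x) = - v / x ^ 2"
    by (simp add: v_def field_rules)
  show ?case
    by (intro conjI; (simp only: v_def[symmetric] E1)?;
      (((rule m' closure_rules)+; fail) |
      (simp add: field_rules; fail)))
qed ((intro region_rules)?;
    (rule loc_subset[OF loc_F5])?; auto intro!: units_intros intro: O_rules)+

text \<open>The corner must be \<open>- 1 / z\<close>, which forces
  \<open>ka = z / (a * b) * (1 - kz)\<close>. The solution with \<open>kz = ka\<close> is
  \<open>z / (z + a * b)\<close>; perturbing \<open>kz\<close> by the dummy \<open>x\<close> in
  \<open>\<P>\<close> sweeps out all pairs with difference in \<open>\<P>\<close>.\<close>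

lemma J_T2_max_ideal:
  "\<forall>\<^sub>F n in sequentially. J n (\<lambda>z x b a. box \<U> \<P> \<U> \<U> z x b a \<and> z + a * b \<in> \<U>) (S7 (t4M w) (w ^ 3)) =
    J n (\<lambda>z x b a. box (Ounits1 ord) \<U> \<U> (Ounits1 ord) z x b a \<and> z - a \<in> \<P>) F2"
proof (rule J_subst_eventually[where
      kz = "\<lambda>z x b a. z / (z + a * b) + x" and kx = "\<lambda>z x b a. - a / z" and
      kb = "\<lambda>z x b a. - b / z" and
      ka = "\<lambda>z x b a. z / (a * b) * (a * b / (z + a * b) - x)" and
      lz = "\<lambda>z x b a. (1 - z) / (x * b * a)" and lx = "\<lambda>z x b a. z - a / (1 - z + a)" and
      lb = "\<lambda>z x b a. - (1 - z) / (x * a)" and la = "\<lambda>z x b a. - (1 - z) / (b * a)"],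
    goal_cases)
  case (1 z x b a)
  then have m: "z \<in> \<U>" "x \<in> \<P>" "b \<in> \<U>" "a \<in> \<U>" "z + a * b \<in> \<U>"
    by auto
  note m' = m m(1,3,4,5)[THEN units_integers] m(2)[THEN max_ideal_integers] and [simp] = m(1,3,4)[THEN units_nonzero]
  define u where "u = z + a * b"
  have u: "u \<in> \<U>"
    using m by (simp add: u_def)
  note m' = m' u u[THEN units_integers] and [simp] = u[THEN units_nonzero]
  \<comment> \<open>\<open>h\<close>, \<open>e\<close> and \<open>g\<close> are
    \<open>1 - z / u\<close>, \<open>1 - kz\<close> and \<open>1 - ka\<close>; the last two differ
    from \<open>h\<close> by elements of \<open>\<P>\<close>, so all are units.\<close>
  define h where "h = a * b / u"
  have h: "h \<in> \<U>"
    unfolding h_def by (rule m' closure_rules)+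
  note m' = m' h h[THEN units_integers] and [simp] = h[THEN units_nonzero]
  define e where "e = h - x"
  have e: "e \<in> \<U>"
    unfolding e_def by (rule m' closure_rules)+
  note m' = m' e e[THEN units_integers] and [simp] = e[THEN units_nonzero]
  define g where "g = h + z * x / (a * b)"
  have g: "g \<in> \<U>"
    unfolding g_def by (rule m' closure_rules)+
  note m' = m' g g[THEN units_integers] and [simp] = g[THEN units_nonzero]
  have h1: "h * u = a * b"
    by (simp add: h_def)
  have g1: "a * b * g = a * b * h + z * x"
    by (simp add: g_def field_rules)
  \<comment> \<open>The lift \<open>b / (a * g)\<close> is the entry \<open>t\<close> that
    \<open>F2\<close> prescribes; it is admissible because its defect, computed in
    \<open>P1\<close>, contains the factor \<open>x\<close>.\<close>
  have TO: "b / (a * g) \<in> \<O>"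
    by (rule m' closure_rules)+
  have P1: "z + a * b - b / (a * g) * a ^ 2 = u * z * x / (a * b * g)"
    unfolding u_def[symmetric] by (simp add: field_rules, use g1 h1 in algebra)
  have P0: "z + a * b - b / (a * g) * a ^ 2 \<in> \<P>"
    unfolding P1 by (rule m' closure_rules)+
  have E3: "1 - (z / u + x) = e"
    by (simp add: field_rules, use e_def h1 u_def in algebra)
  have E4: "1 - z / (a * b) * e = g"
    by (simp add: field_rules, use e_def g1 h1 u_def in algebra)
  have E5: "z / u + x - z / (a * b) * e = x + z * x / (a * b)"
    by (simp add: e_def h_def field_rules)
  have E6: "e + z / (a * b) * e = e * u / (a * b)"
    by (simp add: u_def field_rules)
  show ?case
    unfolding S7_def F2_def Ounits1_iff
    by (intro conjI; (rule integrand_eqI(1)[OF chi_eqI[of _ _ "h" "u * x / z - u * x / (a * b) - u * x * u * x / (a * b * z)"]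
        Phi_C7_units[OF m(1,3,4) TO P0]])?; (simp only: u_def[symmetric] h_def[symmetric] e_def[symmetric] E3 E4 E5 E6)?;
      (((rule m' closure_rules)+; fail) |
      (rule units_nonzero, (rule m' closure_rules)+; fail) |
      (simp add: field_rules; fail) |
      (simp add: e_def h_def field_rules; fail)))
next
  case (2 z x b a)
  then have m: "z \<in> \<U>" "1 - z \<in> \<U>" "x \<in> \<U>" "b \<in> \<U>" "a \<in> \<U>" "1 - a \<in> \<U>"
      "z - a \<in> \<P>"
    by (auto simp: Ounits1_iff)
  note m' = m m(1,2,3,4,5,6)[THEN units_integers] m(7)[THEN max_ideal_integers] and [simp] = m(1,3,4,5)[THEN units_nonzero]
  define v where "v = 1 - z"
  have v: "v \<in> \<U>"
    using m by (simp add: v_def)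
  note m' = m' v v[THEN units_integers] and [simp] = v[THEN units_nonzero]
  \<comment> \<open>\<open>y\<close> is 1 modulo \<open>\<P>\<close>, and \<open>a / y\<close>
    recovers the unperturbed value \<open>z / u\<close> of the forward map.\<close>
  define y where "y = v + a"
  have y: "y \<in> \<U>"
    unfolding y_def v_def by (rule units_1_diff_add, rule m)
  note m' = m' y y[THEN units_integers] and [simp] = y[THEN units_nonzero]
  have E2: "z - a / y = v / y * (z - a)"
    by (simp add: field_rules, use v_def y_def in algebra)
  have E3: "(v / (x * b * a)) + (- v / (b * a)) * (- v / (x * a)) = v * y / (x * b * a ^ 2)"
    by (simp add: field_rules, use v_def y_def in algebra)
  show ?case
    by (intro conjI; (simp only: v_def[symmetric] y_def[symmetric] E2 E3)?;
      (((rule m' closure_rules)+; fail) |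
      (simp add: field_rules; fail) |
      (simp add: field_rules, use v_def y_def in algebra)))
qed ((intro region_rules)?;
    (rule loc_subset[OF loc_F2])?; auto simp: Ounits1_iff intro!: units_1_diff_add units_intros intro: O_rules)+

text \<open>Matching \<open>r\<close>, \<open>t\<close> and the corner in this order gives
  \<open>kb\<close>, \<open>kx\<close> and \<open>1 - kz = - x * (a * b + z * w) / a ^ 2\<close>.
  The latter is a unit, so this is the complement of the part of T13 that comes from
  \<open>S7\<close>.\<close>

lemma J_T13_units:
  "\<forall>\<^sub>F n in sequentially. J n (\<lambda>z x b a. box \<O> \<U> \<U> \<U> z x b a \<and> a + x * b \<in> \<U>) (S1 (t4M w) (w ^ 2)) =
    J n (box (Ounits1 ord) \<U> \<U> \<O>) F13"
proof (rule J_subst_eventually[where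
      kz = "\<lambda>z x b a. (a * (a + x * b) + x * z * w) / a ^ 2" and
      kx = "\<lambda>z x b a. a ^ 2 / ((a * (a + x * b) + x * z * w) * (a * b + z * w))" and
      kb = "\<lambda>z x b a. - a / (a * (a + x * b) + x * z * w)" and ka = "\<lambda>z x b a. z" and
      lz = "\<lambda>z x b a. a" and lx = "\<lambda>z x b a. - (x * (1 - z)) / (b ^ 2 * z)" and
      lb = "\<lambda>z x b a. - (b / x) + a * b * z * w" and la = "\<lambda>z x b a. - 1 / (b * z)"],
    goal_cases)
  case (1 z x b a)
  then have m: "z \<in> \<O>" "x \<in> \<U>" "b \<in> \<U>" "a \<in> \<U>" "a + x * b \<in> \<U>"
    by auto
  note m' = m m(2,3,4,5)[THEN units_integers] and [simp] = m(2,3,4)[THEN units_nonzero]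
  define u where "u = a * b + z * w"
  have u: "u \<in> \<U>"
    unfolding u_def by (rule m' closure_rules)+
  note m' = m' u u[THEN units_integers] and [simp] = u[THEN units_nonzero]
  define q' where "q' = a * (a + x * b) + x * z * w"
  have q': "q' \<in> \<U>"
    unfolding q'_def by (rule m' closure_rules)+
  note m' = m' q' q'[THEN units_integers] and [simp] = q'[THEN units_nonzero]
  have AU: "- (a + x * b) \<in> \<U>"
    by (rule m' closure_rules)+
  have E2: "a * - (a + x * b) - x * z * w = - q'"
    by (simp add: q'_def field_rules)
  have E3: "1 - (q' / a ^ 2) = - x * u / a ^ 2"
    by (simp add: field_rules, use q'_def u_def in algebra)
  show ?case
    unfolding S1_def F13_def Ounits1_iff
    by (intro conjI; (rule integrand_eqI(1)[OF chi_eqI[of _ _ "1" "- z * w / u"]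
        Phi_T13_units[OF m(1,2,3,4) refl AU refl]])?; (simp only: q'_def[symmetric] u_def[symmetric] E2 E3)?;
      (((rule m' closure_rules)+; fail) |
      (simp add: field_rules; fail) |
      (simp add: field_rules, use u_def in algebra)))
next
  case (2 z x b a)
  then have m: "z \<in> \<U>" "1 - z \<in> \<U>" "x \<in> \<U>" "b \<in> \<U>" "a \<in> \<O>"
    by (auto simp: Ounits1_iff)
  note m' = m m(1,2,3,4)[THEN units_integers] and [simp] = m(1,3,4)[THEN units_nonzero]
  define v where "v = 1 - z"
  have v: "v \<in> \<U>"
    using m by (simp add: v_def)
  note m' = m' v v[THEN units_integers] and [simp] = v[THEN units_nonzero]
  have E1: "(- 1 / (b * z)) + (- (x * v) / (b ^ 2 * z)) * (- (b / x) + a * b * z * w) = - (1 + x * v * a * w) / b"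
    by (simp add: field_rules, use v_def in algebra)
  have E2: "(- 1 / (b * z)) * (- (1 + x * v * a * w) / b) + (- (x * v) / (b ^ 2 * z)) * (a) * w = 1 / (b ^ 2 * z)"
    by (simp add: field_rules)
  have E3: "(- 1 / (b * z)) * (- (b / x) + a * b * z * w) + (a) * w = 1 / (x * z)"
    by (simp add: field_rules)
  show ?case
    by (intro conjI; (simp only: v_def[symmetric] E1 E2 E3)?;
      (((rule m' closure_rules)+; fail) |
      (simp add: field_rules; fail)))
qed ((intro region_rules)?;
    (rule loc_subset[OF loc_F13])?; auto simp: Ounits1_iff intro!: units_den units_intros intro: O_rules)+

text \<open>The new \<open>z * b + x\<close> reduces to \<open>- x * b ^ 2 / z ^ 2\<close> modulo
  \<open>\<P>\<close>, hence is a unit: this is the other half of T5. The dummy slot stores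
  \<open>z + a * b\<close>.\<close>

lemma J_T5_units:
  "\<forall>\<^sub>F n in sequentially. J n (\<lambda>z x b a. box \<U> \<U> \<U> \<U> z x b a \<and> z + a * b \<in> \<P>) (S1 (t4M w) (w ^ 3)) =
    J n (\<lambda>z x b a. box \<O> \<U> \<U> \<P> z x b a \<and> z * b + x \<in> \<U>) F5"
proof (rule J_subst_eventually[where
      kz = "\<lambda>z x b a. - (a + x * b) / z" and kx = "\<lambda>z x b a. - 1 / z" and
      kb = "\<lambda>z x b a. b / z" and ka = "\<lambda>z x b a. z + a * b" and
      lz = "\<lambda>z x b a. - 1 / x" and lx = "\<lambda>z x b a. - (z * b + x + x ^ 2 * a) / b ^ 2" and
      lb = "\<lambda>z x b a. - b / x" and la = "\<lambda>z x b a. - (1 + x * a) / b"],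
    goal_cases)
  case (1 z x b a)
  then have m: "z \<in> \<U>" "x \<in> \<U>" "b \<in> \<U>" "a \<in> \<U>" "z + a * b \<in> \<P>"
    by auto
  note m' = m m(1,2,3,4)[THEN units_integers] m(5)[THEN max_ideal_integers] and [simp] = m(1,2,3,4)[THEN units_nonzero]
  define u where "u = z + a * b"
  have u: "u \<in> \<P>"
    using m by (simp add: u_def)
  note m' = m' u u[THEN max_ideal_integers]
  have u_eq: "a = (u - z) / b"
    by (simp add: u_def field_simps)
  have P0: "z + a * b - 0 * (z * x - - (a + x * b) * a) \<in> \<P>"
    using m by simp
  have E1: "(- (a + x * b) / z) * (b / z) + (- 1 / z) = - (x * b ^ 2 + u) / z ^ 2"
    by (simp add: u_eq field_rules)
  show ?case
    unfolding S1_def F5_def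
    by (intro conjI; (rule integrand_eqI(1)[OF chi_eqI[of _ _ "1" "- (z + a * b) / z"]
        Phi_C1_units[OF m(1,2,3,4) refl integers_0 P0]])?; (simp only: u_def[symmetric] E1)?;
      (((rule m' closure_rules)+; fail) |
      (rule units_nonzero, (rule m' closure_rules)+; fail) |
      (simp add: u_eq field_rules; fail)))
next
  case (2 z x b a)
  then have m: "z \<in> \<O>" "x \<in> \<U>" "b \<in> \<U>" "a \<in> \<P>" "z * b + x \<in> \<U>"
    by auto
  note m' = m m(2,3,5)[THEN units_integers] m(4)[THEN max_ideal_integers] and [simp] = m(2,3)[THEN units_nonzero]
  define v where "v = z * b + x"
  have v: "v \<in> \<U>"
    using m by (simp add: v_def)
  note m' = m' v v[THEN units_integers] and [simp] = v[THEN units_nonzero]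
  have E1: "(- 1 / x) + (- (1 + x * a) / b) * (- b / x) = a"
    by (simp add: field_rules)
  show ?case
    by (intro conjI; (simp only: v_def[symmetric] E1)?;
      (((rule m' closure_rules)+; fail) |
      (simp add: v_def field_rules; fail)))
qed ((intro region_rules)?;
    (rule loc_subset[OF loc_F5])?; auto intro!: units_intros intro: O_rules)+

text \<open>The lift is now the exact quotient \<open>u / d\<close>. The difference
  \<open>kz - ka\<close> equals \<open>z * x * b / (u * y)\<close>, a unit because \<open>x\<close>
  is one, so this is the half of T2 complementary to the one from \<open>S7\<close>.\<close>

lemma J_T2_units:
  "\<forall>\<^sub>F n in sequentially. J n (\<lambda>z x b a. ((box \<U> \<U> \<U> \<U> z x b a \<and> z + a * b \<in> \<U>) \<and> a + x * b \<in> \<U>) \<and> z * x + (a + x * b) * a \<in> \<U>) (S1 (t4M w) (w ^ 3)) =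
    J n (\<lambda>z x b a. box (Ounits1 ord) \<U> \<U> (Ounits1 ord) z x b a \<and> z - a \<in> \<U>) F2"
proof (rule J_subst_eventually[where
      kz = "\<lambda>z x b a. z / (z + a * b)" and kx = "\<lambda>z x b a. - (a + x * b) / z" and
      kb = "\<lambda>z x b a. - b / z" and ka = "\<lambda>z x b a. a * z / ((a + x * b) * (z + a * b))" and
      lz = "\<lambda>z x b a. (1 - z) / (x * b * a)" and lx = "\<lambda>z x b a. x * (z - a) / (b * z)" and
      lb = "\<lambda>z x b a. - (1 - z) / (x * a)" and la = "\<lambda>z x b a. - (1 - z) / (z * b)"],
    goal_cases)
  case (1 z x b a)
  then have m: "z \<in> \<U>" "x \<in> \<U>" "b \<in> \<U>" "a \<in> \<U>" "z + a * b \<in> \<U>" "a + x * b \<in> \<U>"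
      "z * x + (a + x * b) * a \<in> \<U>"
    by auto
  note m' = m m(1,2,3,4,5,6,7)[THEN units_integers] and [simp] = m(1,2,3,4)[THEN units_nonzero]
  define u where "u = z + a * b"
  have u: "u \<in> \<U>"
    using m by (simp add: u_def)
  note m' = m' u u[THEN units_integers] and [simp] = u[THEN units_nonzero]
  define y where "y = a + x * b"
  have y: "y \<in> \<U>"
    using m by (simp add: y_def)
  note m' = m' y y[THEN units_integers] and [simp] = y[THEN units_nonzero]
  define d where "d = z * x + y * a"
  have d: "d \<in> \<U>"
    using m by (simp add: d_def y_def)
  note m' = m' d d[THEN units_integers] and [simp] = d[THEN units_nonzero]
  have dd: "z * x - - (a + x * b) * a = d"
    by (simp only: d_def y_def mult_minus_left diff_minus_eq_add)
  have P0: "z + a * b - u / d * (z * x - - (a + x * b) * a) \<in> \<P>"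
    unfolding dd by (simp add: u_def[symmetric] max_ideal_0)
  have TO: "u / d \<in> \<O>"
    by (rule m' closure_rules)+
  have E3: "1 - (z / u) = a * b / u"
    by (simp add: field_rules, use u_def y_def d_def in algebra)
  have E4: "1 - (a * z / (y * u)) = b * d / (y * u)"
    by (simp add: field_rules, use u_def y_def d_def in algebra)
  have E5: "(z / u) - (a * z / (y * u)) = z * x * b / (u * y)"
    by (simp add: field_rules, use u_def y_def d_def in algebra)
  show ?case
    unfolding S1_def F2_def Ounits1_iff
    by (intro conjI; (rule integrand_eqI(1)[OF chi_eqI[of _ _ "a * b / u" "0"]
        Phi_C1_units[OF m(1,2,3,4) refl TO P0]])?; (simp only: u_def[symmetric] y_def[symmetric] d_def[symmetric] E3 E4 E5)?;
      (((rule m' closure_rules)+; fail) |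
      (simp add: field_rules; fail)))
next
  case (2 z x b a)
  then have m: "z \<in> \<U>" "1 - z \<in> \<U>" "x \<in> \<U>" "b \<in> \<U>" "a \<in> \<U>" "1 - a \<in> \<U>"
      "z - a \<in> \<U>"
    by (auto simp: Ounits1_iff)
  note m' = m m(1,2,3,4,5,6,7)[THEN units_integers] and [simp] = m(1,3,4,5)[THEN units_nonzero]
  define v where "v = 1 - z"
  have v: "v \<in> \<U>"
    using m by (simp add: v_def)
  note m' = m' v v[THEN units_integers] and [simp] = v[THEN units_nonzero]
  define t where "t = 1 - a"
  have t: "t \<in> \<U>"
    using m by (simp add: t_def)
  note m' = m' t t[THEN units_integers] and [simp] = t[THEN units_nonzero]
  define r where "r = z - a"
  have r: "r \<in> \<U>"
    using m by (simp add: r_def)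
  note m' = m' r r[THEN units_integers] and [simp] = r[THEN units_nonzero]
  have E3: "(v / (x * b * a)) + (- v / (z * b)) * (- v / (x * a)) = v / (x * a * b * z)"
    by (simp add: field_rules, use v_def t_def r_def in algebra)
  have E4: "(- v / (z * b)) + (x * r / (b * z)) * (- v / (x * a)) = - v / (b * a)"
    by (simp add: field_rules, use v_def t_def r_def in algebra)
  have E5: "(v / (x * b * a)) * (x * r / (b * z)) + (- v / (b * a)) * (- v / (z * b)) = v * t / (a * b ^ 2 * z)"
    by (simp add: field_rules, use v_def t_def r_def in algebra)
  show ?case
    by (intro conjI; (simp only: v_def[symmetric] t_def[symmetric] r_def[symmetric] E3 E4 E5)?;
      (((rule m' closure_rules)+; fail) |
      (simp add: field_rules; fail)))
qed ((intro region_rules)?;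
    (rule loc_subset[OF loc_F2])?; auto simp: Ounits1_iff intro!: units_intros intro: O_rules)+

text \<open>The entries \<open>s\<close>, \<open>r\<close> and the corner fix three variables, and
  the quantity confined to \<open>\<P>\<close> by the case distinction is stored in the dummy
  slot.\<close>

lemma J_T8:
  "\<forall>\<^sub>F n in sequentially. J n (\<lambda>z x b a. ((box \<U> \<U> \<U> \<U> z x b a \<and> z + a * b \<in> \<U>) \<and> a + x * b \<in> \<U>) \<and> z * x + (a + x * b) * a \<in> \<P>) (S1 (t4M w) (w ^ 3)) =
    J n (box (Ounits1 ord) \<U> \<U> \<P>) F8"
proof (rule J_subst_eventually[where
      kz = "\<lambda>z x b a. z / ((a + x * b) * b)" and kx = "\<lambda>z x b a. - (a + x * b) / z" and
      kb = "\<lambda>z x b a. b / z" and ka = "\<lambda>z x b a. z * x + (a + x * b) * a" and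
      lz = "\<lambda>z x b a. - 1 / (z * x * b)" and
      lx = "\<lambda>z x b a. - (1 - z ^ 2 * b ^ 2 * a) * x / (b * (1 - z))" and
      lb = "\<lambda>z x b a. - 1 / (z * x)" and
      la = "\<lambda>z x b a. - (1 - z * b ^ 2 * a) / (b * (1 - z))"],
    goal_cases)
  case (1 z x b a)
  then have m: "z \<in> \<U>" "x \<in> \<U>" "b \<in> \<U>" "a \<in> \<U>" "z + a * b \<in> \<U>" "a + x * b \<in> \<U>"
      "z * x + (a + x * b) * a \<in> \<P>"
    by auto
  note m' = m m(1,2,3,4,5,6)[THEN units_integers] m(7)[THEN max_ideal_integers] and [simp] = m(1,2,3,4)[THEN units_nonzero]
  define u where "u = z + a * b"
  have u: "u \<in> \<U>"
    using m by (simp add: u_def)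
  note m' = m' u u[THEN units_integers] and [simp] = u[THEN units_nonzero]
  define y where "y = a + x * b"
  have y: "y \<in> \<U>"
    using m by (simp add: y_def)
  note m' = m' y y[THEN units_integers] and [simp] = y[THEN units_nonzero]
  define d where "d = z * x + y * a"
  have d: "d \<in> \<P>"
    using m by (simp add: d_def y_def)
  note m' = m' d d[THEN max_ideal_integers]
  \<comment> \<open>\<open>e\<close> equals \<open>x * (y * b - z)\<close>; being
    \<open>y ^ 2\<close> modulo \<open>\<P>\<close>, it shows that \<open>1 - z / (y * b)\<close> is
    a unit.\<close>
  define e where "e = y ^ 2 - d"
  have e: "e \<in> \<U>"
    unfolding e_def by (rule m' closure_rules)+
  note m' = m' e e[THEN units_integers] and [simp] = e[THEN units_nonzero]
  have Pd: "z * x - - (a + x * b) * a \<in> \<P>"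
    using m by (simp only: mult_minus_left diff_minus_eq_add)
  have E4: "1 - (z / (y * b)) = e / (x * y * b)"
    by (simp add: field_rules, use e_def y_def d_def in algebra)
  show ?case
    unfolding S1_def F8_def Ounits1_iff
    by (intro conjI; (rule integrand_eqI(1)[OF chi_eqI[of _ _ "1" "- b * d / (y * z)"]
        Phi_T8[OF m(1,2,3,4) refl Pd]])?; (simp only: u_def[symmetric] y_def[symmetric] d_def[symmetric] e_def[symmetric] E4)?;
      (((rule m' closure_rules)+; fail) |
      (simp add: field_rules; fail) |
      (simp add: field_rules, use e_def y_def d_def in algebra)))
next
  case (2 z x b a)
  then have m: "z \<in> \<U>" "1 - z \<in> \<U>" "x \<in> \<U>" "b \<in> \<U>" "a \<in> \<P>"
    by (auto simp: Ounits1_iff)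
  note m' = m m(1,2,3,4)[THEN units_integers] m(5)[THEN max_ideal_integers] and [simp] = m(1,3,4)[THEN units_nonzero]
  define v where "v = 1 - z"
  have v: "v \<in> \<U>"
    using m by (simp add: v_def)
  note m' = m' v v[THEN units_integers] and [simp] = v[THEN units_nonzero]
  have E1: "(- (1 - z * b ^ 2 * a) / (b * v)) + (- (1 - z ^ 2 * b ^ 2 * a) * x / (b * v)) * (- 1 / (z * x)) = 1 / (z * b)"
    by (simp add: field_rules, use v_def in algebra)
  have E2: "(- 1 / (z * x * b)) + (- (1 - z * b ^ 2 * a) / (b * v)) * (- 1 / (z * x)) = (1 - b ^ 2 * a) / (x * b * v)"
    by (simp add: field_rules, use v_def in algebra)
  have E3: "(- 1 / (z * x * b)) * (- (1 - z ^ 2 * b ^ 2 * a) * x / (b * v)) + (1 / (z * b)) * (- (1 - z * b ^ 2 * a) / (b * v)) = a"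
    by (simp add: field_rules, use v_def in algebra)
  show ?case
    by (intro conjI; (simp only: v_def[symmetric] E1 E2 E3)?;
      (((rule m' closure_rules)+; fail) |
      (simp add: field_rules; fail)))
qed ((intro region_rules)?;
    (rule loc_subset[OF loc_F8])?; auto simp: Ounits1_iff intro!: units_intros intro: O_rules)+

text \<open>The new \<open>x * z - b ^ 2\<close> is the old \<open>(z + a * b) / x\<close>, so the
  unit condition carries over. The dummy slot stores \<open>a + x * b\<close>.\<close>

lemma J_C1_max_ideal:
  "\<forall>\<^sub>F n in sequentially. J n (\<lambda>z x b a. (box \<O> \<U> \<U> \<U> z x b a \<and> z + a * b \<in> \<U>) \<and> a + x * b \<in> \<P>) (S1 (t4M w) (w ^ 3)) =
    J n (\<lambda>z x b a. box \<O> \<U> \<U> \<P> z x b a \<and> x * z - b ^ 2 \<in> \<U>) (S1' (w ^ 3))"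
proof (rule J_subst_eventually[where
      kz = "\<lambda>z x b a. z + a * (a + x * b) / x" and kx = "\<lambda>z x b a. 1 / x" and
      kb = "\<lambda>z x b a. - a / x" and ka = "\<lambda>z x b a. a + x * b" and
      lz = "\<lambda>z x b a. z + a * b" and lx = "\<lambda>z x b a. 1 / x" and
      lb = "\<lambda>z x b a. b + x * a" and la = "\<lambda>z x b a. - b / x"],
    goal_cases)
  case (1 z x b a)
  then have m: "z \<in> \<O>" "x \<in> \<U>" "b \<in> \<U>" "a \<in> \<U>" "z + a * b \<in> \<U>" "a + x * b \<in> \<P>"
    by auto
  note m' = m m(2,3,4,5)[THEN units_integers] m(6)[THEN max_ideal_integers] and [simp] = m(2,3,4)[THEN units_nonzero]
  define u where "u = z + a * b"
  have u: "u \<in> \<U>"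
    using m by (simp add: u_def)
  note m' = m' u u[THEN units_integers] and [simp] = u[THEN units_nonzero]
  define y where "y = a + x * b"
  have y: "y \<in> \<P>"
    using m by (simp add: y_def)
  note m' = m' y y[THEN max_ideal_integers]
  have AP: "- (a + x * b) \<in> \<P>"
    by (rule m' closure_rules)+
  have E2: "(1 / x) * (z + a * y / x) - (- a / x) ^ 2 = u / x"
    by (simp add: u_def y_def field_rules)
  show ?case
    unfolding S1_def S1'_def
    by (intro conjI; (rule integrand_eqI(2)[OF chi_eqI[of _ _ "a / x" "- (a + x * b) / a"]
        Phi_C1_max_ideal[OF Sp4_generators(1)[OF w_nonzero] m(2) AP]])?; (simp only: u_def[symmetric] y_def[symmetric] E2)?;
      (((rule m' closure_rules)+; fail) |
      (simp add: y_def field_rules; fail)))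
next
  case (2 z x b a)
  then have m: "z \<in> \<O>" "x \<in> \<U>" "b \<in> \<U>" "a \<in> \<P>" "x * z - b ^ 2 \<in> \<U>"
    by auto
  note m' = m m(2,3,5)[THEN units_integers] m(4)[THEN max_ideal_integers] and [simp] = m(2,3)[THEN units_nonzero]
  define v where "v = x * z - b ^ 2"
  have v: "v \<in> \<U>"
    using m by (simp add: v_def)
  note m' = m' v v[THEN units_integers] and [simp] = v[THEN units_nonzero]
  have E1: "(z + a * b) + (- b / x) * (b + x * a) = v / x"
    by (simp add: v_def field_rules)
  have E2: "(- b / x) + (1 / x) * (b + x * a) = a"
    by (simp add: field_rules)
  show ?case
    by (intro conjI; (simp only: v_def[symmetric] E1 E2)?;
      (((rule m' closure_rules)+; fail) |
      (simp add: field_rules; fail)))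
qed ((intro region_rules)?;
    (rule loc_subset[OF loc_S1'])?; auto intro!: units_intros intro: O_rules)+

lemma J_T3:
  "\<forall>\<^sub>F n in sequentially. J n (\<lambda>z x b a. box \<U> \<U> \<U> \<O> z x b a \<and> x * z - b ^ 2 \<in> \<U>) (S1' (w ^ 3)) =
    J n (box (Ounits1 ord) \<U> \<U> \<O>) F3"
proof (rule J_subst_eventually[where
      kz = "\<lambda>z x b a. 1 - x * z / b ^ 2" and kx = "\<lambda>z x b a. - 1 / z" and
      kb = "\<lambda>z x b a. b / z" and ka = "\<lambda>z x b a. a" and lz = "\<lambda>z x b a. - 1 / x" and
      lx = "\<lambda>z x b a. - (1 - z) * b ^ 2 / x" and lb = "\<lambda>z x b a. - b / x" and
      la = "\<lambda>z x b a. a"],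
    goal_cases)
  case (1 z x b a)
  then have m: "z \<in> \<U>" "x \<in> \<U>" "b \<in> \<U>" "a \<in> \<O>" "x * z - b ^ 2 \<in> \<U>"
    by auto
  note m' = m m(1,2,3,5)[THEN units_integers] and [simp] = m(1,2,3)[THEN units_nonzero]
  define u where "u = x * z - b ^ 2"
  have u: "u \<in> \<U>"
    using m by (simp add: u_def)
  note m' = m' u u[THEN units_integers] and [simp] = u[THEN units_nonzero]
  have E1: "1 - x * z / b ^ 2 = - u / b ^ 2"
    by (simp add: u_def field_rules)
  have E2: "1 - (- u / b ^ 2) = x * z / b ^ 2"
    by (simp add: u_def field_rules)
  show ?case
    unfolding S1'_def F3_def Ounits1_iff
    by (intro conjI; (rule integrand_eqI(1)[OF chi_eqI[of _ _ "x / b" "0"]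
        Phi_T3[OF m(1) m(2)[THEN units_integers] m(3)]])?; (simp only: u_def[symmetric] E1 E2)?;
      (((rule m' closure_rules)+; fail) |
      (simp add: u_def field_rules; fail)))
next
  case (2 z x b a)
  then have m: "z \<in> \<U>" "1 - z \<in> \<U>" "x \<in> \<U>" "b \<in> \<U>" "a \<in> \<O>"
    by (auto simp: Ounits1_iff)
  note m' = m m(1,2,3,4)[THEN units_integers] and [simp] = m(1,3,4)[THEN units_nonzero]
  define v where "v = 1 - z"
  have v: "v \<in> \<U>"
    using m by (simp add: v_def)
  note m' = m' v v[THEN units_integers] and [simp] = v[THEN units_nonzero]
  have E1: "(- v * b ^ 2 / x) * (- 1 / x) - (- b / x) ^ 2 = - z * b ^ 2 / x ^ 2"
    by (simp add: v_def field_rules)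
  show ?case
    by (intro conjI; (simp only: v_def[symmetric] E1)?;
      (((rule m' closure_rules)+; fail) |
      (simp add: v_def field_rules; fail)))
qed ((intro region_rules)?;
    (rule loc_subset[OF loc_F3])?; auto simp: Ounits1_iff intro!: units_intros intro: O_rules)+

text \<open>With \<open>u = b ^ 2 - x * z * w\<close>, the entry \<open>t\<close> is
  \<open>- u / z\<close> over \<open>w ^ 2\<close>. This dictates \<open>kx\<close>, and the corner
  then gives \<open>1 - kz * w = u / b ^ 2\<close>.\<close>

lemma J_T6:
  "\<forall>\<^sub>F n in sequentially. J n (box \<U> \<U> \<U> \<O>) (S1' (w ^ 2)) =
    J n (box \<U> \<U> \<U> \<O>) F6"
proof (rule J_subst_eventually[where
      kz = "\<lambda>z x b a. x * z / b ^ 2" and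
      kx = "\<lambda>z x b a. - (b ^ 2) / (z * (b ^ 2 - x * z * w))" and kb = "\<lambda>z x b a. b / z" and
      ka = "\<lambda>z x b a. a" and lz = "\<lambda>z x b a. - 1 / (x * (1 - z * w))" and
      lx = "\<lambda>z x b a. - z * b ^ 2 / (x * (1 - z * w))" and
      lb = "\<lambda>z x b a. - b / (x * (1 - z * w))" and la = "\<lambda>z x b a. a"],
    goal_cases)
  case (1 z x b a)
  then have m: "z \<in> \<U>" "x \<in> \<U>" "b \<in> \<U>" "a \<in> \<O>"
    by auto
  note m' = m m(1,2,3)[THEN units_integers] and [simp] = m(1,2,3)[THEN units_nonzero]
  define u where "u = b ^ 2 - x * z * w"
  have u: "u \<in> \<U>"
    unfolding u_def by (rule m' closure_rules)+
  note m' = m' u u[THEN units_integers] and [simp] = u[THEN units_nonzero]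
  have E1: "1 - (x * z / b ^ 2) * w = u / b ^ 2"
    by (simp add: u_def field_rules)
  show ?case
    unfolding S1'_def F6_def
    by (intro conjI; (rule integrand_eqI(1)[OF chi_eqI[of _ _ "x / b" "x * z * w / u"]
        Phi_T6[OF m(1) m(2)[THEN units_integers] m(3)]])?; (simp only: u_def[symmetric] E1)?;
      (((rule m' closure_rules)+; fail) |
      (simp add: field_rules; fail) |
      (simp add: field_rules, use u_def in algebra)))
next
  case (2 z x b a)
  then have m: "z \<in> \<U>" "x \<in> \<U>" "b \<in> \<U>" "a \<in> \<O>"
    by auto
  note m' = m m(1,2,3)[THEN units_integers] and [simp] = m(1,2,3)[THEN units_nonzero]
  define v where "v = 1 - z * w"
  have v: "v \<in> \<U>"
    unfolding v_def by (rule m' closure_rules)+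
  note m' = m' v v[THEN units_integers] and [simp] = v[THEN units_nonzero]
  have E1: "(- b / (x * v)) ^ 2 - (- z * b ^ 2 / (x * v)) * (- 1 / (x * v)) * w = b ^ 2 / (x ^ 2 * v)"
    by (simp add: field_rules, use v_def in algebra)
  show ?case
    by (intro conjI; (simp only: v_def[symmetric] E1)?;
      (((rule m' closure_rules)+; fail) |
      (simp add: field_rules; fail)))
qed ((intro region_rules)?;
    (rule loc_subset[OF loc_F6])?; auto intro!: units_den units_intros intro: O_rules)+

lemma J_T9:
  "\<forall>\<^sub>F n in sequentially. J n (box \<U> \<U> \<U> \<O>) (S1' w) =
    J n (box \<U> \<U> \<U> \<O>) F9"
proof (rule J_subst_eventually[where
      kz = "\<lambda>z x b a. - (b ^ 2) / z" and kx = "\<lambda>z x b a. - x / b ^ 2" and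
      kb = "\<lambda>z x b a. - 1 / b" and ka = "\<lambda>z x b a. a" and
      lz = "\<lambda>z x b a. - 1 / (b ^ 2 * z)" and lx = "\<lambda>z x b a. - x / b ^ 2" and
      lb = "\<lambda>z x b a. - 1 / b" and la = "\<lambda>z x b a. a"],
    goal_cases)
  case (1 z x b a)
  then have m: "z \<in> \<U>" "x \<in> \<U>" "b \<in> \<U>" "a \<in> \<O>"
    by auto
  note m' = m m(1,2,3)[THEN units_integers] and [simp] = m(1,2,3)[THEN units_nonzero]
  show ?case
    unfolding S1'_def F9_def
    by (intro conjI; (rule integrand_eqI(1)[OF chi_eqI[of _ _ "x / b" "0"]
        Phi_T9[OF m(1) m(2)[THEN units_integers] m(3)]])?;
      (((rule m' closure_rules)+; fail) |
      (simp add: field_rules; fail)))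
next
  case (2 z x b a)
  then have m: "z \<in> \<U>" "x \<in> \<U>" "b \<in> \<U>" "a \<in> \<O>"
    by auto
  note m' = m m(1,2,3)[THEN units_integers] and [simp] = m(1,2,3)[THEN units_nonzero]
  show ?case
    by (intro conjI;
      (((rule m' closure_rules)+; fail) |
      (simp add: field_rules; fail)))
qed ((intro region_rules)?;
    (rule loc_subset[OF loc_F9])?; auto intro!: units_intros intro: O_rules)+

text \<open>For integral \<open>z\<close> the corner of the source no longer matters, so
  \<open>z\<close> itself becomes a dummy of the two-variable target.\<close>

lemma J_T10:
  "\<forall>\<^sub>F n in sequentially. J n (box \<O> \<U> \<U> \<O>) (S1' 1) =
    J n (box \<U> \<U> \<O> \<O>) F10"
proof (rule J_subst_eventually[where
      kz = "\<lambda>z x b a. - x / b ^ 2" and kx = "\<lambda>z x b a. - 1 / b" and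
      kb = "\<lambda>z x b a. z" and ka = "\<lambda>z x b a. a" and lz = "\<lambda>z x b a. b" and
      lx = "\<lambda>z x b a. - z / x ^ 2" and lb = "\<lambda>z x b a. - 1 / x" and
      la = "\<lambda>z x b a. a"],
    goal_cases)
  case (1 z x b a)
  then have m: "z \<in> \<O>" "x \<in> \<U>" "b \<in> \<U>" "a \<in> \<O>"
    by auto
  note m' = m m(2,3)[THEN units_integers] and [simp] = m(2,3)[THEN units_nonzero]
  show ?case
    unfolding S1'_def F10_def
    by (intro conjI; (rule integrand_eqI(1)[OF chi_eqI[of _ _ "x / b" "0"]
        Phi_T10[OF m(1) m(2)[THEN units_integers] m(3)]])?;
      (((rule m' closure_rules)+; fail) |
      (simp add: field_rules; fail)))
next
  case (2 z x b a)
  then have m: "z \<in> \<U>" "x \<in> \<U>" "b \<in> \<O>" "a \<in> \<O>"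
    by auto
  note m' = m m(1,2)[THEN units_integers] and [simp] = m(1,2)[THEN units_nonzero]
  show ?case
    by (intro conjI;
      (((rule m' closure_rules)+; fail) |
      (simp add: field_rules; fail)))
qed ((intro region_rules)?;
    (rule loc_subset[OF loc_F10])?; auto intro!: units_intros intro: O_rules)+

end

section \<open>Rescaling variables and splitting by units\<close>

context local_field
begin

lemma scale_z:
  assumes S: "\<And>z x b a. S z x b a \<longleftrightarrow> z \<in> \<O> \<and> Q x b a" and T: "\<And>z x b a. T z x b a \<longleftrightarrow> z \<in> \<P> \<and> Q x b a"
    and "region S" "loc S (\<lambda>z x b a. f (w * z) x b a)"
  shows "\<forall>\<^sub>F n in sequentially. J n T f = (1 / real q) *\<^sub>R J n S (\<lambda>z x b a. f (w * z) x b a)"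
  using J_scale_eventually[OF assms(3,4)]
proof eventually_elim
  case (elim n)
  have "J n T f = J n (\<lambda>z x b a. z \<in> \<P> \<and> S (z / w) x b a) (\<lambda>z x b a. f (w * (z / w)) x b a)"
    by (rule J_cong) (auto simp: S T max_ideal_divide_w)
  then show ?case using elim by simp
qed

lemma region_swap: "region S \<Longrightarrow> region (\<lambda>z x b a. S x z b a)"
  "region S \<Longrightarrow> region (\<lambda>z x b a. S a x b z)"
  unfolding region_def cg_region_def by blast+

lemma loc_swap: "loc S f \<Longrightarrow> loc (\<lambda>z x b a. S x z b a) (\<lambda>z x b a. f x z b a)"
  "loc S f \<Longrightarrow> loc (\<lambda>z x b a. S a x b z) (\<lambda>z x b a. f a x b z)"
  unfolding loc_def cg_fun_def by blast+

lemma scale_x: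
  assumes "\<And>z x b a. S z x b a \<longleftrightarrow> x \<in> \<O> \<and> Q z b a" "\<And>z x b a. T z x b a \<longleftrightarrow> x \<in> \<P> \<and> Q z b a"
    and "region S" "loc S (\<lambda>z x b a. f z (w * x) b a)"
  shows "\<forall>\<^sub>F n in sequentially. J n T f = (1 / real q) *\<^sub>R J n S (\<lambda>z x b a. f z (w * x) b a)"
  using scale_z[of "\<lambda>z x b a. S x z b a" Q "\<lambda>z x b a. T x z b a" "\<lambda>z x b a. f x z b a",
      OF assms(1,2) region_swap(1)[OF assms(3)] loc_swap(1)[OF assms(4)]]
  by (simp only: J_swap[of _ S "\<lambda>z x b a. f z (w * x) b a"] J_swap[of _ T f])

lemma scale_a:
  assumes "\<And>z x b a. S z x b a \<longleftrightarrow> a \<in> \<O> \<and> Q x b z" "\<And>z x b a. T z x b a \<longleftrightarrow> a \<in> \<P> \<and> Q x b z"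
    and "region S" "loc S (\<lambda>z x b a. f z x b (w * a))"
  shows "\<forall>\<^sub>F n in sequentially. J n T f = (1 / real q) *\<^sub>R J n S (\<lambda>z x b a. f z x b (w * a))"
  using scale_z[of "\<lambda>z x b a. S a x b z" Q "\<lambda>z x b a. T a x b z" "\<lambda>z x b a. f a x b z",
      OF assms(1,2) region_swap(2)[OF assms(3)] loc_swap(2)[OF assms(4)]]
  by (simp only: J_swap_last[of _ S "\<lambda>z x b a. f z x b (w * a)"] J_swap_last[of _ T f])

lemma J_split_units:
  assumes "\<And>z x b a. S z x b a \<Longrightarrow> e z x b a \<in> \<O>"
  shows "J n S f = J n (\<lambda>z x b a. S z x b a \<and> e z x b a \<in> \<U>) f + J n (\<lambda>z x b a. S z x b a \<and> e z x b a \<in> \<P>) f"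
proof -
  have "J n (\<lambda>z x b a. S z x b a \<and> \<not> e z x b a \<in> \<U>) f = J n (\<lambda>z x b a. S z x b a \<and> e z x b a \<in> \<P>) f"
    using assms by (intro J_cong) (auto simp: units_iff)
  then show ?thesis using J_split[of n S f "\<lambda>z x b a. e z x b a \<in> \<U>"] by simp
qed

end

section \<open>The operator and the fourteen terms as averages\<close>

context unramified_vector
begin

lemma rho_inverse:
  assumes "M \<in> Sp4" obtains M' where "\<And>u. rho M' (rho M u) = u"
proof -
  define M' where "M' = (- Jp) ** transpose M ** Jp"
  have M': "M' ** M = mat 1" "M ** M' = mat 1"
    using Sp4_inverse[OF assms] by (simp_all add: M'_def)
  then have "M' \<in> Sp4" using Sp4_factor[OF assms, of M'] Sp4_generators(8)[OF w_nonzero] by simp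
  then have "rho M' (rho M u) = u" for u using rho_mult[OF _ assms, of M' u] rho_1 M' by simp
  then show ?thesis using that by blast
qed

text \<open>Local constancy is only known for the integrand \<open>F\<close> with the outer matrix
  pulled inside. It transfers back to \<open>f\<close> because \<open>rho M\<close> is injective,
  and then \<open>rho M\<close>, being linear, commutes with the finite average.\<close>

lemma integ_rho:
  fixes f :: "'f \<Rightarrow> 'f \<Rightarrow> 'f \<Rightarrow> 'f \<Rightarrow> 'v"
  assumes "M \<in> Sp4" and c: "cg_set A" "cg_set B" "cg_set C" "cg_set D" and F: "loc (box A B C D) F"
    and f: "\<And>z x b a. z \<in> A \<Longrightarrow> x \<in> B \<Longrightarrow> b \<in> C \<Longrightarrow> a \<in> D \<Longrightarrow> rho M (f z x b a) = F z x b a"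
  shows "\<forall>\<^sub>F n in sequentially.
    rho M (integ ord A (\<lambda>z. integ ord B (\<lambda>x. integ ord C (\<lambda>b. integ ord D (\<lambda>a. f z x b a))))) = J n (box A B C D) F"
  using loc_eventually[OF F] eventually_ge_at_top[of 1]
proof eventually_elim
  case (elim n)
  obtain M' where M': "\<And>u. rho M' (rho M u) = u" using rho_inverse[OF assms(1)] by blast
  have f': "f z x b a = rho M' (F z x b a)" if "box A B C D z x b a" for z x b a
    using M'[of "f z x b a"] f that by metis
  have "cg_fun n (box A B C D) f"
    unfolding cg_fun_def
  proof (intro allI impI)
    fix z x b a z' x' b' a'
    assume *: "box A B C D z x b a" "cg n z z'" "cg n x x'" "cg n b b'" "cg n a a'"
    then have "box A B C D z' x' b' a'" using elim(2) cg_setD c by meson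
    then show "f z x b a = f z' x' b' a'"
      using * f' cg_funD[OF elim(1) *] by metis
  qed
  then have "rho M (integ ord A (\<lambda>z. integ ord B (\<lambda>x. integ ord C (\<lambda>b. integ ord D (\<lambda>a. f z x b a))))) =
      J n (box A B C D) (\<lambda>z x b a. rho M (f z x b a))"
    by (simp only: integ_box[OF c elim(2)] J_linear[OF rho_linear[OF assms(1)]])
  also have "\<dots> = J n (box A B C D) F"
    by (rule J_cong) (auto simp: f)
  finally show ?case .
qed

lemma integ_rho3:
  fixes f :: "'f \<Rightarrow> 'f \<Rightarrow> 'f \<Rightarrow> 'v"
  assumes "M \<in> Sp4" and c: "cg_set A" "cg_set B" "cg_set C" and F: "loc (box A B C \<O>) F"
    and f: "\<And>z x b a. z \<in> A \<Longrightarrow> x \<in> B \<Longrightarrow> b \<in> C \<Longrightarrow> rho M (f z x b) = F z x b a"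
  shows "\<forall>\<^sub>F n in sequentially.
    rho M (integ ord A (\<lambda>z. integ ord B (\<lambda>x. integ ord C (\<lambda>b. f z x b)))) = J n (box A B C \<O>) F"
  using integ_rho[OF assms(1) c cg_set_integers F, of "\<lambda>z x b a. f z x b"] f by (simp add: integ_const)

lemma integ_rho2:
  fixes f :: "'f \<Rightarrow> 'f \<Rightarrow> 'v"
  assumes "M \<in> Sp4" and c: "cg_set A" "cg_set B" and F: "loc (box A B \<O> \<O>) F"
    and f: "\<And>z x b a. z \<in> A \<Longrightarrow> x \<in> B \<Longrightarrow> rho M (f z x) = F z x b a"
  shows "\<forall>\<^sub>F n in sequentially.
    rho M (integ ord A (\<lambda>z. integ ord B (\<lambda>x. f z x))) = J n (box A B \<O> \<O>) F"
  using integ_rho3[OF assms(1) c cg_set_integers F, of "\<lambda>z x b. f z x"] f by (simp add: integ_const)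

lemma rho_scaleR: "M \<in> Sp4 \<Longrightarrow> g \<in> Sp4 \<Longrightarrow> rho M (c *\<^sub>R rho g v) = c *\<^sub>R Phi (M ** g)"
  by (simp add: linear_cmul[OF rho_linear] rho_mult)

lemma integ_J:
  fixes f :: "'f \<Rightarrow> 'f \<Rightarrow> 'f \<Rightarrow> 'f \<Rightarrow> 'v"
  assumes "cg_set A" "cg_set B" "cg_set C" "cg_set D" and "loc (box A B C D) F"
    and "\<And>z x b a. z \<in> A \<Longrightarrow> x \<in> B \<Longrightarrow> b \<in> C \<Longrightarrow> a \<in> D \<Longrightarrow> f z x b a = F z x b a"
  shows "\<forall>\<^sub>F n in sequentially.
    integ ord A (\<lambda>z. integ ord B (\<lambda>x. integ ord C (\<lambda>b. integ ord D (\<lambda>a. f z x b a)))) = J n (box A B C D) F"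
  using integ_rho[OF Sp4_generators(8)[OF w_nonzero] assms(1-5), of f] assms(6) by (simp add: rho_1)

lemma eventually_scaleR_eq: "\<forall>\<^sub>F n in F. x = X n \<Longrightarrow> \<forall>\<^sub>F n in F. c *\<^sub>R x = c *\<^sub>R X n"
  and eventually_add_eq: "\<forall>\<^sub>F n in F. x = X n \<Longrightarrow> \<forall>\<^sub>F n in F. y = Y n \<Longrightarrow> \<forall>\<^sub>F n in F. x + y = X n + Y n"
  for x y :: "'a::real_vector"
  by (auto elim: eventually_mono eventually_elim2)

lemma iwa_cong: "d = d' \<Longrightarrow> e = e' \<Longrightarrow> s = s' \<Longrightarrow> r = r' \<Longrightarrow> u = u' \<Longrightarrow> t = t' \<Longrightarrow>
    c *\<^sub>R Phi (iwa d e s r u t) = c *\<^sub>R Phi (iwa d' e' s' r' u' t')"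
  by simp

lemmas iwa_products = rho_scaleR Sp4_generators Sp4_mult w_nonzero iwa_Sp4 one_neq_zero not_False_eq_True
  YM_iwa etaM_iwa tauM_iwa matrix_inv_tauM_iwa matrix_mul_assoc[symmetric] matrix_mul_lid

lemma T1_J: "\<forall>\<^sub>F n in sequentially. T1 ord w q chi rho v = real q ^ 2 *\<^sub>R J n (box \<O> \<U> \<U> \<U>) F1"
  unfolding T1_def
  by (rule eventually_scaleR_eq, rule integ_J;
    (intro cg_set_intros Sp4_generators Sp4_mult w_nonzero loc_F1; fail)?;
    (simp only: F1_def XM_YM, (simp only: iwa_products)?,
      rule iwa_cong; simp add: Ounits1_iff units_nonzero field_rules power_int_minus)?)+

text \<open>The corner simplifies because \<open>s r\<close> cancels the constant part of
  \<open>u\<close>: only \<open>- a * b * x / (1 - y)\<close> remains.\<close>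

lemma T2_J: "\<forall>\<^sub>F n in sequentially. T2 ord w q chi rho v = real q *\<^sub>R J n (box (Ounits1 ord) \<U> \<U> (Ounits1 ord)) F2"
  unfolding T2_def
  by (rule eventually_scaleR_eq, rule integ_rho;
    (intro cg_set_intros Sp4_generators Sp4_mult w_nonzero loc_F2; fail)?;
    (simp only: F2_def XM_YM, (simp only: iwa_products)?, rule iwa_cong;
      (simp add: Ounits1_iff units_nonzero field_rules power_int_minus; fail)?;
      simp add: Ounits1_iff units_nonzero power_int_minus divide_simps;
      simp add: algebra_simps power2_eq_square power3_eq_cube)?)+

lemma T11_J: "\<forall>\<^sub>F n in sequentially. T11 ord w q chi rho v = real q ^ 3 *\<^sub>R J n (box \<O> \<O> \<U> \<U>) F11"
  and T12_J: "\<forall>\<^sub>F n in sequentially. T12 ord w q chi rho v = real q ^ 2 *\<^sub>R J n (box (Ounits1 ord) \<O> \<U> \<U>) F12"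
  unfolding T11_def T12_def
  by (rule eventually_scaleR_eq, rule integ_rho;
    (intro cg_set_intros Sp4_generators Sp4_mult w_nonzero loc_F11 loc_F12; fail)?;
    (simp only: F11_def F12_def XM_YM, (simp only: iwa_products)?,
      rule iwa_cong; simp add: Ounits1_iff units_nonzero field_rules power_int_minus)?)+

lemma T3_J: "\<forall>\<^sub>F n in sequentially. T3 ord w chi rho v = J n (box (Ounits1 ord) \<U> \<U> \<O>) F3"
  and T4_J: "\<forall>\<^sub>F n in sequentially. T4 ord w q chi rho v = real q *\<^sub>R J n (box \<U> \<U> \<O> \<O>) F4"
  and T5_J: "\<forall>\<^sub>F n in sequentially. T5 ord w chi rho v = J n (box \<O> \<U> \<U> \<O>) F5"
  and T6_J: "\<forall>\<^sub>F n in sequentially. T6 ord w q chi rho v = inverse (real q) *\<^sub>R J n (box \<U> \<U> \<U> \<O>) F6"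
  and T7_J: "\<forall>\<^sub>F n in sequentially. T7 ord w q chi rho v = real q *\<^sub>R J n (box \<O> \<U> \<U> \<O>) F7"
  and T8_J: "\<forall>\<^sub>F n in sequentially. T8 ord w chi rho v = J n (box (Ounits1 ord) \<U> \<U> \<O>) F8"
  and T9_J: "\<forall>\<^sub>F n in sequentially. T9 ord w q chi rho v = inverse (real q ^ 2) *\<^sub>R J n (box \<U> \<U> \<U> \<O>) F9"
  and T13_J: "\<forall>\<^sub>F n in sequentially. T13 ord w chi rho v = J n (box \<U> \<U> \<U> \<O>) F13"
  and T14_J: "\<forall>\<^sub>F n in sequentially. T14 ord w q chi rho v = real q *\<^sub>R J n (box \<O> \<U> \<U> \<O>) F14"
  unfolding T3_def T4_def T5_def T6_def T7_def T8_def T9_def T13_def T14_def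
  by ((rule eventually_scaleR_eq)?, rule integ_rho3;
    (intro cg_set_intros Sp4_generators Sp4_mult w_nonzero loc_F3 loc_F4
      loc_F5 loc_F6 loc_F7 loc_F8 loc_F9 loc_F13 loc_F14; fail)?;
    (simp only: F3_def F4_def F5_def F6_def F7_def F8_def F9_def
      F13_def F14_def XM_YM, (simp only: iwa_products)?,
      rule iwa_cong; simp add: Ounits1_iff units_nonzero field_rules power_int_minus)?)+

lemma T10_J: "\<forall>\<^sub>F n in sequentially. T10 ord w q chi rho v = inverse (real q ^ 3) *\<^sub>R J n (box \<U> \<U> \<O> \<O>) F10"
  unfolding T10_def
  by (rule eventually_scaleR_eq, rule integ_rho2;
    (intro cg_set_intros Sp4_generators Sp4_mult w_nonzero loc_F10; fail)?;
    (simp only: F10_def XM_YM, (simp only: iwa_products)?,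
      rule iwa_cong; simp add: Ounits1_iff units_nonzero field_rules power_int_minus)?)+

text \<open>Writing \<open>x\<close> as \<open>w\<close> times an integer costs
  \<open>1 / q\<close>, and doing so twice costs \<open>1 / q ^ 2\<close>. The units of the first
  cell and the maximal ideal of the second fit together to a full range \<open>\<O>\<close> for
  \<open>S11\<close>.\<close>

lemma cells_J:
  assumes h: "h \<in> Sp4"
  shows "\<forall>\<^sub>F n in sequentially. J n (box \<O> \<O> \<U> \<U>) (cell_A h c) + J n (box \<O> \<P> \<U> \<U>) (cell_B h c) =
    (1 / real q) *\<^sub>R J n (box \<O> \<U> \<U> \<U>) (S1 h c) + (1 / real q ^ 2) *\<^sub>R J n (box \<O> \<O> \<U> \<U>) (S7 h c)
    + J n (box \<O> \<O> \<U> \<U>) (S11 h c)"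
proof -
  have r: "region (box \<O> \<O> \<U> \<U>)" by (intro region_box cg_set_intros)
  have 1: "\<forall>\<^sub>F n in sequentially. J n (box \<O> \<P> \<U> \<U>) (cell_A h c) =
      (1 / real q) *\<^sub>R J n (box \<O> \<O> \<U> \<U>) (\<lambda>z x b a. cell_A h c z (w * x) b a)"
    by (rule scale_x[where Q = "\<lambda>z b a. z \<in> \<O> \<and> b \<in> \<U> \<and> a \<in> \<U>", OF _ _ r])
      (auto intro: loc_cell_A_scaled h)
  have 2: "\<forall>\<^sub>F n in sequentially. J n (box \<O> \<P> \<U> \<U>) (\<lambda>z x b a. cell_A h c z (w * x) b a) =
      (1 / real q) *\<^sub>R J n (box \<O> \<O> \<U> \<U>) (\<lambda>z x b a. cell_A h c z (w * (w * x)) b a)"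
    by (rule scale_x[where Q = "\<lambda>z b a. z \<in> \<O> \<and> b \<in> \<U> \<and> a \<in> \<U>" and f = "\<lambda>z x b a. cell_A h c z (w * x) b a", OF _ _ r])
      (use loc_cell_A_scaled[OF h, where u = "w * w"] in \<open>auto simp: mult.assoc\<close>)
  show ?thesis
    using 1 2 J_cell_units[OF h, of c] J_cell_w2[OF h, of c]
  proof eventually_elim
    case (elim n)
    have A: "J n (box \<O> \<O> \<U> \<U>) f = J n (box \<O> \<U> \<U> \<U>) f + J n (box \<O> \<P> \<U> \<U>) f"
      for f :: "'f \<Rightarrow> 'f \<Rightarrow> 'f \<Rightarrow> 'f \<Rightarrow> 'v"
      unfolding J_split_units[of "box \<O> \<O> \<U> \<U>" "\<lambda>z x b a. x" n f, simplified]
      by (intro arg_cong2[of _ _ _ _ "(+)"] J_cong) (auto intro: units_integers max_ideal_integers)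
    have B: "J n (box \<O> \<P> \<U> \<U>) (cell_B h c) = J n (box \<O> \<P> \<U> \<U>) (S11 h c)"
      by (rule J_cong) (auto simp: cell_B_def S11_def Phi_cell_s1[OF h])
    have C: "J n (box \<O> \<U> \<U> \<U>) (\<lambda>z x b a. cell_A h c z (w * x) b a) = J n (box \<O> \<U> \<U> \<U>) (S1 h c)"
      by (rule J_cong) (auto simp: cell_A_def S1_def Phi_cell_w[OF h])
    have D: "(\<lambda>z x b a. cell_A h c z (w * (w * x)) b a) = (\<lambda>z x b a. cell_A h c z (w ^ 2 * x) b a)"
      by (simp add: power2_eq_square mult.assoc)
    show ?case
      unfolding A[of "cell_A h c"] elim(1) A[of "\<lambda>z x b a. cell_A h c z (w * x) b a"] B C elim(2,3) D elim(4)
        A[of "S11 h c"]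
      by (simp add: scaleR_add_right power2_eq_square)
  qed
qed

lemma Tchi_J: "\<forall>\<^sub>F n in sequentially. Tchi ord w q chi rho v =
    real q ^ 3 *\<^sub>R (J n (box \<O> \<O> \<U> \<U>) (cell_A (mat 1) (w ^ 4)) + J n (box \<O> \<P> \<U> \<U>) (cell_B (mat 1) (w ^ 4))) +
    real q ^ 2 *\<^sub>R (J n (box \<O> \<O> \<U> \<U>) (cell_A (t4M w) (w ^ 3)) + J n (box \<O> \<P> \<U> \<U>) (cell_B (t4M w) (w ^ 3)))"
proof -
  note sp = Sp4_generators[OF w_nonzero] Sp4_mult
  have powi: "z * w powi (-4) = z / w ^ 4" "z * w powi (-3) = z / w ^ 3" for z
    by (simp_all add: power_int_minus divide_inverse)
  show ?thesis
    unfolding Tchi_def scaleR_add_right add.assoc[symmetric]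
    by (intro eventually_add_eq eventually_scaleR_eq integ_J)
      (auto simp: rho_1 cell_A_def cell_B_def powi rho_mult sp intro!: cg_set_intros loc_cell_A loc_cell_B sp)
qed

end

section \<open>Assembling the half with \<open>t4\<close>\<close>

context local_field
begin

lemma scale_x_dummy:
  assumes "\<And>z x b a. S z x b a \<longleftrightarrow> x \<in> \<O> \<and> Q z b a" "\<And>z x b a. T z x b a \<longleftrightarrow> x \<in> \<P> \<and> Q z b a"
    and "region S" "loc S f" and f: "\<And>z x b a. f z (w * x) b a = f z x b a"
  shows "\<forall>\<^sub>F n in sequentially. J n T f = (1 / real q) *\<^sub>R J n S f"
  using scale_x[OF assms(1,2,3), of f] assms(4) by (simp add: f)

lemma scale_a_dummy:
  assumes "\<And>z x b a. S z x b a \<longleftrightarrow> a \<in> \<O> \<and> Q x b z" "\<And>z x b a. T z x b a \<longleftrightarrow> a \<in> \<P> \<and> Q x b z"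
    and "region S" "loc S f" and f: "\<And>z x b a. f z x b (w * a) = f z x b a"
  shows "\<forall>\<^sub>F n in sequentially. J n T f = (1 / real q) *\<^sub>R J n S f"
  using scale_a[OF assms(1,2,3), of f] assms(4) by (simp add: f)

lemma z_units: "a \<in> \<U> \<Longrightarrow> b \<in> \<U> \<Longrightarrow> z + a * b \<in> \<P> \<Longrightarrow> z \<in> \<U>"
  using units_max_ideal_diff[of "z + a * b" "a * b"] by (simp add: units_mult)

lemma sum_units: "z \<in> \<P> \<Longrightarrow> a \<in> \<U> \<Longrightarrow> b \<in> \<U> \<Longrightarrow> z + a * b \<in> \<U>"
  by (simp add: units_max_ideal_add units_mult)

text \<open>Of the four combinations for \<open>z\<close> and \<open>z + a * b\<close> only three
  occur: as \<open>a * b\<close> is a unit, both cannot lie in \<open>\<P>\<close>.\<close>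

lemma J_split_z: "J n (box \<O> \<O> \<U> \<U>) f = J n (\<lambda>z x b a. box \<U> \<O> \<U> \<U> z x b a \<and> z + a * b \<in> \<U>) f
    + J n (box \<P> \<O> \<U> \<U>) f + J n (\<lambda>z x b a. box \<U> \<O> \<U> \<U> z x b a \<and> z + a * b \<in> \<P>) f"
proof -
  have "J n (box \<O> \<O> \<U> \<U>) f = J n (\<lambda>z x b a. box \<O> \<O> \<U> \<U> z x b a \<and> z + a * b \<in> \<U>) f
      + J n (\<lambda>z x b a. box \<O> \<O> \<U> \<U> z x b a \<and> z + a * b \<in> \<P>) f"
    by (rule J_split_units) (auto intro: O_rules)
  moreover have "J n (\<lambda>z x b a. box \<O> \<O> \<U> \<U> z x b a \<and> z + a * b \<in> \<U>) f =
      J n (\<lambda>z x b a. (box \<O> \<O> \<U> \<U> z x b a \<and> z + a * b \<in> \<U>) \<and> z \<in> \<U>) f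
      + J n (\<lambda>z x b a. (box \<O> \<O> \<U> \<U> z x b a \<and> z + a * b \<in> \<U>) \<and> z \<in> \<P>) f"
    by (rule J_split_units) auto
  moreover have "J n (\<lambda>z x b a. (box \<O> \<O> \<U> \<U> z x b a \<and> z + a * b \<in> \<U>) \<and> z \<in> \<U>) f =
      J n (\<lambda>z x b a. box \<U> \<O> \<U> \<U> z x b a \<and> z + a * b \<in> \<U>) f"
    by (rule J_cong) (auto intro: O_rules)
  moreover have "J n (\<lambda>z x b a. (box \<O> \<O> \<U> \<U> z x b a \<and> z + a * b \<in> \<U>) \<and> z \<in> \<P>) f = J n (box \<P> \<O> \<U> \<U>) f"
    by (rule J_cong) (auto intro: O_rules sum_units)
  moreover have "J n (\<lambda>z x b a. box \<O> \<O> \<U> \<U> z x b a \<and> z + a * b \<in> \<P>) f =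
      J n (\<lambda>z x b a. box \<U> \<O> \<U> \<U> z x b a \<and> z + a * b \<in> \<P>) f"
    by (rule J_cong) (auto intro: O_rules z_units)
  ultimately show ?thesis by (simp only: add.assoc)
qed

end

context unramified_vector
begin

lemma S7_scale: "S7 h (w ^ 3) (w * z) x b a = S7 h (w ^ 2) z x b a"
  and S11_scale: "S11 h (w ^ 3) (w * z) x b a = S11 h (w ^ 2) z x b a"
  and S1_scale: "S1 h (w ^ 3) (w * z) x b a = S1 h (w ^ 2) z x b a"
  and S1'_scale: "S1' (w ^ 3) (w * z) x b a = S1' (w ^ 2) z x b a"
    "S1' (w ^ 2) (w * z) x b a = S1' w z x b a" "S1' w (w * z) x b a = S1' 1 z x b a"
  by (simp_all add: S7_def S11_def S1_def S1'_def power2_eq_square power3_eq_cube)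

lemmas t4M_Sp4 = Sp4_generators(1)[OF w_nonzero]

text \<open>Both factors \<open>1 / q\<close> have volume origin: one from \<open>z\<close> in
  \<open>\<P>\<close> rescaled towards T14, one from the dummy of T4 confined to
  \<open>\<P>\<close>.\<close>

lemma J_C11:
  "\<forall>\<^sub>F n in sequentially. J n (box \<O> \<O> \<U> \<U>) (S11 (t4M w) (w ^ 3)) =
    J n (box (Ounits1 ord) \<O> \<U> \<U>) F12 + (1 / real q) *\<^sub>R J n (box \<O> \<U> \<U> \<O>) F14
    + (1 / real q) *\<^sub>R J n (box \<U> \<U> \<O> \<O>) F4"
proof -
  have r: "region (box \<O> \<O> \<U> \<U>)" "region (box \<U> \<U> \<O> \<O>)" by (intro region_box cg_set_intros)+
  have 1: "\<forall>\<^sub>F n in sequentially. J n (box \<P> \<O> \<U> \<U>) (S11 (t4M w) (w ^ 3)) =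
      (1 / real q) *\<^sub>R J n (box \<O> \<O> \<U> \<U>) (\<lambda>z x b a. S11 (t4M w) (w ^ 3) (w * z) x b a)"
    by (rule scale_z[where Q = "\<lambda>x b a. x \<in> \<O> \<and> b \<in> \<U> \<and> a \<in> \<U>", OF _ _ r(1)])
      (auto simp: S11_scale intro: loc_S11 t4M_Sp4)
  have 2: "\<forall>\<^sub>F n in sequentially. J n (box \<U> \<U> \<O> \<P>) F4 = (1 / real q) *\<^sub>R J n (box \<U> \<U> \<O> \<O>) F4"
    by (rule scale_a_dummy[where Q = "\<lambda>x b z. z \<in> \<U> \<and> x \<in> \<U> \<and> b \<in> \<O>", OF _ _ r(2) loc_F4])
      (auto simp: F4_def)
  show ?thesis
    using 1 2 J_T14 J_T4 J_T12
  proof eventually_elim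
    case (elim n)
    show ?case
      unfolding J_split_z[of n "S11 (t4M w) (w ^ 3)"] elim(1) S11_scale elim(2-5) ..
  qed
qed

text \<open>\<open>S7\<close> ignores \<open>x\<close>, so its range may be shrunk to
  \<open>\<P>\<close> at the price of \<open>q\<close>. For T13 this cancels the
  \<open>1 / q\<close> from \<open>z\<close> in \<open>\<P>\<close>; for T2 the factor
  \<open>q\<close> remains; for T5 the full range is kept.\<close>

lemma J_C7:
  "\<forall>\<^sub>F n in sequentially. J n (box \<O> \<O> \<U> \<U>) (S7 (t4M w) (w ^ 3)) =
    real q *\<^sub>R J n (\<lambda>z x b a. box (Ounits1 ord) \<U> \<U> (Ounits1 ord) z x b a \<and> z - a \<in> \<P>) F2
    + J n (\<lambda>z x b a. box \<U> \<U> \<U> \<O> z x b a \<and> 1 - z \<in> \<P>) F13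
    + J n (\<lambda>z x b a. box \<O> \<U> \<U> \<O> z x b a \<and> z * b + x \<in> \<P>) F5"
proof -
  have r: "region (box \<O> \<O> \<U> \<U>)" "region (\<lambda>z x b a. box \<U> \<O> \<U> \<U> z x b a \<and> z + a * b \<in> \<U>)"
    by (intro region_conj region_box cg_set_intros lip_intros)+
  have d: "S7 h c z (w * x) b a = S7 h c z x b a" for h c z x b a by (simp add: S7_def)
  have 1: "\<forall>\<^sub>F n in sequentially. J n (box \<P> \<O> \<U> \<U>) (S7 (t4M w) (w ^ 3)) =
      (1 / real q) *\<^sub>R J n (box \<O> \<O> \<U> \<U>) (\<lambda>z x b a. S7 (t4M w) (w ^ 3) (w * z) x b a)"
    by (rule scale_z[where Q = "\<lambda>x b a. x \<in> \<O> \<and> b \<in> \<U> \<and> a \<in> \<U>", OF _ _ r(1)])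
      (auto simp: S7_scale intro: loc_S7 t4M_Sp4)
  have 2: "\<forall>\<^sub>F n in sequentially. J n (box \<O> \<P> \<U> \<U>) (S7 (t4M w) (w ^ 2)) =
      (1 / real q) *\<^sub>R J n (box \<O> \<O> \<U> \<U>) (S7 (t4M w) (w ^ 2))"
    by (rule scale_x_dummy[where Q = "\<lambda>z b a. z \<in> \<O> \<and> b \<in> \<U> \<and> a \<in> \<U>", OF _ _ r(1) loc_S7[OF t4M_Sp4] d]) auto
  have 3: "\<forall>\<^sub>F n in sequentially. J n (\<lambda>z x b a. box \<U> \<P> \<U> \<U> z x b a \<and> z + a * b \<in> \<U>) (S7 (t4M w) (w ^ 3)) =
      (1 / real q) *\<^sub>R J n (\<lambda>z x b a. box \<U> \<O> \<U> \<U> z x b a \<and> z + a * b \<in> \<U>) (S7 (t4M w) (w ^ 3))"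
    by (rule scale_x_dummy[where Q = "\<lambda>z b a. z \<in> \<U> \<and> b \<in> \<U> \<and> a \<in> \<U> \<and> z + a * b \<in> \<U>",
          OF _ _ r(2) loc_subset[OF loc_S7[OF t4M_Sp4]] d])
      (auto intro: units_integers)
  show ?thesis
    using 1 2 3 J_T13_max_ideal J_T2_max_ideal J_T5_max_ideal
  proof eventually_elim
    case (elim n)
    \<comment> \<open>The unit \<open>x\<close> must be cancelled by \<open>z * b\<close> modulo
      \<open>\<P>\<close>, so \<open>z\<close> is a unit automatically.\<close>
    have B: "J n (\<lambda>z x b a. box \<O> \<U> \<U> \<O> z x b a \<and> z * b + x \<in> \<P>) F5 =
        J n (\<lambda>z x b a. box \<U> \<U> \<U> \<O> z x b a \<and> z * b + x \<in> \<P>) F5"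
    proof (rule J_cong)
      fix z x b a
      have "z \<in> \<U>" if "z \<in> \<O>" "x \<in> \<U>" "b \<in> \<U>" "z * b + x \<in> \<P>"
        using units_max_ideal_diff[OF that(4,2)] mult_unitsD[of z b] that units_integers by simp
      then show "box \<O> \<U> \<U> \<O> z x b a \<and> z * b + x \<in> \<P> \<longleftrightarrow> box \<U> \<U> \<U> \<O> z x b a \<and> z * b + x \<in> \<P>"
        using units_integers by auto
    qed simp
    show ?case
      unfolding J_split_z[of n "S7 (t4M w) (w ^ 3)"] elim(1) S7_scale B elim(6) elim(4,5)[symmetric] elim(2,3)
      using q_pos by simp
  qed
qed

text \<open>Successive valuations of \<open>z\<close> peel off T3, T6 and T9, each costing another
  \<open>1 / q\<close>; from valuation 3 on everything is T10. The condition on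
  \<open>x * z - b ^ 2\<close> restricts only the first piece, since it holds automatically for
  \<open>z\<close> in \<open>\<P>\<close>.\<close>

lemma J_C1':
  "\<forall>\<^sub>F n in sequentially. J n (\<lambda>z x b a. box \<O> \<U> \<U> \<O> z x b a \<and> x * z - b ^ 2 \<in> \<U>) (S1' (w ^ 3)) =
    J n (box (Ounits1 ord) \<U> \<U> \<O>) F3 + (1 / real q) *\<^sub>R J n (box \<U> \<U> \<U> \<O>) F6
    + (1 / real q ^ 2) *\<^sub>R J n (box \<U> \<U> \<U> \<O>) F9 + (1 / real q ^ 3) *\<^sub>R J n (box \<U> \<U> \<O> \<O>) F10"
proof -
  have r: "region (box \<O> \<U> \<U> \<O>)" by (intro region_box cg_set_intros)+
  have s: "\<forall>\<^sub>F n in sequentially. J n (box \<P> \<U> \<U> \<O>) (S1' c) =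
      (1 / real q) *\<^sub>R J n (box \<O> \<U> \<U> \<O>) (\<lambda>z x b a. S1' c (w * z) x b a)"
    for c
  proof (rule scale_z[where Q = "\<lambda>x b a. x \<in> \<U> \<and> b \<in> \<U> \<and> a \<in> \<O>", OF _ _ r])
    have "S1' c (w * z) x b a = S1' (c / w) z x b a" for z x b a by (simp add: S1'_def mult.commute)
    then show "loc (box \<O> \<U> \<U> \<O>) (\<lambda>z x b a. S1' c (w * z) x b a)" using loc_S1' by simp
  qed auto
  have split: "J n (box \<O> \<U> \<U> \<O>) f = J n (box \<U> \<U> \<U> \<O>) f + J n (box \<P> \<U> \<U> \<O>) f"
    for n and f :: "'f \<Rightarrow> 'f \<Rightarrow> 'f \<Rightarrow> 'f \<Rightarrow> 'v"
    unfolding J_split_units[of "box \<O> \<U> \<U> \<O>" "\<lambda>z x b a. z" n f, simplified]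
    by (intro arg_cong2[of _ _ _ _ "(+)"] J_cong) (auto intro: O_rules)
  show ?thesis
    using s[of "w ^ 3"] s[of "w ^ 2"] s[of w] J_T3 J_T6 J_T9 J_T10
  proof eventually_elim
    case (elim n)
    have s: "J n (box \<P> \<U> \<U> \<O>) (S1' (w ^ 3)) = (1 / real q) *\<^sub>R J n (box \<O> \<U> \<U> \<O>) (S1' (w ^ 2))"
      "J n (box \<P> \<U> \<U> \<O>) (S1' (w ^ 2)) = (1 / real q) *\<^sub>R J n (box \<O> \<U> \<U> \<O>) (S1' w)"
      "J n (box \<P> \<U> \<U> \<O>) (S1' w) = (1 / real q) *\<^sub>R J n (box \<O> \<U> \<U> \<O>) (S1' 1)"
      using elim(1-3) by (simp_all add: S1'_scale)
    let ?S = "\<lambda>z x b a. box \<O> \<U> \<U> \<O> z x b a \<and> x * z - b ^ 2 \<in> \<U>"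
    have "J n ?S (S1' (w ^ 3)) =
        J n (\<lambda>z x b a. ?S z x b a \<and> z \<in> \<U>) (S1' (w ^ 3))
        + J n (\<lambda>z x b a. ?S z x b a \<and> z \<in> \<P>) (S1' (w ^ 3))"
      by (rule J_split_units) auto
    also have "J n (\<lambda>z x b a. ?S z x b a \<and> z \<in> \<U>) (S1' (w ^ 3)) =
        J n (\<lambda>z x b a. box \<U> \<U> \<U> \<O> z x b a \<and> x * z - b ^ 2 \<in> \<U>) (S1' (w ^ 3))"
      by (rule J_cong) (auto intro: O_rules)
    also have "J n (\<lambda>z x b a. ?S z x b a \<and> z \<in> \<P>) (S1' (w ^ 3)) =
        J n (box \<P> \<U> \<U> \<O>) (S1' (w ^ 3))"
      by (rule J_cong) (auto intro: O_rules units_max_ideal_diff max_ideal_mult_right units_power)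
    finally show ?case
      unfolding s(1) split[of n "S1' (w ^ 2)"] s(2) split[of n "S1' w"] s(3) elim(4-7)
      by (simp add: scaleR_add_right power2_eq_square power3_eq_cube add.assoc)
  qed
qed

text \<open>Each of the five pieces is tied to a variable confined to \<open>\<P>\<close> except the
  T2 piece. Hence multiplying by \<open>q\<close> clears four coefficients and leaves
  \<open>q\<close> in front of T2.\<close>

lemma J_C1:
  "\<forall>\<^sub>F n in sequentially. real q *\<^sub>R J n (box \<O> \<U> \<U> \<U>) (S1 (t4M w) (w ^ 3)) =
    J n (\<lambda>z x b a. box \<O> \<U> \<U> \<O> z x b a \<and> z * b + x \<in> \<U>) F5
    + J n (\<lambda>z x b a. box \<O> \<U> \<U> \<O> z x b a \<and> x * z - b ^ 2 \<in> \<U>) (S1' (w ^ 3))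
    + J n (box (Ounits1 ord) \<U> \<U> \<O>) F13
    + real q *\<^sub>R J n (\<lambda>z x b a. box (Ounits1 ord) \<U> \<U> (Ounits1 ord) z x b a \<and> z - a \<in> \<U>) F2
    + J n (box (Ounits1 ord) \<U> \<U> \<O>) F8"
proof -
  have r: "region (\<lambda>z x b a. box \<O> \<U> \<U> \<U> z x b a \<and> a + x * b \<in> \<U>)"
    "region (\<lambda>z x b a. box \<O> \<U> \<U> \<O> z x b a \<and> z * b + x \<in> \<U>)"
    "region (\<lambda>z x b a. box \<O> \<U> \<U> \<O> z x b a \<and> x * z - b ^ 2 \<in> \<U>)"
    "region (box (Ounits1 ord) \<U> \<U> \<O>)"
    by (intro region_conj region_box cg_set_intros lip_intros)+
  have 1: "\<forall>\<^sub>F n in sequentially. J n (\<lambda>z x b a. box \<P> \<U> \<U> \<U> z x b a \<and> a + x * b \<in> \<U>) (S1 (t4M w) (w ^ 3)) =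
      (1 / real q) *\<^sub>R J n (\<lambda>z x b a. box \<O> \<U> \<U> \<U> z x b a \<and> a + x * b \<in> \<U>) (\<lambda>z x b a. S1 (t4M w) (w ^ 3) (w * z) x b a)"
    by (rule scale_z[where Q = "\<lambda>x b a. x \<in> \<U> \<and> b \<in> \<U> \<and> a \<in> \<U> \<and> a + x * b \<in> \<U>", OF _ _ r(1)])
      (auto simp: S1_scale intro: loc_subset[OF loc_S1] t4M_Sp4)
  have 2: "\<forall>\<^sub>F n in sequentially. J n (\<lambda>z x b a. box \<O> \<U> \<U> \<P> z x b a \<and> z * b + x \<in> \<U>) F5 =
      (1 / real q) *\<^sub>R J n (\<lambda>z x b a. box \<O> \<U> \<U> \<O> z x b a \<and> z * b + x \<in> \<U>) F5"
    by (rule scale_a_dummy[where Q = "\<lambda>x b z. z \<in> \<O> \<and> x \<in> \<U> \<and> b \<in> \<U> \<and> z * b + x \<in> \<U>", OF _ _ r(2) loc_subset[OF loc_F5]])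
      (auto simp: F5_def)
  have 3: "\<forall>\<^sub>F n in sequentially. J n (\<lambda>z x b a. box \<O> \<U> \<U> \<P> z x b a \<and> x * z - b ^ 2 \<in> \<U>) (S1' (w ^ 3)) =
      (1 / real q) *\<^sub>R J n (\<lambda>z x b a. box \<O> \<U> \<U> \<O> z x b a \<and> x * z - b ^ 2 \<in> \<U>) (S1' (w ^ 3))"
    by (rule scale_a_dummy[where Q = "\<lambda>x b z. z \<in> \<O> \<and> x \<in> \<U> \<and> b \<in> \<U> \<and> x * z - b ^ 2 \<in> \<U>", OF _ _ r(3) loc_subset[OF loc_S1']])
      (auto simp: S1'_def)
  have 4: "\<forall>\<^sub>F n in sequentially. J n (box (Ounits1 ord) \<U> \<U> \<P>) F8 = (1 / real q) *\<^sub>R J n (box (Ounits1 ord) \<U> \<U> \<O>) F8"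
    by (rule scale_a_dummy[where Q = "\<lambda>x b z. z \<in> Ounits1 ord \<and> x \<in> \<U> \<and> b \<in> \<U>", OF _ _ r(4) loc_F8])
      (auto simp: F8_def)
  show ?thesis
    using 1 2 3 4 J_T5_units J_C1_max_ideal J_T13_units J_T2_units J_T8
  proof eventually_elim
    case (elim n)
    let ?f = "S1 (t4M w) (w ^ 3)"
    let ?S = "\<lambda>z x b a. box \<O> \<U> \<U> \<U> z x b a \<and> z + a * b \<in> \<U>"
    let ?S' = "\<lambda>z x b a. box \<U> \<U> \<U> \<U> z x b a \<and> z + a * b \<in> \<U>"
    have "J n (box \<O> \<U> \<U> \<U>) ?f = J n ?S ?f
        + J n (\<lambda>z x b a. box \<O> \<U> \<U> \<U> z x b a \<and> z + a * b \<in> \<P>) ?f"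
      by (rule J_split_units) (auto intro: O_rules)
    also have "J n (\<lambda>z x b a. box \<O> \<U> \<U> \<U> z x b a \<and> z + a * b \<in> \<P>) ?f =
        J n (\<lambda>z x b a. box \<U> \<U> \<U> \<U> z x b a \<and> z + a * b \<in> \<P>) ?f"
      by (rule J_cong) (auto intro: O_rules z_units)
    also have "J n ?S ?f =
        J n (\<lambda>z x b a. ?S z x b a \<and> a + x * b \<in> \<U>) ?f
        + J n (\<lambda>z x b a. ?S z x b a \<and> a + x * b \<in> \<P>) ?f"
      by (rule J_split_units) (auto intro: O_rules)
    also have "J n (\<lambda>z x b a. ?S z x b a \<and> a + x * b \<in> \<U>) ?f =
        J n (\<lambda>z x b a. (?S z x b a \<and> a + x * b \<in> \<U>) \<and> z \<in> \<U>) ?f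
        + J n (\<lambda>z x b a. (?S z x b a \<and> a + x * b \<in> \<U>) \<and> z \<in> \<P>) ?f"
      by (rule J_split_units) auto
    also have "J n (\<lambda>z x b a. (?S z x b a \<and> a + x * b \<in> \<U>) \<and> z \<in> \<P>) ?f =
        J n (\<lambda>z x b a. box \<P> \<U> \<U> \<U> z x b a \<and> a + x * b \<in> \<U>) ?f"
      by (rule J_cong) (auto intro: O_rules sum_units)
    also have "J n (\<lambda>z x b a. (?S z x b a \<and> a + x * b \<in> \<U>) \<and> z \<in> \<U>) ?f =
        J n (\<lambda>z x b a. ?S' z x b a \<and> a + x * b \<in> \<U>) ?f"
      by (rule J_cong) (auto intro: O_rules)
    \<comment> \<open>This last split is needed only here: with \<open>z + a * b\<close> in
      \<open>\<P>\<close> the tested quantity is \<open>a ^ 2\<close> modulo \<open>\<P>\<close>,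
      and hence a unit anyway.\<close>
    also have "\<dots> =
        J n (\<lambda>z x b a. (?S' z x b a \<and> a + x * b \<in> \<U>) \<and> z * x + (a + x * b) * a \<in> \<U>) ?f
        + J n (\<lambda>z x b a. (?S' z x b a \<and> a + x * b \<in> \<U>) \<and> z * x + (a + x * b) * a \<in> \<P>) ?f"
      by (rule J_split_units) (auto intro: O_rules)
    finally show ?case
      unfolding elim(1) S1_scale elim(5-9) elim(2-4)
      using q_pos by (simp add: scaleR_add_right algebra_simps)
  qed
qed

end

theorem theorem4p2:
  fixes ord :: "'f::field_char_0 \<Rightarrow> int" and w :: 'f and q :: nat
    and chi :: "'f \<Rightarrow> real" and rho :: "'f^4^4 \<Rightarrow> 'v::real_vector \<Rightarrow> 'v" and v :: 'v
  assumes "nonarch_local_field ord w q"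
    and "quad_char_cond_p ord chi"
    and "smooth_rep_trivcent ord rho"
    and "v \<in> Vfix ord rho 0"
  shows "Tchi ord w q chi rho v =
           T1 ord w q chi rho v + T2 ord w q chi rho v + T3 ord w chi rho v
         + T4 ord w q chi rho v + T5 ord w chi rho v + T6 ord w q chi rho v
         + T7 ord w q chi rho v + T8 ord w chi rho v + T9 ord w q chi rho v
         + T10 ord w q chi rho v + T11 ord w q chi rho v + T12 ord w q chi rho v
         + T13 ord w chi rho v + T14 ord w q chi rho v"
proof -
  interpret unramified_vector ord w q chi rho v
    using assms by unfold_locales
  have "\<forall>\<^sub>F n::nat in sequentially. Tchi ord w q chi rho v =
           T1 ord w q chi rho v + T2 ord w q chi rho v + T3 ord w chi rho v
         + T4 ord w q chi rho v + T5 ord w chi rho v + T6 ord w q chi rho v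
         + T7 ord w q chi rho v + T8 ord w chi rho v + T9 ord w q chi rho v
         + T10 ord w q chi rho v + T11 ord w q chi rho v + T12 ord w q chi rho v
         + T13 ord w chi rho v + T14 ord w q chi rho v"
    using Tchi_J cells_J[OF Sp4_generators(8)[OF w_nonzero], of "w ^ 4"] cells_J[OF t4M_Sp4, of "w ^ 3"]
      J_T1 J_T7 J_T11 J_C1 J_C1' J_C7 J_C11
      T1_J T2_J T3_J T4_J T5_J T6_J T7_J T8_J T9_J T10_J T11_J T12_J T13_J T14_J
  proof eventually_elim
    case (elim n)
    \<comment> \<open>T5, T2 and T13 each arise in two halves, one from \<open>S7\<close> and one
      from \<open>S1\<close>; the three splits below reunite them.\<close>
    have F5: "J n (box \<O> \<U> \<U> \<O>) F5 = J n (\<lambda>z x b a. box \<O> \<U> \<U> \<O> z x b a \<and> z * b + x \<in> \<U>) F5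
        + J n (\<lambda>z x b a. box \<O> \<U> \<U> \<O> z x b a \<and> z * b + x \<in> \<P>) F5"
      by (rule J_split_units) (auto intro: O_rules)
    have F2: "J n (box (Ounits1 ord) \<U> \<U> (Ounits1 ord)) F2 =
        J n (\<lambda>z x b a. box (Ounits1 ord) \<U> \<U> (Ounits1 ord) z x b a \<and> z - a \<in> \<U>) F2
        + J n (\<lambda>z x b a. box (Ounits1 ord) \<U> \<U> (Ounits1 ord) z x b a \<and> z - a \<in> \<P>) F2"
      by (rule J_split_units) (auto simp: Ounits1_iff intro: O_rules)
    have "J n (box \<U> \<U> \<U> \<O>) F13 = J n (\<lambda>z x b a. box \<U> \<U> \<U> \<O> z x b a \<and> 1 - z \<in> \<U>) F13
        + J n (\<lambda>z x b a. box \<U> \<U> \<U> \<O> z x b a \<and> 1 - z \<in> \<P>) F13"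
      by (rule J_split_units) (auto intro: O_rules integers_1)
    also have "J n (\<lambda>z x b a. box \<U> \<U> \<U> \<O> z x b a \<and> 1 - z \<in> \<U>) F13 = J n (box (Ounits1 ord) \<U> \<U> \<O>) F13"
      by (rule J_cong) (auto simp: Ounits1_iff)
    finally have F13: "J n (box \<U> \<U> \<U> \<O>) F13 = J n (box (Ounits1 ord) \<U> \<U> \<O>) F13
        + J n (\<lambda>z x b a. box \<U> \<U> \<U> \<O> z x b a \<and> 1 - z \<in> \<P>) F13" .
    have q: "real q ^ 2 *\<^sub>R ((1 / real q) *\<^sub>R X + (1 / real q ^ 2) *\<^sub>R Y + Z) = real q *\<^sub>R X + Y + real q ^ 2 *\<^sub>R Z"
      "real q ^ 3 *\<^sub>R ((1 / real q) *\<^sub>R X + (1 / real q ^ 2) *\<^sub>R Y + Z) = real q ^ 2 *\<^sub>R X + real q *\<^sub>R Y + real q ^ 3 *\<^sub>R Z"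
      "real q ^ 2 *\<^sub>R (X + (1 / real q) *\<^sub>R Y + (1 / real q) *\<^sub>R Z) = real q ^ 2 *\<^sub>R X + real q *\<^sub>R Y + real q *\<^sub>R Z"
      for X Y Z :: 'v
      using q_pos by (simp_all add: scaleR_add_right power2_eq_square power3_eq_cube)
    show ?case
      unfolding elim(1) elim(2,3) q(1,2) elim(4-10) q(3) elim(11-24) F5 F2 F13
      by (simp add: scaleR_add_right inverse_eq_divide add_ac)
  qed
  \<comment> \<open>Neither side depends on \<open>n\<close>, so holding for large \<open>n\<close>
    means holding.\<close>
  then show ?thesis by simp
qed

end
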